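(* Let $\lambda\in\mathbb R$, $\lambda\notin\mathrm{Sp}(-\nabla\mathrm{div})\cup\mathrm{Sp}(\mathrm{rot})$, let $k,m\ge0$ be integers and let $\mathbf f=\mathbf f_{\mathcal A}+\mathbf f_{\mathbf V}\in\mathbf C(2k,m)\subset\mathbf L_2(\Omega)$. The problem of finding $\mathbf u\in\mathbf L_2(\Omega)$ with $$\nabla\mathrm{div}\,\mathbf u+\mathrm{rot}\,\mathbf u+\lambda\mathbf u=\mathbf f\ \text{ in }\Omega,\qquad\gamma(\mathbf n\cdot\mathbf u)=0\ \text{ (if this trace exists)}$$ has a unique solution, and it has the form $$\mathbf u=\mathbf u_{\mathcal A}+\mathbf u_{\mathbf V},\qquad\mathbf u_{\mathcal A}=(\mathcal N_d+\lambda I)^{-1}\mathbf f_{\mathcal A},\qquad\mathbf u_{\mathbf V}=(S+\lambda I)^{-1}\mathbf f_{\mathbf V}.$$ This solution belongs to $\mathbf C(2(k+1),m+1)$.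
   Context: $\Omega\subset\mathbb R^3$ is a bounded domain with smooth boundary, homeomorphic to a ball; $\mathbf n$ is the unit normal, $\gamma$ the boundary trace; $\mathbf L_2(\Omega)$ is the real Hilbert space of square integrable vector fields with inner product $(\cdot,\cdot)$. $\mathcal A=\{\nabla h:h\in H^1(\Omega)\}$, and $\mathcal B=\mathbf V^0$ is its orthogonal complement in $\mathbf L_2(\Omega)$; $\mathbf f_{\mathcal A}$, $\mathbf f_{\mathbf V}$ are the orthogonal projections of $\mathbf f$ on $\mathcal A$, $\mathbf V^0$. $\{\mathbf q_j\}$ is an orthonormal basis of $\mathcal A$ with $\mathbf q_j\in\mathbf C^\infty(\overline\Omega)$, $-\nabla\mathrm{div}\,\mathbf q_j=\nu_j^2\mathbf q_j$, $\gamma(\mathbf n\cdot\mathbf q_j)=0$, $0<\nu_1^2\le\nu_2^2\le\dots$. For $k\ge0$, $\mathbf A^{2k}=\{\mathbf f\in\mathcal A:\sum_j\nu_j^{4k}(\mathbf f,\mathbf q_j)^2<\infty\}$. $\mathcal N_d$, with domain $\mathbf A^2$, is the self-adjoint extension of $\nabla\mathrm{div}$: $\mathcal N_d\mathbf f=-\sum_j\nu_j^2(\mathbf f,\mathbf q_j)\mathbf q_j$. For $m\ge1$, $\mathbf W^m=\{\mathbf f\in\mathbf V^0,\ \mathrm{rot}\,\mathbf f\in\mathbf V^0,\dots,\mathrm{rot}^m\mathbf f\in\mathbf V^0\}$, $\mathbf W^0=\mathbf V^0$. $S$ is the self-adjoint operator in $\mathbf V^0$ with domain $\mathbf W^1$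 and $S\mathbf f=\mathrm{rot}\,\mathbf f$. Standing convention: its eigenvalues come in pairs $\pm\lambda_j$, $0<\lambda_1\le\lambda_2\le\dots$, and $\mathbf V^0$ has an orthonormal basis $\{\mathbf q_j^+,\mathbf q_j^-\}$ with $\mathrm{rot}\,\mathbf q_j^\pm=\pm\lambda_j\mathbf q_j^\pm$, $\gamma(\mathbf n\cdot\mathbf q_j^\pm)=0$. $\mathbf C(2k,m)=\mathbf A^{2k}\oplus\mathbf W^m$. The problem is understood via the extensions $\mathcal N_d$, $S$, i.e. as the pair of projected equations $(\mathcal N_d+\lambda I)\mathbf u_{\mathcal A}=\mathbf f_{\mathcal A}$ (with $\mathbf u_{\mathcal A}\in\mathbf A^2$) and $(S+\lambda I)\mathbf u_{\mathbf V}=\mathbf f_{\mathbf V}$ (with $\mathbf u_{\mathbf V}\in\mathbf W^1$). $\mathrm{Sp}(\mathrm{rot})$ is the set of real $\lambda$ for which $\mathrm{rot}\,\mathbf u=\lambda\mathbf u$, $\gamma(\mathbf n\cdot\mathbf u)=0$, has a nonzero solution, i.e. $\{0\}\cup\{\pm\lambda_j\}$; $\mathrm{Sp}(-\nabla\mathrm{div})$ is the set of real $\mu$ for which $-\nabla\mathrm{div}\,\mathbf v=\mu\mathbf v$, $\gamma(\mathbf n\cdot\mathbf v)=0$, has a nonzero solution, i.e. $\{0\}\cup\{\nu_j^2\}$. *)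

theory Defs
  imports "HOL-Analysis.Analysis"
begin

section \<open>The Hilbert space of square integrable fields\<close>

definition square_integrable :: "('a::euclidean_space \<Rightarrow> 'b::euclidean_space) \<Rightarrow> bool" where
  "square_integrable f \<longleftrightarrow>
     f \<in> borel_measurable lborel \<and> integrable lborel (\<lambda>x. (norm (f x))\<^sup>2)"

lemma square_integrable_inner:
  assumes "square_integrable f" "square_integrable g"
  shows "integrable lborel (\<lambda>x. f x \<bullet> g x)"
proof (rule Bochner_Integration.integrable_bound)
  show "integrable lborel (\<lambda>x. (norm (f x))\<^sup>2 + (norm (g x))\<^sup>2)"
    using assms by (intro Bochner_Integration.integrable_add) (simp_all add: square_integrable_def)
  show "(\<lambda>x. f x \<bullet> g x) \<in> borel_measurable lborel"
    using assms by (intro borel_measurable_inner) (simp_all add: square_integrable_def)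
  show "AE x in lborel. norm (f x \<bullet> g x) \<le> norm ((norm (f x))\<^sup>2 + (norm (g x))\<^sup>2)"
  proof (rule AE_I2)
    fix x
    have "\<bar>f x \<bullet> g x\<bar> \<le> norm (f x) * norm (g x)"
      by (rule Cauchy_Schwarz_ineq2)
    also have "\<dots> \<le> (norm (f x))\<^sup>2 + (norm (g x))\<^sup>2"
      using sum_squares_bound[of "norm (f x)" "norm (g x)"]
        mult_nonneg_nonneg[OF norm_ge_zero[of "f x"] norm_ge_zero[of "g x"]] by linarith
    finally show "norm (f x \<bullet> g x) \<le> norm ((norm (f x))\<^sup>2 + (norm (g x))\<^sup>2)"
      by simp
  qed
qed

lemma square_integrable_zero: "square_integrable (\<lambda>x. 0)"
  by (simp add: square_integrable_def)

lemma square_integrable_scaleR: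
  "square_integrable f \<Longrightarrow> square_integrable (\<lambda>x. c *\<^sub>R f x)"
  by (auto simp: square_integrable_def power_mult_distrib)

lemma square_integrable_add:
  assumes "square_integrable f" "square_integrable g"
  shows "square_integrable (\<lambda>x. f x + g x)"
proof -
  have "(norm (f x + g x))\<^sup>2 = (norm (f x))\<^sup>2 + 2 * (f x \<bullet> g x) + (norm (g x))\<^sup>2" for x
    by (simp add: power2_norm_eq_inner inner_add_left inner_add_right inner_commute)
  then show ?thesis
    using assms square_integrable_inner[OF assms] by (auto simp: square_integrable_def)
qed

lemma square_integrable_uminus:
  "square_integrable f \<Longrightarrow> square_integrable (\<lambda>x. - f x)"
  using square_integrable_scaleR[of f "-1"] by simp

lemma square_integrable_diff:
  "square_integrable f \<Longrightarrow> square_integrable g \<Longrightarrow> square_integrable (\<lambda>x. f x - g x)"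
  using square_integrable_add[of f "\<lambda>x. - g x"] square_integrable_uminus[of g] by simp

definition l2_rel ::
    "('a::euclidean_space \<Rightarrow> 'b::euclidean_space) \<Rightarrow> ('a \<Rightarrow> 'b) \<Rightarrow> bool" where
  "l2_rel f g \<longleftrightarrow> square_integrable f \<and> square_integrable g \<and> (AE x in lborel. f x = g x)"

lemma l2_rel_AE: "l2_rel f g \<Longrightarrow> AE x in lborel. f x = g x"
  by (simp add: l2_rel_def)

lemma l2_rel_comp:
  fixes f f' g g' :: "'a::euclidean_space \<Rightarrow> 'b::euclidean_space" and F :: "'b \<Rightarrow> 'b \<Rightarrow> 'b"
  assumes "l2_rel f f'" "l2_rel g g'"
    and "\<And>u v :: 'a \<Rightarrow> 'b. square_integrable u \<Longrightarrow> square_integrable v \<Longrightarrow>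
      square_integrable (\<lambda>x. F (u x) (v x))"
  shows "l2_rel (\<lambda>x. F (f x) (g x)) (\<lambda>x. F (f' x) (g' x))"
proof -
  have "AE x in lborel. F (f x) (g x) = F (f' x) (g' x)"
    using l2_rel_AE[OF assms(1)] l2_rel_AE[OF assms(2)] by eventually_elim simp
  then show ?thesis
    using assms(1,2) assms(3)[of f g] assms(3)[of f' g'] by (simp add: l2_rel_def)
qed

quotient_type (overloaded) ('a, 'b) l2 = "'a::euclidean_space \<Rightarrow> 'b::euclidean_space" / partial: l2_rel
proof (rule part_equivpI)
  show "\<exists>f::'a \<Rightarrow> 'b. l2_rel f f"
    by (rule exI[of _ "\<lambda>x. 0"]) (simp add: l2_rel_def square_integrable_zero)
  show "symp (l2_rel :: ('a \<Rightarrow> 'b) \<Rightarrow> _)"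
    by (auto intro!: sympI simp: l2_rel_def eq_commute)
  show "transp (l2_rel :: ('a \<Rightarrow> 'b) \<Rightarrow> _)"
  proof (rule transpI)
    fix f g h :: "'a \<Rightarrow> 'b"
    assume fg: "l2_rel f g" and gh: "l2_rel g h"
    have "AE x in lborel. f x = h x"
      using l2_rel_AE[OF fg] l2_rel_AE[OF gh] by eventually_elim simp
    then show "l2_rel f h"
      using fg gh by (simp add: l2_rel_def)
  qed
qed

instantiation l2 :: (euclidean_space, euclidean_space) real_vector
begin

lift_definition zero_l2 :: "('a, 'b) l2" is "\<lambda>x. 0"
  by (simp add: l2_rel_def square_integrable_zero)

lift_definition plus_l2 :: "('a, 'b) l2 \<Rightarrow> ('a, 'b) l2 \<Rightarrow> ('a, 'b) l2"
  is "\<lambda>f g x. f x + g x"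
  by (rule l2_rel_comp[where F = "(+)"]) (rule square_integrable_add | assumption)+

lift_definition minus_l2 :: "('a, 'b) l2 \<Rightarrow> ('a, 'b) l2 \<Rightarrow> ('a, 'b) l2"
  is "\<lambda>f g x. f x - g x"
  by (rule l2_rel_comp[where F = "(-)"]) (rule square_integrable_diff | assumption)+

lift_definition uminus_l2 :: "('a, 'b) l2 \<Rightarrow> ('a, 'b) l2" is "\<lambda>f x. - f x"
proof -
  fix f g :: "'a \<Rightarrow> 'b"
  assume fg: "l2_rel f g"
  show "l2_rel (\<lambda>x. - f x) (\<lambda>x. - g x)"
    by (rule l2_rel_comp[where F = "\<lambda>y _. - y", OF fg fg]) (rule square_integrable_uminus | assumption)+
qed

lift_definition scaleR_l2 :: "real \<Rightarrow> ('a, 'b) l2 \<Rightarrow> ('a, 'b) l2" is "\<lambda>c f x. c *\<^sub>R f x"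
proof -
  fix c :: real and f g :: "'a \<Rightarrow> 'b"
  assume fg: "l2_rel f g"
  show "l2_rel (\<lambda>x. c *\<^sub>R f x) (\<lambda>x. c *\<^sub>R g x)"
    by (rule l2_rel_comp[where F = "\<lambda>y _. c *\<^sub>R y", OF fg fg]) (rule square_integrable_scaleR | assumption)+
qed

instance
proof
  fix u v w :: "('a, 'b) l2" and a b :: real
  show "u + v + w = u + (v + w)"
    by transfer (auto simp: l2_rel_def square_integrable_add add.assoc)
  show "u + v = v + u"
    by transfer (auto simp: l2_rel_def square_integrable_add add.commute)
  show "0 + u = u" by transfer (auto simp: l2_rel_def)
  show "- u + u = 0" by transfer (auto simp: l2_rel_def square_integrable_zero)
  show "u - v = u + - v"
    by transfer (auto simp: l2_rel_def square_integrable_diff)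
  show "a *\<^sub>R (u + v) = a *\<^sub>R u + a *\<^sub>R v"
    by transfer (auto simp: l2_rel_def scaleR_add_right
        intro!: square_integrable_add square_integrable_scaleR)
  show "(a + b) *\<^sub>R u = a *\<^sub>R u + b *\<^sub>R u"
    by transfer (auto simp: l2_rel_def scaleR_add_left
        intro!: square_integrable_add square_integrable_scaleR)
  show "a *\<^sub>R b *\<^sub>R u = (a * b) *\<^sub>R u"
    by transfer (auto simp: l2_rel_def intro!: square_integrable_scaleR)
  show "1 *\<^sub>R u = u" by transfer (auto simp: l2_rel_def)
qed

end

instantiation l2 :: (euclidean_space, euclidean_space) real_inner
begin

lift_definition inner_l2 :: "('a, 'b) l2 \<Rightarrow> ('a, 'b) l2 \<Rightarrow> real"
  is "\<lambda>f g. LINT x|lborel. f x \<bullet> g x"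
proof -
  fix f f' g g' :: "'a \<Rightarrow> 'b"
  assume r: "l2_rel f f'" "l2_rel g g'"
  have "AE x in lborel. f x \<bullet> g x = f' x \<bullet> g' x"
    using l2_rel_AE[OF r(1)] l2_rel_AE[OF r(2)] by eventually_elim simp
  moreover have "integrable lborel (\<lambda>x. f x \<bullet> g x)" "integrable lborel (\<lambda>x. f' x \<bullet> g' x)"
    using r by (simp_all add: l2_rel_def square_integrable_inner)
  ultimately show "(LINT x|lborel. f x \<bullet> g x) = (LINT x|lborel. f' x \<bullet> g' x)"
    by (intro integral_cong_AE borel_measurable_integrable)
qed

definition norm_l2 :: "('a, 'b) l2 \<Rightarrow> real" where
  "norm_l2 u = sqrt (u \<bullet> u)"

definition sgn_l2 :: "('a, 'b) l2 \<Rightarrow> ('a, 'b) l2" where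
  "sgn_l2 u = u /\<^sub>R norm u"

definition dist_l2 :: "('a, 'b) l2 \<Rightarrow> ('a, 'b) l2 \<Rightarrow> real" where
  "dist_l2 u v = norm (u - v)"

definition uniformity_l2 :: "(('a, 'b) l2 \<times> ('a, 'b) l2) filter" where
  "uniformity_l2 = (INF e\<in>{0<..}. principal {(u, v). dist u v < e})"

definition open_l2 :: "('a, 'b) l2 set \<Rightarrow> bool" where
  "open_l2 U \<longleftrightarrow> (\<forall>u\<in>U. eventually (\<lambda>(u', v). u' = u \<longrightarrow> v \<in> U) uniformity)"

instance
proof
  fix u v w :: "('a, 'b) l2" and r :: real
  show "u \<bullet> v = v \<bullet> u" by transfer (simp add: inner_commute)
  show "(u + v) \<bullet> w = u \<bullet> w + v \<bullet> w"
    by transfer (simp add: inner_add_left l2_rel_def square_integrable_inner)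
  show "(r *\<^sub>R u) \<bullet> v = r * (u \<bullet> v)" by transfer simp
  show "0 \<le> u \<bullet> u" by transfer simp
  show "(u \<bullet> u = 0) = (u = 0)"
  proof transfer
    fix f :: "'a \<Rightarrow> 'b"
    assume f: "l2_rel f f"
    then have "((LINT x|lborel. f x \<bullet> f x) = 0) = (AE x in lborel. f x \<bullet> f x = 0)"
      by (intro integral_nonneg_eq_0_iff_AE square_integrable_inner) (auto simp: l2_rel_def)
    then show "((LINT x|lborel. f x \<bullet> f x) = 0) = l2_rel f (\<lambda>x. 0)"
      using f by (simp add: l2_rel_def square_integrable_zero)
  qed
qed (rule dist_l2_def sgn_l2_def uniformity_l2_def open_l2_def norm_l2_def)+

end

text \<open>\<open>L2 \<Omega>\<close> is realised isometrically inside \<open>L2\<close> of the whole space, as the classes vanishing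
  almost everywhere outside \<open>\<Omega>\<close> (extension by zero).\<close>

lift_definition vanishes_off :: "'a::euclidean_space set \<Rightarrow> ('a, 'b::euclidean_space) l2 \<Rightarrow> bool"
  is "\<lambda>\<Omega> f. AE x in lborel. x \<notin> \<Omega> \<longrightarrow> f x = 0"
proof -
  fix \<Omega> :: "'a set" and f g :: "'a \<Rightarrow> 'b"
  assume fg: "l2_rel f g"
  have "AE x in lborel. (x \<notin> \<Omega> \<longrightarrow> f x = 0) = (x \<notin> \<Omega> \<longrightarrow> g x = 0)"
    using l2_rel_AE[OF fg] by eventually_elim simp
  then show "(AE x in lborel. x \<notin> \<Omega> \<longrightarrow> f x = 0) = (AE x in lborel. x \<notin> \<Omega> \<longrightarrow> g x = 0)"
    by (rule eventually_subst)
qed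

definition L2 :: "'a::euclidean_space set \<Rightarrow> ('a, 'b::euclidean_space) l2 set" where
  "L2 \<Omega> = {u. vanishes_off \<Omega> u}"

text \<open>\<open>l2_of f\<close> is unspecified unless \<open>f\<close> is square integrable.\<close>
abbreviation l2_of :: "('a::euclidean_space \<Rightarrow> 'b::euclidean_space) \<Rightarrow> ('a, 'b) l2" where
  "l2_of \<equiv> abs_l2"

type_synonym scalar_l2 = "(real^3, real) l2"
type_synonym vector_l2 = "(real^3, real^3) l2"


section \<open>Smooth functions and smooth domains\<close>

fun Ck_on :: "nat \<Rightarrow> 'a::real_normed_vector set \<Rightarrow> ('a \<Rightarrow> 'b::real_normed_vector) \<Rightarrow> bool" where
  "Ck_on 0 U f \<longleftrightarrow> continuous_on U f"
| "Ck_on (Suc k) U f \<longleftrightarrow>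
     f differentiable_on U \<and> (\<forall>v. Ck_on k U (\<lambda>x. frechet_derivative f (at x) v))"

text \<open>Only meant for open \<open>U\<close>.\<close>
definition smooth_on :: "'a::real_normed_vector set \<Rightarrow> ('a \<Rightarrow> 'b::real_normed_vector) \<Rightarrow> bool" where
  "smooth_on U f \<longleftrightarrow> (\<forall>k. Ck_on k U f)"

definition smooth_boundary :: "'a::euclidean_space set \<Rightarrow> bool" where
  "smooth_boundary \<Omega> \<longleftrightarrow>
     (\<forall>p\<in>frontier \<Omega>. \<exists>U (\<rho> :: 'a \<Rightarrow> real). open U \<and> p \<in> U \<and> smooth_on U \<rho> \<and>
        (\<forall>x\<in>U. \<exists>v. frechet_derivative \<rho> (at x) v \<noteq> 0) \<and> \<Omega> \<inter> U = {x\<in>U. \<rho> x < 0})"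

text \<open>\<open>C\<^sup>\<infinity>\<close> up to the boundary: restriction of a smooth function on the whole space.\<close>
definition smooth_closure :: "'a::euclidean_space set \<Rightarrow> ('a, 'b::euclidean_space) l2 \<Rightarrow> bool" where
  "smooth_closure \<Omega> u \<longleftrightarrow>
     (\<exists>g. smooth_on UNIV g \<and> (AE x in lborel. x \<in> \<Omega> \<longrightarrow> rep_l2 u x = g x))"

definition test_function :: "'a::euclidean_space set \<Rightarrow> ('a \<Rightarrow> 'b::euclidean_space) \<Rightarrow> bool" where
  "test_function \<Omega> \<phi> \<longleftrightarrow>
     smooth_on UNIV \<phi> \<and> (\<exists>K. compact K \<and> K \<subseteq> \<Omega> \<and> (\<forall>x. x \<notin> K \<longrightarrow> \<phi> x = 0))"


section \<open>Gradient, divergence and rotor\<close>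

definition partial_deriv :: "3 \<Rightarrow> (real^3 \<Rightarrow> 'b::real_normed_vector) \<Rightarrow> real^3 \<Rightarrow> 'b" where
  "partial_deriv i f x = frechet_derivative f (at x) (axis i 1)"

definition grad :: "(real^3 \<Rightarrow> real) \<Rightarrow> real^3 \<Rightarrow> real^3" where
  "grad h x = (\<chi> i. partial_deriv i h x)"

definition divg :: "(real^3 \<Rightarrow> real^3) \<Rightarrow> real^3 \<Rightarrow> real" where
  "divg u x = (\<Sum>i\<in>UNIV. partial_deriv i u x $ i)"

definition curl :: "(real^3 \<Rightarrow> real^3) \<Rightarrow> real^3 \<Rightarrow> real^3" where
  "curl u x = vector
     [partial_deriv 2 u x $ 3 - partial_deriv 3 u x $ 2,
      partial_deriv 3 u x $ 1 - partial_deriv 1 u x $ 3,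
      partial_deriv 1 u x $ 2 - partial_deriv 2 u x $ 1]"

text \<open>The operators on \<open>L2 \<Omega>\<close> are taken in the sense of distributions on \<open>\<Omega>\<close>, with values in
  \<open>L2 \<Omega>\<close>.\<close>

definition has_grad :: "(real^3) set \<Rightarrow> scalar_l2 \<Rightarrow> vector_l2 \<Rightarrow> bool" where
  "has_grad \<Omega> h g \<longleftrightarrow> h \<in> L2 \<Omega> \<and> g \<in> L2 \<Omega> \<and>
     (\<forall>\<phi>. test_function \<Omega> \<phi> \<longrightarrow> h \<bullet> l2_of (divg \<phi>) = - (g \<bullet> l2_of \<phi>))"

definition has_div :: "(real^3) set \<Rightarrow> vector_l2 \<Rightarrow> scalar_l2 \<Rightarrow> bool" where
  "has_div \<Omega> u d \<longleftrightarrow> u \<in> L2 \<Omega> \<and> d \<in> L2 \<Omega> \<and>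
     (\<forall>\<phi>. test_function \<Omega> \<phi> \<longrightarrow> u \<bullet> l2_of (grad \<phi>) = - (d \<bullet> l2_of \<phi>))"

definition has_rot :: "(real^3) set \<Rightarrow> vector_l2 \<Rightarrow> vector_l2 \<Rightarrow> bool" where
  "has_rot \<Omega> u w \<longleftrightarrow> u \<in> L2 \<Omega> \<and> w \<in> L2 \<Omega> \<and>
     (\<forall>\<phi>. test_function \<Omega> \<phi> \<longrightarrow> u \<bullet> l2_of (curl \<phi>) = w \<bullet> l2_of \<phi>)"

definition has_grad_div :: "(real^3) set \<Rightarrow> vector_l2 \<Rightarrow> vector_l2 \<Rightarrow> bool" where
  "has_grad_div \<Omega> u w \<longleftrightarrow> (\<exists>d. has_div \<Omega> u d \<and> has_grad \<Omega> d w)"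

definition rot :: "(real^3) set \<Rightarrow> vector_l2 \<Rightarrow> vector_l2" where
  "rot \<Omega> u = (THE w. has_rot \<Omega> u w)"

text \<open>The trace of the normal component on the boundary exists, as a functional on \<open>H\<^sup>1 \<Omega>\<close>, for the
  fields in \<open>L2 \<Omega>\<close> with divergence in \<open>L2 \<Omega>\<close>.  It is given by Green's formula
  \<open>\<langle>\<gamma>(n \<cdot> u), h\<rangle> = (u, grad h) + (div u, h)\<close>; for a field smooth up to the boundary the right-hand
  side is the boundary integral of \<open>(n \<cdot> u) h\<close>, with \<open>n\<close> the outer unit normal.\<close>

definition normal_trace_exists :: "(real^3) set \<Rightarrow> vector_l2 \<Rightarrow> bool" where
  "normal_trace_exists \<Omega> u \<longleftrightarrow> (\<exists>d. has_div \<Omega> u d)"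

definition normal_trace_zero :: "(real^3) set \<Rightarrow> vector_l2 \<Rightarrow> bool" where
  "normal_trace_zero \<Omega> u \<longleftrightarrow>
     (\<exists>d. has_div \<Omega> u d \<and> (\<forall>h g. has_grad \<Omega> h g \<longrightarrow> u \<bullet> g + d \<bullet> h = 0))"

definition Sp_rot :: "(real^3) set \<Rightarrow> real set" where
  "Sp_rot \<Omega> = {\<mu>. \<exists>u. u \<noteq> 0 \<and> has_rot \<Omega> u (\<mu> *\<^sub>R u) \<and> normal_trace_zero \<Omega> u}"

definition Sp_neg_grad_div :: "(real^3) set \<Rightarrow> real set" where
  "Sp_neg_grad_div \<Omega> =
     {\<mu>. \<exists>v. v \<noteq> 0 \<and> has_grad_div \<Omega> v (- (\<mu> *\<^sub>R v)) \<and> normal_trace_zero \<Omega> v}"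


section \<open>Hilbert space notions\<close>

definition orthonormal_basis :: "('i \<Rightarrow> 'h::real_inner) \<Rightarrow> 'h set \<Rightarrow> bool" where
  "orthonormal_basis e H \<longleftrightarrow>
     (\<forall>i j. e i \<bullet> e j = (if i = j then 1 else 0)) \<and> closure (span (range e)) = H"

definition orth_proj :: "'h::real_inner set \<Rightarrow> 'h \<Rightarrow> 'h" where
  "orth_proj H f = (THE g. g \<in> H \<and> (\<forall>v\<in>H. orthogonal (f - g) v))"

definition adjoint_dom :: "'h::real_inner set \<Rightarrow> 'h set \<Rightarrow> ('h \<Rightarrow> 'h) \<Rightarrow> 'h set" where
  "adjoint_dom H D T = {v\<in>H. \<exists>w\<in>H. \<forall>u\<in>D. T u \<bullet> v = u \<bullet> w}"

text \<open>\<open>T\<close>, with domain \<open>D\<close> dense in \<open>H\<close>, coincides with its adjoint in \<open>H\<close>.\<close>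
definition self_adjoint_in :: "'h::real_inner set \<Rightarrow> 'h set \<Rightarrow> ('h \<Rightarrow> 'h) \<Rightarrow> bool" where
  "self_adjoint_in H D T \<longleftrightarrow>
     D \<subseteq> H \<and> subspace D \<and> H \<subseteq> closure D \<and> T ` D \<subseteq> H \<and>
     (\<forall>u\<in>D. \<forall>v\<in>D. \<forall>a b. T (a *\<^sub>R u + b *\<^sub>R v) = a *\<^sub>R T u + b *\<^sub>R T v) \<and>
     adjoint_dom H D T = D \<and> (\<forall>u\<in>D. \<forall>v\<in>D. T u \<bullet> v = u \<bullet> T v)"


section \<open>The spaces and the operators of the problem\<close>

definition spaceA :: "(real^3) set \<Rightarrow> vector_l2 set" where
  "spaceA \<Omega> = {g. \<exists>h. has_grad \<Omega> h g}"

definition spaceV :: "(real^3) set \<Rightarrow> vector_l2 set" where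
  "spaceV \<Omega> = L2 \<Omega> \<inter> (spaceA \<Omega>)\<^sup>\<bottom>"

text \<open>\<open>spaceA_pow \<Omega> \<nu> q k\<close> is the space \<open>A\<^sup>2\<^sup>k\<close>.\<close>
definition spaceA_pow ::
    "(real^3) set \<Rightarrow> (nat \<Rightarrow> real) \<Rightarrow> (nat \<Rightarrow> vector_l2) \<Rightarrow> nat \<Rightarrow> vector_l2 set" where
  "spaceA_pow \<Omega> \<nu> q k = {f \<in> spaceA \<Omega>. summable (\<lambda>j. \<nu> j ^ (4 * k) * (f \<bullet> q j)\<^sup>2)}"

fun spaceW :: "(real^3) set \<Rightarrow> nat \<Rightarrow> vector_l2 set" where
  "spaceW \<Omega> 0 = spaceV \<Omega>"
| "spaceW \<Omega> (Suc m) = {f \<in> spaceV \<Omega>. \<exists>w\<in>spaceW \<Omega> m. has_rot \<Omega> f w}"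

text \<open>\<open>spaceC \<Omega> \<nu> q k m\<close> is the space \<open>C(2k, m)\<close>.\<close>
definition spaceC ::
    "(real^3) set \<Rightarrow> (nat \<Rightarrow> real) \<Rightarrow> (nat \<Rightarrow> vector_l2) \<Rightarrow> nat \<Rightarrow> nat \<Rightarrow> vector_l2 set" where
  "spaceC \<Omega> \<nu> q k m = {a + v | a v. a \<in> spaceA_pow \<Omega> \<nu> q k \<and> v \<in> spaceW \<Omega> m}"

definition opN :: "(nat \<Rightarrow> real) \<Rightarrow> (nat \<Rightarrow> vector_l2) \<Rightarrow> vector_l2 \<Rightarrow> vector_l2" where
  "opN \<nu> q f = - (\<Sum>j. ((\<nu> j)\<^sup>2 * (f \<bullet> q j)) *\<^sub>R q j)"

abbreviation opS :: "(real^3) set \<Rightarrow> vector_l2 \<Rightarrow> vector_l2" where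
  "opS \<equiv> rot"

text \<open>The inverses of \<open>opN + \<lambda> I\<close> on the domain \<open>A\<^sup>2\<close> and of \<open>opS + \<lambda> I\<close> on the domain \<open>W\<^sup>1\<close>.\<close>

definition resolventN ::
    "(real^3) set \<Rightarrow> (nat \<Rightarrow> real) \<Rightarrow> (nat \<Rightarrow> vector_l2) \<Rightarrow> real \<Rightarrow> vector_l2 \<Rightarrow> vector_l2" where
  "resolventN \<Omega> \<nu> q lam = the_inv_into (spaceA_pow \<Omega> \<nu> q 1) (\<lambda>v. opN \<nu> q v + lam *\<^sub>R v)"

definition resolventS :: "(real^3) set \<Rightarrow> real \<Rightarrow> vector_l2 \<Rightarrow> vector_l2" where
  "resolventS \<Omega> lam = the_inv_into (spaceW \<Omega> 1) (\<lambda>v. opS \<Omega> v + lam *\<^sub>R v)"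

text \<open>The boundary value problem \<open>grad div u + rot u + \<lambda> u = f\<close>, \<open>\<gamma>(n \<cdot> u) = 0\<close>, understood through
  the extensions \<open>opN\<close> and \<open>opS\<close> applied to the projections of \<open>u\<close>.\<close>
definition solves_problem ::
    "(real^3) set \<Rightarrow> (nat \<Rightarrow> real) \<Rightarrow> (nat \<Rightarrow> vector_l2) \<Rightarrow> real \<Rightarrow> vector_l2 \<Rightarrow> vector_l2 \<Rightarrow> bool" where
  "solves_problem \<Omega> \<nu> q lam f u \<longleftrightarrow>
     (let uA = orth_proj (spaceA \<Omega>) u; uV = orth_proj (spaceV \<Omega>) u in
        u \<in> L2 \<Omega> \<and> uA \<in> spaceA_pow \<Omega> \<nu> q 1 \<and> uV \<in> spaceW \<Omega> 1 \<and>
        opN \<nu> q uA + lam *\<^sub>R uA = orth_proj (spaceA \<Omega>) f \<and>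
        opS \<Omega> uV + lam *\<^sub>R uV = orth_proj (spaceV \<Omega>) f \<and>
        (normal_trace_exists \<Omega> u \<longrightarrow> normal_trace_zero \<Omega> u))"

end

(* Both operators are diagonal in the given orthonormal bases, so the resolvents exist as soon as the
   eigenvalues stay away from lam.  The hypotheses only say that lam is not an eigenvalue; that the
   eigenvalues do not accumulate at lam follows without any compactness: monotone eigenvalues that
   do not tend to infinity are bounded, and then grad (respectively rot, on solenoidal fields) would
   be a bounded operator, which the restrictions of sin (n x1) and cos (n x1) to the domain refute.
   The boundary condition for the sum holds because the solenoidal part has trace zero, and div q_j
   is an orthogonal sequence with norms |nu_j|, so that the divergence series of the gradient part
   converges. *)

theory Submission
  imports Defs
begin

section \<open>Orthonormal sequences and diagonal operators\<close>

text \<open>The trial fields satisfy no boundary condition, so they need not lie in the domain of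
  either operator. For gradients this is harmless: the zero trace of \<open>q j\<close> lets Green's
  formula pair it with every potential having a square integrable gradient, so that the coefficients
  of a gradient are, up to sign, \<open>\<nu> j\<close> times those of its potential in the
  normalised divergences \<open>p j\<close>. For the rotor, the trial field is first stripped of its
  gradient part; this keeps the rotor and lands in \<open>spaceV\<close>, where bounded eigenvalues
  would make the domain everything. The two operators enter differently. \<open>opN\<close> is given
  by its series, so its domain is a condition on coefficients; \<open>spaceW \<Omega> 1\<close> is
  given by weak rotors, and self-adjointness is what lets coefficients decide membership in it. All
  solutions are sums of series in the quotient space of square integrable fields, hence its
  completeness is proved; weak rotors and divergences are chosen by description, hence the totality
  of test functions is proved.\<close>

lemma subspace_closure:
  fixes S :: "'a::real_normed_vector set"
  assumes "subspace S"
  shows "subspace (closure S)"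
proof (rule subspaceI)
  show "0 \<in> closure S"
    using subspace_0[OF assms] closure_subset by blast
  show "x + y \<in> closure S" if xy: "x \<in> closure S" "y \<in> closure S" for x y
  proof -
    obtain f g where "\<And>n. f n \<in> S" "f \<longlonglongrightarrow> x" "\<And>n. g n \<in> S" "g \<longlonglongrightarrow> y"
      using xy by (auto simp: closure_sequential)
    then show ?thesis
      unfolding closure_sequential
      by (intro exI[of _ "\<lambda>n. f n + g n"]) (auto intro!: tendsto_add subspace_add assms)
  qed
  show "c *\<^sub>R x \<in> closure S" if x: "x \<in> closure S" for c x
  proof -
    obtain f where "\<And>n. f n \<in> S" "f \<longlonglongrightarrow> x"
      using x by (auto simp: closure_sequential)
    then show ?thesis
      unfolding closure_sequential
      by (intro exI[of _ "\<lambda>n. c *\<^sub>R f n"]) (auto intro!: tendsto_scaleR subspace_scale assms)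
  qed
qed

text \<open>The bounded multipliers \<open>b\<close> are the spectral factors met below: those of
  the resolvents, of the regularity gain and of the divergence series.\<close>

lemma summable_sq_mult:
  assumes "\<And>j. \<bar>b j\<bar> \<le> B" "summable (\<lambda>j. (c j)\<^sup>2)"
  shows "summable (\<lambda>j. (b j * c j :: real)\<^sup>2)"
proof (rule summable_comparison_test')
  show "summable (\<lambda>j. B\<^sup>2 * (c j)\<^sup>2)"
    by (rule summable_mult[OF assms(2)])
  show "norm ((b j * c j)\<^sup>2) \<le> B\<^sup>2 * (c j)\<^sup>2" for j
    using power_mono[OF assms(1)[of j], of 2] by (simp add: power_mult_distrib mult_right_mono)
qed

locale orthonormal_seq =
  fixes e :: "nat \<Rightarrow> 'h::{real_inner, banach}"
  assumes ortho: "e i \<bullet> e j = (if i = j then 1 else 0)"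
begin

lemma norm_sum_sq:
  assumes "finite I"
  shows "(norm (\<Sum>i\<in>I. c i *\<^sub>R e i))\<^sup>2 = (\<Sum>i\<in>I. (c i)\<^sup>2)"
proof -
  have "(\<Sum>j\<in>I. c j * (if j = i then 1 else 0)) = c i" if "i \<in> I" for i
  proof -
    have "(\<Sum>j\<in>I. c j * (if j = i then 1 else 0)) = (\<Sum>j\<in>I. if j = i then c j else 0)"
      by (rule sum.cong) auto
    then show ?thesis
      using that assms by simp
  qed
  then show ?thesis
    unfolding power2_norm_eq_inner
    by (simp add: inner_sum_left inner_sum_right ortho power2_eq_square)
qed

lemma bessel_partial: "(\<Sum>j<n. (x \<bullet> e j)\<^sup>2) \<le> (norm x)\<^sup>2"
proof -
  define s where "s = (\<Sum>j<n. (x \<bullet> e j) *\<^sub>R e j)"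
  have xs: "x \<bullet> s = (\<Sum>j<n. (x \<bullet> e j)\<^sup>2)"
    by (simp add: s_def inner_sum_right power2_eq_square)
  have ss: "s \<bullet> s = (\<Sum>j<n. (x \<bullet> e j)\<^sup>2)"
    using norm_sum_sq[of "{..<n}" "\<lambda>j. x \<bullet> e j"] by (simp add: s_def power2_norm_eq_inner)
  have "0 \<le> (x - s) \<bullet> (x - s)"
    by simp
  then show ?thesis
    by (simp add: inner_diff_left inner_diff_right xs ss inner_commute[of s x] power2_norm_eq_inner)
qed

lemma bessel_summable: "summable (\<lambda>j. (x \<bullet> e j)\<^sup>2)"
  by (rule summableI_nonneg_bounded[where x = "(norm x)\<^sup>2"]) (simp_all add: bessel_partial)

lemma bessel: "(\<Sum>j. (x \<bullet> e j)\<^sup>2) \<le> (norm x)\<^sup>2"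
  by (rule suminf_le_const[OF bessel_summable bessel_partial])

text \<open>Pythagoras turns the norm of a block of the series into a block of the sum of squares,
  so the Cauchy criterion passes from the scalars to the vectors.\<close>

lemma summable_series:
  assumes "summable (\<lambda>j. (c j)\<^sup>2)"
  shows "summable (\<lambda>j. c j *\<^sub>R e j)"
  unfolding summable_Cauchy
proof (intro allI impI)
  fix \<epsilon> :: real assume \<epsilon>: "0 < \<epsilon>"
  then obtain N where N: "norm (\<Sum>j=m..<n. (c j)\<^sup>2) < \<epsilon>\<^sup>2" if "m \<ge> N" for m n
    using assms[unfolded summable_Cauchy] by (meson zero_less_power)
  have "norm (\<Sum>j=m..<n. c j *\<^sub>R e j) < \<epsilon>" if "m \<ge> N" for m n
  proof -
    have "(norm (\<Sum>j=m..<n. c j *\<^sub>R e j))\<^sup>2 < \<epsilon>\<^sup>2"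
      using N[OF that, of n] by (simp add: norm_sum_sq sum_nonneg)
    then show ?thesis
      using \<epsilon> by (simp add: power_less_imp_less_base)
  qed
  then show "\<exists>N. \<forall>m\<ge>N. \<forall>n. norm (\<Sum>j=m..<n. c j *\<^sub>R e j) < \<epsilon>"
    by blast
qed

lemma series_inner:
  assumes "summable (\<lambda>j. (c j)\<^sup>2)"
  shows "(\<lambda>j. c j * (e j \<bullet> y)) sums ((\<Sum>j. c j *\<^sub>R e j) \<bullet> y)"
  using bounded_linear.sums[OF bounded_linear_inner_left summable_sums[OF summable_series[OF assms]], of y]
  by simp

lemma series_coeff:
  assumes "summable (\<lambda>j. (c j)\<^sup>2)"
  shows "(\<Sum>j. c j *\<^sub>R e j) \<bullet> e k = c k"
proof -
  have "(\<lambda>j. c j * (e j \<bullet> e k)) = (\<lambda>j. if j = k then c j else 0)"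
    by (auto simp: ortho)
  then have "(\<lambda>j. c j * (e j \<bullet> e k)) sums c k"
    using sums_single[of k c] by simp
  then show ?thesis
    by (rule sums_unique2[OF series_inner[OF assms]])
qed

definition H :: "'h set" where "H = closure (span (range e))"

lemma subspace_H: "subspace H"
  unfolding H_def by (rule subspace_closure[OF subspace_span])

lemma closed_H: "closed H"
  by (simp add: H_def)

lemma e_in_H: "e j \<in> H"
  unfolding H_def by (rule subsetD[OF closure_subset span_base]) simp

lemma series_in_H:
  assumes "summable (\<lambda>j. (c j)\<^sup>2)"
  shows "(\<Sum>j. c j *\<^sub>R e j) \<in> H"
proof (rule closed_sequentially[OF closed_H])
  show "(\<lambda>n. \<Sum>j<n. c j *\<^sub>R e j) \<longlonglongrightarrow> (\<Sum>j. c j *\<^sub>R e j)"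
    by (rule summable_LIMSEQ[OF summable_series[OF assms]])
  show "(\<Sum>j<n. c j *\<^sub>R e j) \<in> H" for n
    by (intro subspace_sum subspace_H subspace_scale e_in_H)
qed

text \<open>The vectors orthogonal to \<open>x\<close> form a closed subspace; once it contains
  every \<open>e j\<close>, it contains their closed span.\<close>

lemma ortho_H:
  assumes "\<And>j. x \<bullet> e j = 0" "y \<in> H"
  shows "x \<bullet> y = 0"
proof -
  have "span (range e) \<subseteq> {y. x \<bullet> y = 0}"
    by (rule span_minimal) (auto simp: assms(1) subspace_def inner_add_right)
  then have "H \<subseteq> {y. x \<bullet> y = 0}"
    unfolding H_def by (rule closure_minimal) (rule closed_hyperplane)
  then show ?thesis
    using assms(2) by auto
qed

text \<open>The difference lies in \<open>H\<close> and is orthogonal to it. Operator equations are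
  reduced to equations between coefficients by this rule.\<close>

lemma H_eqI:
  assumes "x \<in> H" "y \<in> H" "\<And>j. x \<bullet> e j = y \<bullet> e j"
  shows "x = y"
proof -
  have "(x - y) \<bullet> (x - y) = 0"
  proof (rule ortho_H)
    show "x - y \<in> H"
      by (rule subspace_diff[OF subspace_H assms(1,2)])
  qed (simp add: inner_diff_left assms(3))
  then show ?thesis by simp
qed

lemma expansion:
  assumes "x \<in> H"
  shows "(\<Sum>j. (x \<bullet> e j) *\<^sub>R e j) = x"
  by (rule H_eqI) (simp_all add: assms series_in_H series_coeff bessel_summable)

lemma inner_expansion:
  assumes "x \<in> H"
  shows "(\<lambda>j. (x \<bullet> e j) * (y \<bullet> e j)) sums (x \<bullet> y)"
  using series_inner[OF bessel_summable[of x], of y] by (simp add: expansion[OF assms] inner_commute)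

lemma parseval:
  assumes "x \<in> H"
  shows "(\<lambda>j. (x \<bullet> e j)\<^sup>2) sums (norm x)\<^sup>2"
  unfolding power2_norm_eq_inner
  using inner_expansion[OF assms, of x] by (simp add: power2_eq_square)

text \<open>The Fourier series of \<open>x\<close> serves as its projection; this yields the
  splitting of \<open>L2 \<Omega>\<close> into gradients and solenoidal fields.\<close>

lemma proj_exists:
  obtains p where "p \<in> H" "\<And>v. v \<in> H \<Longrightarrow> (x - p) \<bullet> v = 0"
proof
  show "(\<Sum>j. (x \<bullet> e j) *\<^sub>R e j) \<in> H"
    by (rule series_in_H[OF bessel_summable])
  show "(x - (\<Sum>j. (x \<bullet> e j) *\<^sub>R e j)) \<bullet> v = 0" if "v \<in> H" for v
    by (rule ortho_H[OF _ that]) (simp add: inner_diff_left series_coeff bessel_summable)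
qed

end

lemma orthonormal_seqI:
  assumes "orthonormal_basis e H"
  shows "orthonormal_seq (e :: nat \<Rightarrow> 'h::{real_inner, banach})"
  using assms by unfold_locales (simp add: orthonormal_basis_def)

lemma orthonormal_basis_H:
  assumes "orthonormal_basis e H"
  shows "orthonormal_seq.H (e :: nat \<Rightarrow> 'h::{real_inner, banach}) = H"
  using assms by (simp add: orthonormal_seq.H_def[OF orthonormal_seqI[OF assms]] orthonormal_basis_def)

text \<open>Two candidates differ by a vector of \<open>H\<close> orthogonal to itself, which gives
  the definite description in \<open>orth_proj\<close> its value.\<close>

lemma orth_proj_eqI:
  assumes "subspace H" "g \<in> H" "\<And>v. v \<in> H \<Longrightarrow> (f - g) \<bullet> v = 0"
  shows "orth_proj H f = g"
  unfolding orth_proj_def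
proof (rule the_equality)
  show "g \<in> H \<and> (\<forall>v\<in>H. orthogonal (f - g) v)"
    using assms by (simp add: orthogonal_def)
  fix g' assume g': "g' \<in> H \<and> (\<forall>v\<in>H. orthogonal (f - g') v)"
  then have d: "g - g' \<in> H"
    using assms by (simp add: subspace_diff)
  have "(g - g') \<bullet> (g - g') = (f - g') \<bullet> (g - g') - (f - g) \<bullet> (g - g')"
    by (simp add: inner_diff_left)
  also have "\<dots> = 0"
    using g' assms(3)[OF d] d by (simp add: orthogonal_def)
  finally show "g' = g" by simp
qed

section \<open>Self-adjoint operators diagonal in an orthonormal basis\<close>

locale diagonal_self_adjoint = orthonormal_seq +
  fixes D :: "'a set" and T :: "'a \<Rightarrow> 'a" and \<mu> :: "nat \<Rightarrow> real"
  assumes self_adjoint: "self_adjoint_in H D T"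
    and e_in_D: "e j \<in> D" and T_e: "T (e j) = \<mu> j *\<^sub>R e j"
begin

lemma T_in_H: "v \<in> D \<Longrightarrow> T v \<in> H"
  using self_adjoint by (auto simp: self_adjoint_in_def)

lemma D_in_H: "v \<in> D \<Longrightarrow> v \<in> H"
  using self_adjoint by (auto simp: self_adjoint_in_def)

lemma T_coeff: "v \<in> D \<Longrightarrow> T v \<bullet> e j = \<mu> j * (v \<bullet> e j)"
  using self_adjoint e_in_D[of j] by (simp add: self_adjoint_in_def T_e)

text \<open>Expanding both sides in the basis exhibits \<open>w\<close> as the adjoint image of
  \<open>v\<close>, and self-adjointness says that the adjoint has no larger domain than
  \<open>T\<close>.\<close>

lemma domainI:
  assumes "v \<in> H" "w \<in> H" "\<And>j. w \<bullet> e j = \<mu> j * (v \<bullet> e j)"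
  shows "v \<in> D" "T v = w"
proof -
  have "T u \<bullet> v = u \<bullet> w" if u: "u \<in> D" for u
  proof (rule sums_unique2)
    show "(\<lambda>j. \<mu> j * (u \<bullet> e j) * (v \<bullet> e j)) sums (T u \<bullet> v)"
      using inner_expansion[OF T_in_H[OF u], of v] by (simp add: T_coeff u)
    show "(\<lambda>j. \<mu> j * (u \<bullet> e j) * (v \<bullet> e j)) sums (u \<bullet> w)"
      using inner_expansion[OF D_in_H[OF u], of w] by (simp add: assms(3) mult_ac)
  qed
  then have "v \<in> adjoint_dom H D T"
    using assms by (auto simp: adjoint_dom_def)
  then show v: "v \<in> D"
    using self_adjoint by (simp add: self_adjoint_in_def)
  show "T v = w"
    by (rule H_eqI) (simp_all add: T_in_H v assms T_coeff)
qed

text \<open>Serves an indirect argument: bounded eigenvalues would make the domain all of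
  \<open>H\<close>, which the rotor contradicts.\<close>

lemma bounded_domain:
  assumes "\<And>j. \<bar>\<mu> j\<bar> \<le> L" "v \<in> H"
  shows "v \<in> D" "norm (T v) \<le> L * norm v"
proof -
  have s: "summable (\<lambda>j. (\<mu> j * (v \<bullet> e j))\<^sup>2)"
    by (rule summable_sq_mult[OF assms(1) bessel_summable])
  show v: "v \<in> D"
    by (rule domainI[OF assms(2) series_in_H[OF s]]) (simp add: series_coeff[OF s])
  have "(norm (T v))\<^sup>2 \<le> L\<^sup>2 * (norm v)\<^sup>2"
  proof (rule sums_le)
    show "(\<lambda>j. (\<mu> j * (v \<bullet> e j))\<^sup>2) sums (norm (T v))\<^sup>2"
      using parseval[OF T_in_H[OF v]] by (simp add: T_coeff v)
    show "(\<lambda>j. L\<^sup>2 * (v \<bullet> e j)\<^sup>2) sums (L\<^sup>2 * (norm v)\<^sup>2)"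
      by (rule sums_mult[OF parseval[OF assms(2)]])
    show "(\<mu> j * (v \<bullet> e j))\<^sup>2 \<le> L\<^sup>2 * (v \<bullet> e j)\<^sup>2" for j
      using power_mono[OF assms(1)[of j], of 2] by (simp add: power_mult_distrib mult_right_mono)
  qed
  moreover have "0 \<le> L"
    using assms(1)[of 0] by simp
  ultimately show "norm (T v) \<le> L * norm v"
    by (metis power_mult_distrib power2_le_imp_le mult_nonneg_nonneg norm_ge_zero)
qed

text \<open>Dividing coefficients by \<open>\<mu> j + lam\<close> inverts the operator; the gap
  \<open>\<delta>\<close> keeps the quotients square summable, which mere nonvanishing of the
  factors would not.\<close>

lemma bij_shift:
  assumes "0 < \<delta>" "\<And>j. \<delta> \<le> \<bar>\<mu> j + lam\<bar>"
  shows "bij_betw (\<lambda>v. T v + lam *\<^sub>R v) D H"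
proof (rule bij_betw_imageI)
  have nz: "\<mu> j + lam \<noteq> 0" for j
    using assms(1) assms(2)[of j] by auto
  have co: "(T v + lam *\<^sub>R v) \<bullet> e j = (\<mu> j + lam) * (v \<bullet> e j)" if "v \<in> D" for v j
    by (simp add: inner_add_left T_coeff[OF that] algebra_simps)
  show "inj_on (\<lambda>v. T v + lam *\<^sub>R v) D"
  proof (rule inj_onI)
    fix u v assume uv: "u \<in> D" "v \<in> D" and eq: "T u + lam *\<^sub>R u = T v + lam *\<^sub>R v"
    show "u = v"
    proof (rule H_eqI)
      fix j
      show "u \<bullet> e j = v \<bullet> e j"
        using co[OF uv(1), of j] co[OF uv(2), of j] nz[of j] by (simp add: eq)
    qed (use uv D_in_H in auto)
  qed
  have "f \<in> (\<lambda>v. T v + lam *\<^sub>R v) ` D" if f: "f \<in> H" for f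
  proof -
    define c where "c = (\<lambda>j. inverse (\<mu> j + lam) * (f \<bullet> e j))"
    have s: "summable (\<lambda>j. (c j)\<^sup>2)"
      unfolding c_def
    proof (rule summable_sq_mult[OF _ bessel_summable])
      show "\<bar>inverse (\<mu> j + lam)\<bar> \<le> inverse \<delta>" for j
        using assms(1) assms(2)[of j] by (simp add: le_imp_inverse_le)
    qed
    define u where "u = (\<Sum>j. c j *\<^sub>R e j)"
    have u: "u \<in> H" "u \<bullet> e j = c j" for j
      by (simp_all add: u_def series_in_H[OF s] series_coeff[OF s])
    \<comment> \<open>This is the vector that \<open>T u\<close> has to be; \<open>domainI\<close>
      asks for it before \<open>u\<close> is known to lie in \<open>D\<close>.\<close>
    have w: "f - lam *\<^sub>R u \<in> H"
      by (intro subspace_diff subspace_scale subspace_H f u)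
    have "(f - lam *\<^sub>R u) \<bullet> e j = \<mu> j * (u \<bullet> e j)" for j
      using nz[of j] by (simp add: inner_diff_left u c_def field_simps)
    then have "u \<in> D" "T u = f - lam *\<^sub>R u"
      using domainI[OF u(1) w] by auto
    then show ?thesis
      by (intro image_eqI[of _ _ u]) auto
  qed
  moreover have "T v + lam *\<^sub>R v \<in> H" if "v \<in> D" for v
    using that by (intro subspace_add subspace_scale subspace_H T_in_H D_in_H)
  ultimately show "(\<lambda>v. T v + lam *\<^sub>R v) ` D = H"
    by auto
qed

end

section \<open>Monotone eigenvalue sequences and spectral gaps\<close>

lemma mono_unbounded_at_top:
  fixes a :: "nat \<Rightarrow> real"
  assumes "mono a" "\<And>L. \<exists>j. L < a j"
  shows "filterlim a at_top sequentially"
  unfolding filterlim_at_top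
proof
  fix Z :: real
  obtain N where "Z < a N" using assms(2) by blast
  then show "eventually (\<lambda>j. Z \<le> a j) sequentially"
    using monoD[OF assms(1)] by (intro eventually_sequentiallyI[of N]) (meson less_imp_le order_trans)
qed

lemma at_top_gap:
  fixes a :: "nat \<Rightarrow> real"
  assumes "filterlim a at_top sequentially" "\<And>j. a j \<noteq> x"
  obtains \<delta> where "0 < \<delta>" "\<And>j. \<delta> \<le> \<bar>a j - x\<bar>"
proof -
  obtain N where N: "x + 1 \<le> a j" if "j \<ge> N" for j
    using assms(1) unfolding filterlim_at_top eventually_sequentially by meson
  \<comment> \<open>Only the finitely many terms before \<open>N\<close> can come closer than
    \<open>1\<close> to \<open>x\<close>. The inserted \<open>1\<close> takes care of the tail and
    keeps the set nonempty when \<open>N = 0\<close>.\<close>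
  define \<delta> where "\<delta> = Min (insert 1 ((\<lambda>j. \<bar>a j - x\<bar>) ` {..<N}))"
  show ?thesis
  proof
    show "0 < \<delta>"
      using assms(2) by (simp add: \<delta>_def)
    show "\<delta> \<le> \<bar>a j - x\<bar>" for j
    proof (cases "j < N")
      case True
      then show ?thesis by (simp add: \<delta>_def)
    next
      case False
      have "\<delta> \<le> 1" by (simp add: \<delta>_def)
      then show ?thesis using N[of j] False by linarith
    qed
  qed
qed

section \<open>Completeness of the space of square integrable fields\<close>

lemma square_integrable_rep_l2: "square_integrable (rep_l2 u)"
  using Quotient3_rep_reflp[OF Quotient3_l2, of u] by (simp add: l2_rel_def)

lemma l2_of_rep_l2 [simp]: "l2_of (rep_l2 u) = u"
  by (rule Quotient3_abs_rep[OF Quotient3_l2])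

lemma l2_of_eq_iff:
  assumes "square_integrable f" "square_integrable g"
  shows "l2_of f = l2_of g \<longleftrightarrow> (AE x in lborel. f x = g x)"
  using Quotient3_rel[OF Quotient3_l2, of f g] assms by (simp add: l2_rel_def)

lemma square_integrable_rel: "square_integrable f \<Longrightarrow> l2_rel f f"
  by (simp add: l2_rel_def)

lemma l2_of_inner:
  assumes "square_integrable f" "square_integrable g"
  shows "l2_of f \<bullet> l2_of g = (LINT x|lborel. f x \<bullet> g x)"
  using assms by (simp add: inner_l2.abs_eq square_integrable_rel)

lemma l2_of_add:
  assumes "square_integrable f" "square_integrable g"
  shows "l2_of (\<lambda>x. f x + g x) = l2_of f + l2_of g"
  using assms by (simp add: plus_l2.abs_eq square_integrable_rel)

lemma l2_of_diff:
  assumes "square_integrable f" "square_integrable g"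
  shows "l2_of (\<lambda>x. f x - g x) = l2_of f - l2_of g"
  using assms by (simp add: minus_l2.abs_eq square_integrable_rel)

lemma l2_of_scaleR:
  assumes "square_integrable f"
  shows "l2_of (\<lambda>x. c *\<^sub>R f x) = c *\<^sub>R l2_of f"
  using assms by (simp add: scaleR_l2.abs_eq square_integrable_rel)

lemma l2_of_in_L2_iff:
  assumes "square_integrable f"
  shows "l2_of f \<in> L2 \<Omega> \<longleftrightarrow> (AE x in lborel. x \<notin> \<Omega> \<longrightarrow> f x = 0)"
  using assms by (simp add: L2_def vanishes_off.abs_eq square_integrable_rel)

lemma in_L2_iff: "u \<in> L2 \<Omega> \<longleftrightarrow> (AE x in lborel. x \<notin> \<Omega> \<longrightarrow> rep_l2 u x = 0)"
  using l2_of_in_L2_iff[OF square_integrable_rep_l2, of u \<Omega>] by simp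

lemma norm_l2_of_sq:
  assumes "square_integrable f"
  shows "(norm (l2_of f))\<^sup>2 = (LINT x|lborel. (norm (f x))\<^sup>2)"
  using assms by (simp add: power2_norm_eq_inner l2_of_inner)

lemma nn_integral_norm_l2_of_sq:
  assumes "square_integrable f"
  shows "(\<integral>\<^sup>+x. ennreal ((norm (f x))\<^sup>2) \<partial>lborel) = ennreal ((norm (l2_of f))\<^sup>2)"
  using assms by (subst nn_integral_eq_integral) (auto simp: norm_l2_of_sq square_integrable_def)

lemma square_integrableI_nn:
  fixes f :: "'a::euclidean_space \<Rightarrow> 'b::euclidean_space"
  assumes "f \<in> borel_measurable lborel" "(\<integral>\<^sup>+x. ennreal ((norm (f x))\<^sup>2) \<partial>lborel) < \<infinity>"
  shows "square_integrable f"
  using assms unfolding square_integrable_def by (intro conjI integrableI_bounded) auto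

text \<open>The geometric weight makes the almost everywhere convergence a consequence of the
  summability of integrals of squares alone.\<close>

lemma fast_Cauchy_AE_convergent:
  fixes g :: "nat \<Rightarrow> 'a::euclidean_space \<Rightarrow> 'b::euclidean_space"
  assumes g: "\<And>n. square_integrable (g n)"
    and fast: "\<And>n. (norm (l2_of (g (Suc n)) - l2_of (g n)))\<^sup>2 \<le> (1/4)^n"
  shows "AE x in lborel. convergent (\<lambda>n. g n x)"
proof -
  have [measurable]: "g n \<in> borel_measurable borel" for n
    using g[of n] by (simp add: square_integrable_def)
  have "(\<integral>\<^sup>+x. (\<Sum>n. ennreal (2^n * (norm (g (Suc n) x - g n x))\<^sup>2)) \<partial>lborel)
      = (\<Sum>n. \<integral>\<^sup>+x. ennreal (2^n * (norm (g (Suc n) x - g n x))\<^sup>2) \<partial>lborel)"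
    by (rule nn_integral_suminf) measurable
  also have "\<dots> = (\<Sum>n. ennreal (2^n * (norm (l2_of (g (Suc n)) - l2_of (g n)))\<^sup>2))"
    using g by (simp add: ennreal_mult nn_integral_cmult l2_of_diff square_integrable_diff
        nn_integral_norm_l2_of_sq[of "\<lambda>x. g (Suc _) x - g _ x", OF square_integrable_diff])
  also have "\<dots> \<le> (\<Sum>n. ennreal ((1/2)^n))"
  proof (rule suminf_le)
    fix n
    have "2^n * (norm (l2_of (g (Suc n)) - l2_of (g n)))\<^sup>2 \<le> 2^n * (1/4)^n"
      by (rule mult_left_mono[OF fast]) simp
    also have "\<dots> = (1/2)^n"
      by (simp flip: power_mult_distrib)
    finally show "ennreal (2^n * (norm (l2_of (g (Suc n)) - l2_of (g n)))\<^sup>2) \<le> ennreal ((1/2)^n)"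
      by (rule ennreal_leI)
  qed auto
  also have "\<dots> < \<infinity>"
    by (subst suminf_ennreal2) (auto intro: summable_geometric)
  finally have "AE x in lborel. (\<Sum>n. ennreal (2^n * (norm (g (Suc n) x - g n x))\<^sup>2)) \<noteq> \<infinity>"
    by (intro nn_integral_PInf_AE) auto
  then show ?thesis
  proof eventually_elim
    case (elim x)
    define d where "d = (\<lambda>n. g (Suc n) x - g n x)"
    have "summable (\<lambda>n. 2^n * (norm (d n))\<^sup>2)"
      using elim by (intro summable_suminf_not_top) (auto simp: d_def)
    moreover have "summable (\<lambda>n. (1/2::real)^n)"
      by (rule summable_geometric) simp
    ultimately have "summable (\<lambda>n. 2^n * (norm (d n))\<^sup>2 + (1/2::real)^n)"
      by (rule summable_add)
    then have "summable d"
    proof (rule summable_comparison_test')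
      fix n
      \<comment> \<open>The two square roots multiply to \<open>1\<close>; the bound
        \<open>2 a b \<le> a^2 + b^2\<close> then trades the norm for its weighted square plus a
        summable term.\<close>
      have "norm (d n) * 2 = 2 * (sqrt (2^n) * norm (d n)) * (sqrt ((1/2)^n))"
        by (simp add: real_sqrt_divide power_divide)
      also have "\<dots> \<le> (sqrt (2^n) * norm (d n))\<^sup>2 + (sqrt ((1/2)^n))\<^sup>2"
        by (rule sum_squares_bound)
      also have "\<dots> = 2^n * (norm (d n))\<^sup>2 + (1/2)^n"
        by (simp add: power_mult_distrib)
      finally show "norm (d n) \<le> 2^n * (norm (d n))\<^sup>2 + (1/2)^n"
        by (smt (verit) norm_ge_zero)
    qed
    then have "convergent (\<lambda>n. \<Sum>k<n. d k)"
      by (simp add: summable_iff_convergent)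
    then have "convergent (\<lambda>n. (\<Sum>k<n. d k) + g 0 x)"
      by (rule convergent_add) (rule convergent_const)
    moreover have "(\<Sum>k<n. d k) + g 0 x = g n x" for n
      using sum_lessThan_telescope[of "\<lambda>k. g k x" n] by (simp add: d_def)
    ultimately show ?case by simp
  qed
qed

text \<open>Fatou's lemma for the squares, which keeps the constant \<open>B\<close>. The bound is
  required only eventually because a Cauchy sequence is controlled only in its tail.\<close>

lemma Fatou_l2:
  fixes g :: "nat \<Rightarrow> 'a::euclidean_space \<Rightarrow> 'b::euclidean_space"
  assumes g: "\<And>n. square_integrable (g n)" and h: "h \<in> borel_measurable lborel"
    and lim: "AE x in lborel. (\<lambda>n. g n x) \<longlonglongrightarrow> h x"
    and bound: "eventually (\<lambda>n. norm (l2_of (g n)) \<le> B) sequentially"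
  shows "square_integrable h" "norm (l2_of h) \<le> B"
proof -
  have [measurable]: "g n \<in> borel_measurable borel" "h \<in> borel_measurable borel" for n
    using g[of n] h by (simp_all add: square_integrable_def)
  obtain n where "norm (l2_of (g n)) \<le> B"
    using bound eventually_happens by force
  then have B: "0 \<le> B"
    by (rule order_trans[OF norm_ge_zero])
  have "(\<integral>\<^sup>+x. ennreal ((norm (h x))\<^sup>2) \<partial>lborel)
      = (\<integral>\<^sup>+x. liminf (\<lambda>n. ennreal ((norm (g n x))\<^sup>2)) \<partial>lborel)"
  proof (rule nn_integral_cong_AE)
    show "AE x in lborel. ennreal ((norm (h x))\<^sup>2) = liminf (\<lambda>n. ennreal ((norm (g n x))\<^sup>2))"
      using lim
    proof eventually_elim
      case (elim x)
      then have "(\<lambda>n. ennreal ((norm (g n x))\<^sup>2)) \<longlonglongrightarrow> ennreal ((norm (h x))\<^sup>2)"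
        by (intro tendsto_ennrealI tendsto_power tendsto_norm)
      then show ?case
        by (rule lim_imp_Liminf[OF trivial_limit_sequentially, symmetric])
    qed
  qed
  also have "\<dots> \<le> liminf (\<lambda>n. \<integral>\<^sup>+x. ennreal ((norm (g n x))\<^sup>2) \<partial>lborel)"
    by (rule nn_integral_liminf) measurable
  also have "\<dots> = liminf (\<lambda>n. ennreal ((norm (l2_of (g n)))\<^sup>2))"
    using g by (simp add: nn_integral_norm_l2_of_sq)
  also have "\<dots> \<le> liminf (\<lambda>n. ennreal (B\<^sup>2))"
    using bound by (intro Liminf_mono) (auto elim!: eventually_mono intro!: ennreal_leI power_mono)
  also have "\<dots> = ennreal (B\<^sup>2)"
    by (simp add: Liminf_const)
  finally have le: "(\<integral>\<^sup>+x. ennreal ((norm (h x))\<^sup>2) \<partial>lborel) \<le> ennreal (B\<^sup>2)" .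
  show si: "square_integrable h"
    by (rule square_integrableI_nn[OF h le_less_trans[OF le]]) simp
  show "norm (l2_of h) \<le> B"
  proof (rule power2_le_imp_le[OF _ B])
    show "(norm (l2_of h))\<^sup>2 \<le> B\<^sup>2"
      using le by (simp add: nn_integral_norm_l2_of_sq[OF si])
  qed
qed

text \<open>The Riesz-Fischer argument: a fast subsequence converges almost everywhere,
  \<open>Fatou_l2\<close> upgrades this to convergence in norm, and a Cauchy sequence follows its
  subsequence.\<close>

instance l2 :: (euclidean_space, euclidean_space) banach
proof
  fix X :: "nat \<Rightarrow> ('a, 'b) l2"
  assume X: "Cauchy X"
  have "\<forall>k. \<exists>N. \<forall>m\<ge>N. \<forall>n\<ge>N. norm (X m - X n) < (1/2)^k"
  proof
    show "\<exists>N. \<forall>m\<ge>N. \<forall>n\<ge>N. norm (X m - X n) < (1/2)^k" for k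
      by (rule X[unfolded Cauchy_iff, rule_format]) simp
  qed
  from choice[OF this] obtain N where
    N: "\<And>k m n. m \<ge> N k \<Longrightarrow> n \<ge> N k \<Longrightarrow> norm (X m - X n) < (1/2)^k"
    by auto
  \<comment> \<open>The partial sums dominate every threshold \<open>N k\<close>; the added
    \<open>k\<close> makes \<open>r\<close> strictly increasing.\<close>
  define r where "r = (\<lambda>k. (\<Sum>i\<le>k. N i) + k)"
  have r: "N k \<le> r k" "k \<le> r k" "r k \<le> r (Suc k)" for k
    using member_le_sum[of k "{..k}" N] unfolding r_def by simp_all
  define g where "g = (\<lambda>k. rep_l2 (X (r k)))"
  have g: "square_integrable (g k)" "l2_of (g k) = X (r k)" for k
    by (simp_all add: g_def square_integrable_rep_l2)
  have [measurable]: "g k \<in> borel_measurable borel" for k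
    using g(1)[of k] by (simp add: square_integrable_def)
  have conv: "AE x in lborel. convergent (\<lambda>k. g k x)"
  proof (rule fast_Cauchy_AE_convergent[OF g(1)])
    fix k
    have "norm (X (r (Suc k)) - X (r k)) \<le> (1/2)^k"
      using N[of k "r (Suc k)" "r k"] r(1,3)[of k] by linarith
    then have "(norm (X (r (Suc k)) - X (r k)))\<^sup>2 \<le> ((1/2)^k)\<^sup>2"
      by (rule power_mono) simp
    also have "\<dots> = (1/4)^k"
      by (simp add: power_mult[symmetric] mult.commute[of k 2] power_mult power2_eq_square)
        (simp add: power_mult_distrib[symmetric])
    finally show "(norm (l2_of (g (Suc k)) - l2_of (g k)))\<^sup>2 \<le> (1/4)^k"
      by (simp add: g)
  qed
  \<comment> \<open>Where the subsequence diverges, \<open>lim\<close> is an unspecified value; this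
    happens on a null set only.\<close>
  define h where "h = (\<lambda>x. lim (\<lambda>k. g k x))"
  have h [measurable]: "h \<in> borel_measurable borel"
    unfolding h_def by (rule borel_measurable_lim_metric) measurable
  have lim: "AE x in lborel. (\<lambda>k. g k x) \<longlonglongrightarrow> h x"
    using conv by eventually_elim (simp add: h_def convergent_LIMSEQ_iff)
  have close: "square_integrable (\<lambda>x. h x - g k x)" "norm (l2_of (\<lambda>x. h x - g k x)) \<le> (1/2)^k" for k
  proof -
    have 1: "AE x in lborel. (\<lambda>j. g j x - g k x) \<longlonglongrightarrow> h x - g k x"
      using lim by eventually_elim (intro tendsto_diff tendsto_const)
    have "norm (l2_of (\<lambda>x. g j x - g k x)) \<le> (1/2)^k" if "j \<ge> r k" for j
    proof -
      have "norm (X (r j) - X (r k)) < (1/2)^k"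
        using r[of k] r[of j] that by (intro N) auto
      then show ?thesis
        by (simp add: l2_of_diff g)
    qed
    then have 2: "eventually (\<lambda>j. norm (l2_of (\<lambda>x. g j x - g k x)) \<le> (1/2)^k) sequentially"
      by (rule eventually_sequentiallyI)
    show "square_integrable (\<lambda>x. h x - g k x)" "norm (l2_of (\<lambda>x. h x - g k x)) \<le> (1/2)^k"
      using Fatou_l2[OF square_integrable_diff[OF g(1) g(1)] _ 1 2] by auto
  qed
  have hs: "square_integrable h"
    using square_integrable_add[OF close(1)[of 0] g(1)[of 0]] by simp
  have "(\<lambda>k. X (r k)) \<longlonglongrightarrow> l2_of h"
  proof (rule Lim_null_comparison[THEN LIM_zero_cancel])
    show "eventually (\<lambda>k. norm (X (r k) - l2_of h) \<le> (1/2)^k) sequentially"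
      using close(2) by (intro always_eventually allI) (simp add: l2_of_diff hs g norm_minus_commute)
    show "(\<lambda>k. (1/2::real)^k) \<longlonglongrightarrow> 0"
      by (rule LIMSEQ_power_zero) simp
  qed
  moreover have "strict_mono r"
    unfolding strict_mono_Suc_iff by (simp add: r_def)
  ultimately have "X \<longlonglongrightarrow> l2_of h"
    by (intro Cauchy_converges_subseq[OF X]) (simp_all add: comp_def)
  then show "convergent X"
    by (rule convergentI)
qed

section \<open>Smooth functions\<close>

lemma frechet_derivative_eqI:
  "(f has_derivative f') (at x) \<Longrightarrow> frechet_derivative f (at x) = f'"
  by (metis frechet_derivative_at)

lemma Ck_on_mono: "Ck_on (Suc k) UNIV f \<Longrightarrow> Ck_on k UNIV f"
  by (induction k arbitrary: f) (auto intro: differentiable_imp_continuous_on)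

lemma Ck_on_differentiable: "Ck_on (Suc k) UNIV f \<Longrightarrow> f differentiable (at x)"
  by (simp add: differentiable_on_def)

lemma Ck_on_const: "Ck_on k UNIV (\<lambda>x. c)"
  by (induction k arbitrary: c) (simp_all add: differentiable_on_def)

lemma Ck_on_add:
  "Ck_on k UNIV f \<Longrightarrow> Ck_on k UNIV g \<Longrightarrow> Ck_on k UNIV (\<lambda>x. f x + g x)"
proof (induction k arbitrary: f g)
  case (Suc k)
  have d: "f differentiable (at x)" "g differentiable (at x)" for x
    using Suc.prems by (blast intro: Ck_on_differentiable)+
  have "frechet_derivative (\<lambda>x. f x + g x) (at x)
      = (\<lambda>v. frechet_derivative f (at x) v + frechet_derivative g (at x) v)" for x
    using d[of x] by (intro frechet_derivative_eqI has_derivative_add) (simp_all add: frechet_derivative_works)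
  then show ?case
    using Suc d by (simp add: differentiable_on_def)
qed (simp add: continuous_on_add)

lemma Ck_on_mult:
  fixes f :: "'a::real_normed_vector \<Rightarrow> real" and g :: "'a \<Rightarrow> real"
  shows "Ck_on k UNIV f \<Longrightarrow> Ck_on k UNIV g \<Longrightarrow> Ck_on k UNIV (\<lambda>x. f x * g x)"
proof (induction k arbitrary: f g)
  case (Suc k)
  have d: "f differentiable (at x)" "g differentiable (at x)" for x
    using Suc.prems by (blast intro: Ck_on_differentiable)+
  have "frechet_derivative (\<lambda>x. f x * g x) (at x)
      = (\<lambda>v. f x * frechet_derivative g (at x) v + frechet_derivative f (at x) v * g x)" for x
    using d[of x] by (intro frechet_derivative_eqI has_derivative_mult) (simp_all add: frechet_derivative_works)
  moreover have "Ck_on k UNIV (\<lambda>x. f x * frechet_derivative g (at x) v + frechet_derivative f (at x) v * g x)" for v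
    using Suc.prems by (intro Ck_on_add Suc.IH) (simp_all add: Ck_on_mono)
  ultimately show ?case
    using d by (simp add: differentiable_on_def)
qed (simp add: continuous_on_mult)

lemma Ck_on_bounded_linear:
  assumes "bounded_linear L"
  shows "Ck_on k UNIV f \<Longrightarrow> Ck_on k UNIV (\<lambda>x. L (f x))"
proof (induction k arbitrary: f)
  case 0
  then show ?case
    using bounded_linear.continuous_on[OF assms] by auto
next
  case (Suc k)
  have d: "f differentiable (at x)" for x
    using Suc.prems by (rule Ck_on_differentiable)
  have h: "((\<lambda>x. L (f x)) has_derivative (\<lambda>v. L (frechet_derivative f (at x) v))) (at x)" for x
    using d[of x] by (intro bounded_linear.has_derivative[OF assms]) (simp add: frechet_derivative_works)
  show ?case
    using Suc h by (auto simp: differentiable_on_def differentiable_def frechet_derivative_eqI[OF h])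
qed

text \<open>The inner derivative is the constant map \<open>l\<close>, so a directional derivative
  is again a function composed with the same affine map, and the induction closes without
  products.\<close>

lemma Ck_on_affine:
  fixes l :: "'a::real_normed_vector \<Rightarrow> 'b::real_normed_vector"
  assumes "bounded_linear l"
  shows "Ck_on k UNIV f \<Longrightarrow> Ck_on k UNIV (\<lambda>x. f (l x + c))"
proof (induction k arbitrary: f)
  case 0
  then have "continuous_on UNIV (f \<circ> (\<lambda>x. l x + c))"
    by (intro continuous_on_compose continuous_on_add continuous_on_const
        linear_continuous_on[OF assms]) (auto intro: continuous_on_subset)
  then show ?case by (simp add: comp_def)
next
  case (Suc k)
  have d: "f differentiable (at x)" for x
    using Suc.prems by (rule Ck_on_differentiable)
  have h: "((\<lambda>x. f (l x + c)) has_derivative (\<lambda>v. frechet_derivative f (at (l x + c)) (l v))) (at x)" for x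
  proof (rule has_derivative_compose[where f = "\<lambda>x. l x + c" and g = f])
    show "((\<lambda>x. l x + c) has_derivative l) (at x)"
      using bounded_linear_imp_has_derivative[OF assms] by (rule has_derivative_add_const)
    show "(f has_derivative frechet_derivative f (at (l x + c))) (at (l x + c))"
      using d by (simp add: frechet_derivative_works)
  qed
  have "Ck_on k UNIV (\<lambda>x. frechet_derivative f (at x) (l v))" for v
    using Suc.prems by simp
  then have "Ck_on k UNIV (\<lambda>x. frechet_derivative f (at (l x + c)) (l v))" for v
    using Suc.IH by blast
  then show ?case
    using h by (auto simp: differentiable_on_def differentiable_def frechet_derivative_eqI[OF h])
qed

abbreviation smooth :: "('a::real_normed_vector \<Rightarrow> 'b::real_normed_vector) \<Rightarrow> bool" where
  "smooth \<equiv> smooth_on UNIV"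

lemma smooth_differentiable: "smooth f \<Longrightarrow> f differentiable (at x)"
  unfolding smooth_on_def by (blast intro: Ck_on_differentiable)

lemma smooth_has_derivative: "smooth f \<Longrightarrow> (f has_derivative frechet_derivative f (at x)) (at x)"
  using smooth_differentiable frechet_derivative_works by blast

lemma smooth_continuous: "smooth f \<Longrightarrow> continuous_on UNIV f"
  unfolding smooth_on_def by (metis Ck_on.simps(1))

lemma smooth_derivative: "smooth f \<Longrightarrow> smooth (\<lambda>x. frechet_derivative f (at x) v)"
  unfolding smooth_on_def by (metis Ck_on.simps(2))

text \<open>For the sine and for \<open>flat\<close>, an explicit class closed under differentiation
  is easier to name than the derivatives of each order.\<close>

lemma smooth_coinduct:
  assumes "P f" "\<And>f. P f \<Longrightarrow> f differentiable_on UNIV \<and> (\<forall>v. P (\<lambda>x. frechet_derivative f (at x) v))"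
  shows "smooth f"
proof -
  have "P g \<Longrightarrow> Ck_on k UNIV g" for k g
    by (induction k arbitrary: g) (use assms(2) differentiable_imp_continuous_on in auto)
  then show ?thesis
    using assms(1) by (simp add: smooth_on_def)
qed

lemma smooth_const: "smooth (\<lambda>x. c)"
  by (simp add: smooth_on_def Ck_on_const)

lemma smooth_add: "smooth f \<Longrightarrow> smooth g \<Longrightarrow> smooth (\<lambda>x. f x + g x)"
  by (simp add: smooth_on_def Ck_on_add)

lemma smooth_mult:
  fixes f :: "'a::real_normed_vector \<Rightarrow> real"
  shows "smooth f \<Longrightarrow> smooth g \<Longrightarrow> smooth (\<lambda>x. f x * g x)"
  by (simp add: smooth_on_def Ck_on_mult)

lemma smooth_bounded_linear: "bounded_linear L \<Longrightarrow> smooth f \<Longrightarrow> smooth (\<lambda>x. L (f x))"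
  by (simp add: smooth_on_def Ck_on_bounded_linear)

lemma smooth_affine: "bounded_linear l \<Longrightarrow> smooth f \<Longrightarrow> smooth (\<lambda>x. f (l x + c))"
  by (simp add: smooth_on_def Ck_on_affine)

lemma smooth_uminus: "smooth f \<Longrightarrow> smooth (\<lambda>x. - f x)"
  by (rule smooth_bounded_linear) (rule bounded_linear_minus[OF bounded_linear_ident])

lemma smooth_diff: "smooth f \<Longrightarrow> smooth g \<Longrightarrow> smooth (\<lambda>x. f x - g x)"
  using smooth_add[of f "\<lambda>x. - g x"] smooth_uminus[of g] by simp

lemma smooth_sum: "(\<And>i. i \<in> I \<Longrightarrow> smooth (f i)) \<Longrightarrow> smooth (\<lambda>x. \<Sum>i\<in>I. f i x)"
  by (induction I rule: infinite_finite_induct) (simp_all add: smooth_const smooth_add)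

lemma smooth_prod:
  fixes f :: "'i \<Rightarrow> 'a::real_normed_vector \<Rightarrow> real"
  shows "(\<And>i. i \<in> I \<Longrightarrow> smooth (f i)) \<Longrightarrow> smooth (\<lambda>x. \<Prod>i\<in>I. f i x)"
  by (induction I rule: infinite_finite_induct) (simp_all add: smooth_const smooth_mult)

lemma smooth_vec_nth: "smooth f \<Longrightarrow> smooth (\<lambda>x. f x $ i)"
  by (rule smooth_bounded_linear[OF bounded_linear_vec_nth])

lemma smooth_vecI:
  fixes f :: "'a::real_normed_vector \<Rightarrow> real^'n"
  assumes "\<And>i. smooth (\<lambda>x. f x $ i)"
  shows "smooth f"
proof -
  have "smooth (\<lambda>x. \<Sum>i\<in>UNIV. (f x $ i) *\<^sub>R (axis i 1 :: real^'n))"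
    by (intro smooth_sum smooth_bounded_linear[OF bounded_linear_scaleR_left] assms)
  moreover have "(\<Sum>i\<in>UNIV. (f x $ i) *\<^sub>R (axis i 1 :: real^'n)) = f x" for x
    using basis_expansion[of "f x"] by (simp add: scalar_mult_eq_scaleR)
  ultimately show ?thesis by simp
qed

text \<open>Cosine is the sine shifted by \<open>pi/2\<close>, and the direction \<open>v\<close> is
  absorbed into the amplitude, so two parameters describe all derivatives.\<close>

lemma smooth_scaled_sin: "smooth (\<lambda>t::real. A * sin (t + c))"
proof (rule smooth_coinduct[where P = "\<lambda>f. \<exists>A c. f = (\<lambda>t::real. A * sin (t + c))"])
  fix f assume "\<exists>A c. f = (\<lambda>t::real. A * sin (t + c))"
  then obtain A c where f: "f = (\<lambda>t::real. A * sin (t + c))" by blast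
  have h: "(f has_derivative (\<lambda>v. (v * A) * sin (t + (c + pi/2)))) (at t)" for t
  proof -
    have "(f has_derivative (\<lambda>v. v * (A * cos (t + c)))) (at t)"
      unfolding f by (auto intro!: derivative_eq_intros)
    moreover have "sin (t + (c + pi/2)) = cos (t + c)"
      by (simp add: sin_add algebra_simps flip: add.assoc)
    ultimately show ?thesis by (simp add: mult_ac)
  qed
  show "f differentiable_on UNIV \<and>
    (\<forall>v. \<exists>A c. (\<lambda>x. frechet_derivative f (at x) v) = (\<lambda>t. A * sin (t + c)))"
    using h by (auto simp: differentiable_on_def differentiable_def frechet_derivative_eqI[OF h])
qed auto

section \<open>Mixed partial derivatives\<close>

lemma has_real_derivative_along:
  fixes f :: "'a::real_normed_vector \<Rightarrow> real"
  assumes "smooth f"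
  shows "((\<lambda>s. f (x + s *\<^sub>R v)) has_real_derivative frechet_derivative f (at (x + t *\<^sub>R v)) v) (at t)"
proof -
  have "((\<lambda>s. f (x + s *\<^sub>R v)) has_derivative (\<lambda>s. frechet_derivative f (at (x + t *\<^sub>R v)) (s *\<^sub>R v))) (at t)"
  proof (rule has_derivative_compose[where g = f])
    show "((\<lambda>s. x + s *\<^sub>R v) has_derivative (\<lambda>s. s *\<^sub>R v)) (at t)"
      by (auto intro!: derivative_eq_intros)
  qed (rule smooth_has_derivative[OF assms])
  moreover have "frechet_derivative f (at y) (s *\<^sub>R v) = s * frechet_derivative f (at y) v" for y s
    using linear_scale[OF linear_frechet_derivative[OF smooth_differentiable[OF assms]]] by simp
  ultimately show ?thesis
    by (simp add: has_field_derivative_def mult.commute[of _ "frechet_derivative f _ _"])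
qed

text \<open>The mean value theorem is applied twice: along \<open>u\<close> to the increment in
  direction \<open>v\<close>, then along \<open>v\<close> to the derivative in direction
  \<open>u\<close>.\<close>

lemma second_difference_mvt:
  fixes f :: "'a::real_normed_vector \<Rightarrow> real"
  assumes f: "smooth f" and t: "0 < t"
  obtains a b where "0 < a" "a < t" "0 < b" "b < t"
    "f (x + t *\<^sub>R u + t *\<^sub>R v) - f (x + t *\<^sub>R u) - f (x + t *\<^sub>R v) + f x
      = t * t * frechet_derivative (\<lambda>y. frechet_derivative f (at y) u) (at (x + a *\<^sub>R u + b *\<^sub>R v)) v"
proof -
  define F where "F = (\<lambda>s. f (x + t *\<^sub>R v + s *\<^sub>R u) - f (x + s *\<^sub>R u))"
  have "(F has_real_derivative (frechet_derivative f (at (x + t *\<^sub>R v + s *\<^sub>R u)) u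
      - frechet_derivative f (at (x + s *\<^sub>R u)) u)) (at s)" for s
    unfolding F_def by (intro DERIV_diff has_real_derivative_along[OF f])
  then obtain a where a: "0 < a" "a < t"
    "F t - F 0 = (t - 0) * (frechet_derivative f (at (x + t *\<^sub>R v + a *\<^sub>R u)) u
      - frechet_derivative f (at (x + a *\<^sub>R u)) u)"
    using MVT2[OF t, of F "\<lambda>s. frechet_derivative f (at (x + t *\<^sub>R v + s *\<^sub>R u)) u
      - frechet_derivative f (at (x + s *\<^sub>R u)) u"] by blast
  define G where "G = (\<lambda>s. frechet_derivative f (at (x + a *\<^sub>R u + s *\<^sub>R v)) u)"
  have "(G has_real_derivative
      frechet_derivative (\<lambda>y. frechet_derivative f (at y) u) (at (x + a *\<^sub>R u + s *\<^sub>R v)) v) (at s)" for s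
    unfolding G_def by (rule has_real_derivative_along[OF smooth_derivative[OF f]])
  then obtain b where b: "0 < b" "b < t" "G t - G 0 = (t - 0) *
      frechet_derivative (\<lambda>y. frechet_derivative f (at y) u) (at (x + a *\<^sub>R u + b *\<^sub>R v)) v"
    using MVT2[OF t, of G "\<lambda>s. frechet_derivative (\<lambda>y. frechet_derivative f (at y) u)
      (at (x + a *\<^sub>R u + s *\<^sub>R v)) v"] by blast
  have "F t - F 0 = t * (G t - G 0)"
    using a(3) by (simp add: G_def ac_simps)
  then show ?thesis
    using that[OF a(1,2) b(1,2)] by (simp add: b(3) F_def ac_simps)
qed

text \<open>The second difference is symmetric in \<open>u\<close> and \<open>v\<close>, so the two
  mixed derivatives agree at points near \<open>x\<close>, and continuity carries the equality to
  \<open>x\<close>. The purpose is that a curl has no divergence.\<close>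

lemma mixed_derivatives_commute:
  fixes f :: "'a::real_normed_vector \<Rightarrow> real"
  assumes f: "smooth f"
  shows "frechet_derivative (\<lambda>y. frechet_derivative f (at y) u) (at x) v
    = frechet_derivative (\<lambda>y. frechet_derivative f (at y) v) (at x) u"
proof -
  define P Q where "P = (\<lambda>z. frechet_derivative (\<lambda>y. frechet_derivative f (at y) u) (at z) v)"
    and "Q = (\<lambda>z. frechet_derivative (\<lambda>y. frechet_derivative f (at y) v) (at z) u)"
  have cont: "isCont P x" "isCont Q x"
    using smooth_continuous[OF smooth_derivative[OF smooth_derivative[OF f]]]
    by (auto simp: P_def Q_def continuous_on_eq_continuous_at)
  have "\<exists>a b c d. 0 < a \<and> a < t \<and> 0 < b \<and> b < t \<and> 0 < c \<and> c < t \<and> 0 < d \<and> d < t \<and>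
    P (x + a *\<^sub>R u + b *\<^sub>R v) = Q (x + c *\<^sub>R v + d *\<^sub>R u)" if t: "0 < t" for t
  proof -
    obtain a b where ab: "0 < a" "a < t" "0 < b" "b < t"
      "f (x + t *\<^sub>R u + t *\<^sub>R v) - f (x + t *\<^sub>R u) - f (x + t *\<^sub>R v) + f x
        = t * t * P (x + a *\<^sub>R u + b *\<^sub>R v)"
      using second_difference_mvt[OF f t, of x u v] unfolding P_def by blast
    obtain c d where cd: "0 < c" "c < t" "0 < d" "d < t"
      "f (x + t *\<^sub>R v + t *\<^sub>R u) - f (x + t *\<^sub>R v) - f (x + t *\<^sub>R u) + f x
        = t * t * Q (x + c *\<^sub>R v + d *\<^sub>R u)"
      using second_difference_mvt[OF f t, of x v u] unfolding Q_def by blast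
    have "t * t * P (x + a *\<^sub>R u + b *\<^sub>R v) = t * t * Q (x + c *\<^sub>R v + d *\<^sub>R u)"
      using ab(5) cd(5) by (simp only: add.commute add.left_commute add.assoc)
    then have "P (x + a *\<^sub>R u + b *\<^sub>R v) = Q (x + c *\<^sub>R v + d *\<^sub>R u)"
      using t by simp
    then show ?thesis
      using ab(1-4) cd(1-4) by blast
  qed
  then have "\<forall>n. \<exists>a b c d. 0 < a \<and> a < inverse (Suc n) \<and> 0 < b \<and> b < inverse (Suc n) \<and>
    0 < c \<and> c < inverse (Suc n) \<and> 0 < d \<and> d < inverse (Suc n) \<and>
    P (x + a *\<^sub>R u + b *\<^sub>R v) = Q (x + c *\<^sub>R v + d *\<^sub>R u)"
    by (simp del: of_nat_Suc)
  then obtain a b c d :: "nat \<Rightarrow> real" where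
    ab: "\<And>n. 0 < a n \<and> a n < inverse (Suc n)" "\<And>n. 0 < b n \<and> b n < inverse (Suc n)"
      "\<And>n. 0 < c n \<and> c n < inverse (Suc n)" "\<And>n. 0 < d n \<and> d n < inverse (Suc n)"
    and eq: "\<And>n. P (x + a n *\<^sub>R u + b n *\<^sub>R v) = Q (x + c n *\<^sub>R v + d n *\<^sub>R u)"
    by metis
  have z: "s \<longlonglongrightarrow> 0" if "\<And>n. 0 < s n \<and> s n < inverse (Suc n)" for s :: "nat \<Rightarrow> real"
  proof (rule Lim_null_comparison[OF _ LIMSEQ_inverse_real_of_nat])
    have "norm (s n) \<le> inverse (real (Suc n))" for n
      using that[of n] unfolding real_norm_def by linarith
    then show "eventually (\<lambda>n. norm (s n) \<le> inverse (real (Suc n))) sequentially"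
      by simp
  qed
  have "(\<lambda>n. x + a n *\<^sub>R u + b n *\<^sub>R v) \<longlonglongrightarrow> x + 0 *\<^sub>R u + 0 *\<^sub>R v"
    by (intro tendsto_intros z ab)
  then have 1: "(\<lambda>n. P (x + a n *\<^sub>R u + b n *\<^sub>R v)) \<longlonglongrightarrow> P x"
    using isCont_tendsto_compose[OF cont(1)] by simp
  have "(\<lambda>n. x + c n *\<^sub>R v + d n *\<^sub>R u) \<longlonglongrightarrow> x + 0 *\<^sub>R v + 0 *\<^sub>R u"
    by (intro tendsto_intros z ab)
  then have 2: "(\<lambda>n. Q (x + c n *\<^sub>R v + d n *\<^sub>R u)) \<longlonglongrightarrow> Q x"
    using isCont_tendsto_compose[OF cont(2)] by simp
  have "P x = Q x"
    by (rule LIMSEQ_unique[OF 1]) (simp add: eq 2)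
  then show ?thesis by (simp add: P_def Q_def)
qed

section \<open>Integration by parts\<close>

lemma integrable_compact_support:
  fixes f :: "'a::euclidean_space \<Rightarrow> 'b::euclidean_space"
  assumes "continuous_on UNIV f" "compact K" "\<And>x. x \<notin> K \<Longrightarrow> f x = 0"
  shows "integrable lborel f"
proof -
  have "integrable lborel (\<lambda>x. indicator K x *\<^sub>R f x)"
    using assms by (intro borel_integrable_compact) (auto intro: continuous_on_subset)
  moreover have "(\<lambda>x. indicator K x *\<^sub>R f x) = f"
    using assms(3) by (auto simp: indicator_def)
  ultimately show ?thesis by simp
qed

lemma square_integrable_compact_support:
  fixes f :: "'a::euclidean_space \<Rightarrow> 'b::euclidean_space"
  assumes "continuous_on UNIV f" "compact K" "\<And>x. x \<notin> K \<Longrightarrow> f x = 0"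
  shows "square_integrable f"
  unfolding square_integrable_def
proof
  show "f \<in> borel_measurable lborel"
    using borel_measurable_continuous_onI[OF assms(1)] by simp
  show "integrable lborel (\<lambda>x. (norm (f x))\<^sup>2)"
    by (rule integrable_compact_support[OF _ assms(2)])
      (auto intro!: continuous_intros assms(1) simp: assms(3))
qed

lemma derivative_zero_outside:
  assumes "closed K" "\<And>x. x \<notin> K \<Longrightarrow> f x = 0" "x \<notin> K"
  shows "frechet_derivative f (at x) v = 0"
proof -
  have "(f has_derivative (\<lambda>v. 0)) (at x)"
  proof (rule has_derivative_transform_within_open)
    show "((\<lambda>x. 0) has_derivative (\<lambda>v. 0)) (at x)" by simp
    show "open (- K)" using assms(1) by auto
  qed (use assms in auto)
  then show ?thesis
    by (simp add: frechet_derivative_eqI)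
qed

lemma integral_translate:
  fixes f :: "'a::euclidean_space \<Rightarrow> 'b::euclidean_space"
  assumes "integrable lborel f"
  shows "integrable lborel (\<lambda>x. f (c + x))" "(LINT x|lborel. f (c + x)) = (LINT x|lborel. f x)"
proof -
  have [measurable]: "f \<in> borel_measurable borel"
    using borel_measurable_integrable[OF assms] by simp
  have "integrable (distr lborel borel ((+) c)) f"
    using assms by (simp add: lborel_distr_plus)
  then show "integrable lborel (\<lambda>x. f (c + x))"
    by (subst (asm) integrable_distr_eq) auto
  have "(LINT x|lborel. f x) = (LINT x|distr lborel borel ((+) c). f x)"
    by (simp add: lborel_distr_plus)
  also have "\<dots> = (LINT x|lborel. f (c + x))"
    by (rule integral_distr) auto
  finally show "(LINT x|lborel. f (c + x)) = (LINT x|lborel. f x)" ..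
qed

text \<open>By translation invariance the difference quotients have integral zero, and they are dominated
  on a fixed compact set.\<close>

lemma integral_derivative_zero:
  fixes f :: "'a::euclidean_space \<Rightarrow> real"
  assumes f: "smooth f" and K: "compact K" and supp: "\<And>x. x \<notin> K \<Longrightarrow> f x = 0"
  shows "(LINT x|lborel. frechet_derivative f (at x) v) = 0"
proof -
  define D where "D = (\<lambda>x. frechet_derivative f (at x) v)"
  have fi: "integrable lborel f"
    by (rule integrable_compact_support[OF smooth_continuous[OF f] K supp])
  have Dc: "continuous_on UNIV D"
    unfolding D_def by (rule smooth_continuous[OF smooth_derivative[OF f]])
  have D0: "D x = 0" if "x \<notin> K" for x
    unfolding D_def by (rule derivative_zero_outside[OF compact_imp_closed[OF K] supp that])
  have "bounded (D ` K)"
    by (intro compact_imp_bounded compact_continuous_image K continuous_on_subset[OF Dc]) auto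
  then obtain M where M: "\<And>x. x \<in> K \<Longrightarrow> \<bar>D x\<bar> \<le> M"
    by (auto simp: bounded_iff)
  define B where "B = max M 0"
  have B: "\<bar>D x\<bar> \<le> B" for x
    using M[of x] D0[of x] by (cases "x \<in> K") (auto simp: B_def)
  have B0: "0 \<le> B"
    by (simp add: B_def)
  obtain R where R: "\<And>x. x \<in> K \<Longrightarrow> norm x \<le> R"
    using compact_imp_bounded[OF K] by (auto simp: bounded_iff)
  define h where "h = (\<lambda>n. inverse (real (Suc n)))"
  have h: "0 < h n" "h n \<le> 1" for n
    by (simp_all add: h_def inverse_le_1_iff)
  define q where "q = (\<lambda>n x. (f (h n *\<^sub>R v + x) - f x) / h n)"
  have qi: "integrable lborel (q n)" for n
    unfolding q_def using integral_translate(1)[OF fi] fi by auto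
  have q0: "(LINT x|lborel. q n x) = 0" for n
    unfolding q_def using integral_translate[OF fi] fi by simp
  have "(\<lambda>n. LINT x|lborel. q n x) \<longlonglongrightarrow> (LINT x|lborel. D x)"
  proof (rule integral_dominated_convergence)
    show "D \<in> borel_measurable lborel"
      using borel_measurable_continuous_onI[OF Dc] by simp
    show "q n \<in> borel_measurable lborel" for n
      by (rule borel_measurable_integrable[OF qi])
    \<comment> \<open>Since \<open>h n \<le> 1\<close>, a point of norm above
      \<open>R + norm v\<close> is outside \<open>K\<close> before and after the shift, so one ball
      carries all the quotients.\<close>
    show "integrable lborel (\<lambda>x. B * indicator (cball 0 (R + norm v)) x)"
      by (intro integrable_mult_right integrable_real_indicator) (simp_all add: emeasure_bounded_finite[unfolded infinity_ennreal_def])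
    show "AE x in lborel. (\<lambda>n. q n x) \<longlonglongrightarrow> D x"
    proof (rule AE_I2)
      fix x
      have "((\<lambda>s. f (x + s *\<^sub>R v)) has_real_derivative D x) (at 0)"
        using has_real_derivative_along[OF f, of x v 0] by (simp add: D_def)
      then have "((\<lambda>s. (f (x + s *\<^sub>R v) - f x) / s) \<longlongrightarrow> D x) (at 0)"
        by (simp add: DERIV_def)
      moreover have "filterlim h (at 0) sequentially"
        unfolding filterlim_at h_def
        using LIMSEQ_inverse_real_of_nat by (auto intro!: always_eventually simp del: of_nat_Suc)
      ultimately have "(\<lambda>n. (f (x + h n *\<^sub>R v) - f x) / h n) \<longlonglongrightarrow> D x"
        by (rule filterlim_compose)
      then show "(\<lambda>n. q n x) \<longlonglongrightarrow> D x"
        by (simp add: q_def add.commute)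
    qed
    show "AE x in lborel. norm (q n x) \<le> B * indicator (cball 0 (R + norm v)) x" for n
    proof (rule AE_I2)
      fix x
      show "norm (q n x) \<le> B * indicator (cball 0 (R + norm v)) x"
      proof (cases "x \<in> cball 0 (R + norm v)")
        case True
        \<comment> \<open>The quotient is a value of \<open>D\<close> at an intermediate point,
          hence bounded by \<open>B\<close> uniformly in \<open>n\<close>.\<close>
        have "\<exists>z. 0 < z \<and> z < h n \<and> f (x + h n *\<^sub>R v) - f (x + 0 *\<^sub>R v) = (h n - 0) * D (x + z *\<^sub>R v)"
          unfolding D_def
          using MVT2[OF h(1)[of n], of "\<lambda>s. f (x + s *\<^sub>R v)" "\<lambda>s. frechet_derivative f (at (x + s *\<^sub>R v)) v"]
            has_real_derivative_along[OF f, of x v] by blast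
        then obtain z where "f (x + h n *\<^sub>R v) - f x = h n * D (x + z *\<^sub>R v)"
          by auto
        then have "q n x = D (x + z *\<^sub>R v)"
          using h(1)[of n] by (simp add: q_def add.commute)
        then show ?thesis
          using True B by simp
      next
        case False
        then have x: "R + norm v < norm x" by simp
        have "x \<notin> K"
          using R[of x] x norm_ge_zero[of v] by linarith
        moreover have "h n *\<^sub>R v + x \<notin> K"
        proof
          assume "h n *\<^sub>R v + x \<in> K"
          then have "norm (h n *\<^sub>R v + x) \<le> R" by (rule R)
          moreover have "norm x \<le> norm (h n *\<^sub>R v + x) + norm (h n *\<^sub>R v)"
            using norm_triangle_ineq4[of "h n *\<^sub>R v + x" "h n *\<^sub>R v"] by simp
          moreover have "norm (h n *\<^sub>R v) \<le> norm v"
            using h[of n] by (simp add: mult_left_le_one_le)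
          ultimately show False using x by linarith
        qed
        ultimately show ?thesis
          by (simp add: q_def supp B0)
      qed
    qed
  qed
  then have "(LINT x|lborel. D x) = 0"
    using LIMSEQ_unique by (simp add: q0 LIMSEQ_const_iff)
  then show ?thesis by (simp add: D_def)
qed

text \<open>The product \<open>a x * b x\<close> inherits the compact support of \<open>b\<close>,
  so the integral of its derivative vanishes and no boundary term occurs.\<close>

lemma integral_by_parts:
  fixes a b :: "'a::euclidean_space \<Rightarrow> real"
  assumes a: "smooth a" and b: "smooth b" and K: "compact K" and supp: "\<And>x. x \<notin> K \<Longrightarrow> b x = 0"
  shows "integrable lborel (\<lambda>x. a x * frechet_derivative b (at x) v)"
    and "integrable lborel (\<lambda>x. frechet_derivative a (at x) v * b x)"
    and "(LINT x|lborel. a x * frechet_derivative b (at x) v)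
      = - (LINT x|lborel. frechet_derivative a (at x) v * b x)"
proof -
  show 1: "integrable lborel (\<lambda>x. a x * frechet_derivative b (at x) v)"
    by (rule integrable_compact_support[OF smooth_continuous[OF smooth_mult[OF a smooth_derivative[OF b]]] K])
      (simp add: derivative_zero_outside[OF compact_imp_closed[OF K] supp])
  show 2: "integrable lborel (\<lambda>x. frechet_derivative a (at x) v * b x)"
    by (rule integrable_compact_support[OF smooth_continuous[OF smooth_mult[OF smooth_derivative[OF a] b]] K])
      (simp add: supp)
  have "frechet_derivative (\<lambda>x. a x * b x) (at x) v
      = a x * frechet_derivative b (at x) v + frechet_derivative a (at x) v * b x" for x
    by (subst frechet_derivative_eqI[OF has_derivative_mult[OF smooth_has_derivative[OF a] smooth_has_derivative[OF b]]])
      simp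
  then have "(LINT x|lborel. a x * frechet_derivative b (at x) v + frechet_derivative a (at x) v * b x) = 0"
    using integral_derivative_zero[OF smooth_mult[OF a b] K, of v] by (simp add: supp)
  then show "(LINT x|lborel. a x * frechet_derivative b (at x) v)
      = - (LINT x|lborel. frechet_derivative a (at x) v * b x)"
    using 1 2 by simp
qed

section \<open>Test functions and restrictions of smooth functions\<close>

lemma test_functionE:
  assumes "test_function \<Omega> \<phi>"
  obtains K where "smooth \<phi>" "compact K" "K \<subseteq> \<Omega>" "\<And>x. x \<notin> K \<Longrightarrow> \<phi> x = 0"
  using assms unfolding test_function_def by auto

lemma test_function_smooth: "test_function \<Omega> \<phi> \<Longrightarrow> smooth \<phi>"
  by (simp add: test_function_def)

lemma test_function_outside: "test_function \<Omega> \<phi> \<Longrightarrow> x \<notin> \<Omega> \<Longrightarrow> \<phi> x = 0"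
  unfolding test_function_def by auto

lemma test_function_square_integrable:
  "test_function \<Omega> \<phi> \<Longrightarrow> square_integrable \<phi>"
  by (erule test_functionE) (rule square_integrable_compact_support[OF smooth_continuous])

lemma test_function_bounded_linear:
  fixes \<phi> :: "'a::euclidean_space \<Rightarrow> 'b::euclidean_space"
  assumes "bounded_linear L" "test_function \<Omega> \<phi>"
  shows "test_function \<Omega> (\<lambda>x. L (\<phi> x))"
proof -
  obtain K where "smooth \<phi>" "compact K" "K \<subseteq> \<Omega>" "\<And>x. x \<notin> K \<Longrightarrow> \<phi> x = 0"
    using assms(2) by (rule test_functionE) blast
  then show ?thesis
    unfolding test_function_def
    by (intro conjI exI[of _ K] smooth_bounded_linear[OF assms(1)])
      (auto simp: linear_0[OF bounded_linear.linear[OF assms(1)]])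
qed

lemma test_function_derivative:
  assumes "test_function \<Omega> \<phi>"
  shows "test_function \<Omega> (\<lambda>x. frechet_derivative \<phi> (at x) v)"
proof -
  obtain K where K: "smooth \<phi>" "compact K" "K \<subseteq> \<Omega>" "\<And>x. x \<notin> K \<Longrightarrow> \<phi> x = 0"
    using assms by (rule test_functionE) blast
  then show ?thesis
    unfolding test_function_def
    by (intro conjI exI[of _ K] smooth_derivative)
      (auto intro!: derivative_zero_outside[OF compact_imp_closed])
qed

lemma test_function_add:
  assumes "test_function \<Omega> \<phi>" "test_function \<Omega> \<psi>"
  shows "test_function \<Omega> (\<lambda>x. \<phi> x + \<psi> x)"
proof -
  obtain K where K: "smooth \<phi>" "compact K" "K \<subseteq> \<Omega>" "\<And>x. x \<notin> K \<Longrightarrow> \<phi> x = 0"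
    using assms(1) by (rule test_functionE) blast
  obtain L where L: "smooth \<psi>" "compact L" "L \<subseteq> \<Omega>" "\<And>x. x \<notin> L \<Longrightarrow> \<psi> x = 0"
    using assms(2) by (rule test_functionE) blast
  show ?thesis
    unfolding test_function_def
    using K L by (intro conjI exI[of _ "K \<union> L"] smooth_add) auto
qed

lemma test_function_zero: "test_function \<Omega> (\<lambda>x. 0)"
  unfolding test_function_def by (intro conjI smooth_const exI[of _ "{}"]) auto

lemma test_function_sum:
  "(\<And>i. i \<in> I \<Longrightarrow> test_function \<Omega> (\<phi> i)) \<Longrightarrow> test_function \<Omega> (\<lambda>x. \<Sum>i\<in>I. \<phi> i x)"
  by (induction I rule: infinite_finite_induct) (simp_all add: test_function_zero test_function_add)

lemma test_function_uminus:
  assumes "test_function \<Omega> \<phi>"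
  shows "test_function \<Omega> (\<lambda>x. - \<phi> x)"
  by (rule test_function_bounded_linear[OF bounded_linear_minus[OF bounded_linear_ident] assms])

lemma test_function_diff:
  assumes "test_function \<Omega> \<phi>" "test_function \<Omega> \<psi>"
  shows "test_function \<Omega> (\<lambda>x. \<phi> x - \<psi> x)"
  using test_function_add[OF assms(1) test_function_uminus[OF assms(2)]] by simp

lemma test_function_vec_nth: "test_function \<Omega> \<phi> \<Longrightarrow> test_function \<Omega> (\<lambda>x. \<phi> x $ i)"
  by (rule test_function_bounded_linear[OF bounded_linear_vec_nth])

lemma test_function_vecI:
  fixes \<phi> :: "'a::euclidean_space \<Rightarrow> real^'n"
  assumes "\<And>i. test_function \<Omega> (\<lambda>x. \<phi> x $ i)"
  shows "test_function \<Omega> \<phi>"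
proof -
  have "test_function \<Omega> (\<lambda>x. \<Sum>i\<in>UNIV. (\<phi> x $ i) *\<^sub>R (axis i 1 :: real^'n))"
    by (intro test_function_sum test_function_bounded_linear[OF bounded_linear_scaleR_left] assms)
  moreover have "(\<Sum>i\<in>UNIV. (\<phi> x $ i) *\<^sub>R (axis i 1 :: real^'n)) = \<phi> x" for x
    using basis_expansion[of "\<phi> x"] by (simp add: scalar_mult_eq_scaleR)
  ultimately show ?thesis by simp
qed

section \<open>Vector calculus for smooth functions and test functions\<close>

lemma partial_deriv_vec_nth:
  assumes "smooth u"
  shows "partial_deriv i u x $ j = partial_deriv i (\<lambda>x. u x $ j) x"
  unfolding partial_deriv_def
  by (subst frechet_derivative_eqI[OF bounded_linear.has_derivative[OF bounded_linear_vec_nth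
          smooth_has_derivative[OF assms]]]) simp

lemma grad_nth: "grad h x $ i = partial_deriv i h x"
  by (simp add: grad_def)

lemma divg_eq: "smooth u \<Longrightarrow> divg u x = (\<Sum>i\<in>UNIV. partial_deriv i (\<lambda>x. u x $ i) x)"
  by (simp add: divg_def partial_deriv_vec_nth)

lemma curl_nth:
  assumes "smooth u"
  shows "curl u x $ 1 = partial_deriv 2 (\<lambda>x. u x $ 3) x - partial_deriv 3 (\<lambda>x. u x $ 2) x"
    "curl u x $ 2 = partial_deriv 3 (\<lambda>x. u x $ 1) x - partial_deriv 1 (\<lambda>x. u x $ 3) x"
    "curl u x $ 3 = partial_deriv 1 (\<lambda>x. u x $ 2) x - partial_deriv 2 (\<lambda>x. u x $ 1) x"
  by (simp_all add: curl_def partial_deriv_vec_nth[OF assms])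

lemma smooth_partial_deriv: "smooth f \<Longrightarrow> smooth (partial_deriv i f)"
  unfolding partial_deriv_def by (rule smooth_derivative)

lemma test_function_partial_deriv: "test_function \<Omega> f \<Longrightarrow> test_function \<Omega> (partial_deriv i f)"
  unfolding partial_deriv_def by (rule test_function_derivative)

lemma test_function_grad: "test_function \<Omega> \<phi> \<Longrightarrow> test_function \<Omega> (grad \<phi>)"
  by (intro test_function_vecI) (simp add: grad_nth test_function_partial_deriv)

lemma test_function_divg:
  assumes "test_function \<Omega> \<phi>"
  shows "test_function \<Omega> (divg \<phi>)"
  unfolding divg_def
  by (intro test_function_sum test_function_vec_nth test_function_partial_deriv assms)

lemma smooth_grad: "smooth h \<Longrightarrow> smooth (grad h)"
  by (intro smooth_vecI) (simp add: grad_nth smooth_partial_deriv)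

lemma smooth_curl:
  assumes "smooth u"
  shows "smooth (curl u)"
proof (intro smooth_vecI)
  fix i :: 3
  show "smooth (\<lambda>x. curl u x $ i)"
    using exhaust_3[of i]
    by (elim disjE) (simp_all add: curl_nth[OF assms] smooth_diff smooth_partial_deriv smooth_vec_nth[OF assms])
qed

lemma test_function_curl:
  assumes "test_function \<Omega> \<phi>"
  shows "test_function \<Omega> (curl \<phi>)"
proof (intro test_function_vecI)
  fix i :: 3
  show "test_function \<Omega> (\<lambda>x. curl \<phi> x $ i)"
    using exhaust_3[of i]
    by (elim disjE) (simp_all add: curl_nth[OF test_function_smooth[OF assms]] test_function_diff
        test_function_partial_deriv test_function_vec_nth[OF assms])
qed

text \<open>The six second derivatives cancel in pairs by symmetry.\<close>

lemma divg_curl: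
  assumes "smooth u"
  shows "divg (curl u) x = 0"
proof -
  have s: "smooth (\<lambda>x. u x $ i)" for i
    by (rule smooth_vec_nth[OF assms])
  have d: "partial_deriv i (\<lambda>x. partial_deriv j a x - partial_deriv k b x) x
      = partial_deriv i (partial_deriv j a) x - partial_deriv i (partial_deriv k b) x"
    if "smooth a" "smooth b" for i j k :: 3 and a b :: "real^3 \<Rightarrow> real"
    unfolding partial_deriv_def
    by (subst frechet_derivative_eqI[OF has_derivative_diff[OF smooth_has_derivative smooth_has_derivative]])
      (simp_all add: smooth_derivative that)
  have c: "partial_deriv i (partial_deriv j a) x = partial_deriv j (partial_deriv i a) x"
    if "smooth a" for i j :: 3 and a :: "real^3 \<Rightarrow> real"
    unfolding partial_deriv_def by (rule mixed_derivatives_commute[OF that])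
  show ?thesis
    by (simp add: divg_eq[OF smooth_curl[OF assms]] sum_3 curl_nth[OF assms] d s
        c[of "\<lambda>x. u x $ 3" 2 1] c[of "\<lambda>x. u x $ 2" 3 1] c[of "\<lambda>x. u x $ 1" 3 2])
qed

section \<open>Zero extensions of smooth functions and their weak derivatives\<close>

abbreviation restr :: "'a set \<Rightarrow> ('a \<Rightarrow> 'b::real_vector) \<Rightarrow> 'a \<Rightarrow> 'b" where
  "restr \<Omega> f \<equiv> (\<lambda>x. indicator \<Omega> x *\<^sub>R f x)"

lemma restr_test_function: "test_function \<Omega> \<phi> \<Longrightarrow> restr \<Omega> \<phi> = \<phi>"
  by (auto simp: indicator_def test_function_outside)

lemma square_integrable_restr:
  fixes f :: "'a::euclidean_space \<Rightarrow> 'b::euclidean_space"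
  assumes "open \<Omega>" "bounded \<Omega>" "continuous_on UNIV f"
  shows "square_integrable (restr \<Omega> f)"
  unfolding square_integrable_def
proof
  have [measurable]: "f \<in> borel_measurable borel"
    by (rule borel_measurable_continuous_onI[OF assms(3)])
  have [measurable]: "\<Omega> \<in> sets borel"
    using assms(1) by simp
  show "restr \<Omega> f \<in> borel_measurable lborel"
    by measurable
  have "integrable lborel (\<lambda>x. indicator (closure \<Omega>) x *\<^sub>R (norm (f x))\<^sup>2)"
    using assms by (intro borel_integrable_compact continuous_intros) (auto intro: continuous_on_subset)
  then show "integrable lborel (\<lambda>x. (norm (restr \<Omega> f x))\<^sup>2)"
  proof (rule Bochner_Integration.integrable_bound)
    show "AE x in lborel. norm ((norm (restr \<Omega> f x))\<^sup>2) \<le> norm (indicator (closure \<Omega>) x *\<^sub>R (norm (f x))\<^sup>2)"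
      using closure_subset[of \<Omega>] by (auto simp: indicator_def)
  qed measurable
qed

lemma restr_in_L2:
  fixes f :: "'a::euclidean_space \<Rightarrow> 'b::euclidean_space"
  assumes "open \<Omega>" "bounded \<Omega>" "continuous_on UNIV f"
  shows "l2_of (restr \<Omega> f) \<in> L2 \<Omega>"
  by (simp add: l2_of_in_L2_iff square_integrable_restr[OF assms])

text \<open>A test function already vanishes outside \<open>\<Omega>\<close>, so the cut-off
  disappears under the integral and integration by parts can take place on the whole space.\<close>

lemma l2_of_restr_inner:
  fixes f :: "'a::euclidean_space \<Rightarrow> 'b::euclidean_space"
  assumes "open \<Omega>" "bounded \<Omega>" "continuous_on UNIV f" "test_function \<Omega> \<phi>"
  shows "l2_of (restr \<Omega> f) \<bullet> l2_of \<phi> = (LINT x|lborel. f x \<bullet> \<phi> x)"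
proof -
  have "l2_of (restr \<Omega> f) \<bullet> l2_of \<phi> = (LINT x|lborel. restr \<Omega> f x \<bullet> \<phi> x)"
    by (rule l2_of_inner[OF square_integrable_restr[OF assms(1-3)] test_function_square_integrable[OF assms(4)]])
  also have "\<dots> = (LINT x|lborel. f x \<bullet> \<phi> x)"
    using test_function_outside[OF assms(4)]
    by (intro Bochner_Integration.integral_cong) (auto simp: indicator_def)
  finally show ?thesis .
qed

lemma test_integral_by_parts:
  fixes a b :: "real^3 \<Rightarrow> real"
  assumes "smooth a" "test_function \<Omega> b"
  shows "integrable lborel (\<lambda>x. a x * partial_deriv i b x)"
    and "integrable lborel (\<lambda>x. partial_deriv i a x * b x)"
    and "(LINT x|lborel. a x * partial_deriv i b x) = - (LINT x|lborel. partial_deriv i a x * b x)"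
proof -
  obtain K where K: "smooth b" "compact K" "\<And>x. x \<notin> K \<Longrightarrow> b x = 0"
    using assms(2) by (rule test_functionE) blast
  show "integrable lborel (\<lambda>x. a x * partial_deriv i b x)"
    "integrable lborel (\<lambda>x. partial_deriv i a x * b x)"
    "(LINT x|lborel. a x * partial_deriv i b x) = - (LINT x|lborel. partial_deriv i a x * b x)"
    unfolding partial_deriv_def by (intro integral_by_parts[OF assms(1) K]; simp)+
qed

text \<open>The jump of the zero extension at the boundary is invisible to test functions, so
  \<open>h\<close> is subject to no boundary condition.\<close>

lemma has_grad_restr:
  fixes h :: "real^3 \<Rightarrow> real"
  assumes "open \<Omega>" "bounded \<Omega>" "smooth h"
  shows "has_grad \<Omega> (l2_of (restr \<Omega> h)) (l2_of (restr \<Omega> (grad h)))"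
  unfolding has_grad_def
proof (intro conjI allI impI)
  show "l2_of (restr \<Omega> h) \<in> L2 \<Omega>" "l2_of (restr \<Omega> (grad h)) \<in> L2 \<Omega>"
    using assms by (intro restr_in_L2 smooth_continuous smooth_grad; simp)+
  fix \<phi> :: "real^3 \<Rightarrow> real^3"
  assume \<phi>: "test_function \<Omega> \<phi>"
  note parts = test_integral_by_parts[OF assms(3) test_function_vec_nth[OF \<phi>]]
  have "l2_of (restr \<Omega> h) \<bullet> l2_of (divg \<phi>) = (LINT x|lborel. h x * divg \<phi> x)"
    using l2_of_restr_inner[OF assms(1,2) smooth_continuous[OF assms(3)] test_function_divg[OF \<phi>]] by simp
  also have "\<dots> = (\<Sum>i\<in>UNIV. LINT x|lborel. h x * partial_deriv i (\<lambda>x. \<phi> x $ i) x)"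
    using parts(1) by (simp add: divg_eq[OF test_function_smooth[OF \<phi>]] sum_distrib_left)
  also have "\<dots> = - (\<Sum>i\<in>UNIV. LINT x|lborel. partial_deriv i h x * \<phi> x $ i)"
    by (simp add: parts(3) sum_negf)
  also have "\<dots> = - (LINT x|lborel. grad h x \<bullet> \<phi> x)"
    using parts(2) by (simp add: inner_vec_def grad_nth)
  also have "\<dots> = - (l2_of (restr \<Omega> (grad h)) \<bullet> l2_of \<phi>)"
    using l2_of_restr_inner[OF assms(1,2) smooth_continuous[OF smooth_grad[OF assms(3)]] \<phi>] by simp
  finally show "l2_of (restr \<Omega> h) \<bullet> l2_of (divg \<phi>) = - (l2_of (restr \<Omega> (grad h)) \<bullet> l2_of \<phi>)" .
qed

text \<open>Each term of the curl is integrated by parts separately; the sign this produces is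
  undone by the antisymmetry of the curl.\<close>

lemma has_rot_restr:
  fixes u :: "real^3 \<Rightarrow> real^3"
  assumes "open \<Omega>" "bounded \<Omega>" "smooth u"
  shows "has_rot \<Omega> (l2_of (restr \<Omega> u)) (l2_of (restr \<Omega> (curl u)))"
  unfolding has_rot_def
proof (intro conjI allI impI)
  show "l2_of (restr \<Omega> u) \<in> L2 \<Omega>" "l2_of (restr \<Omega> (curl u)) \<in> L2 \<Omega>"
    using assms by (intro restr_in_L2 smooth_continuous smooth_curl; simp)+
  fix \<phi> :: "real^3 \<Rightarrow> real^3"
  assume \<phi>: "test_function \<Omega> \<phi>"
  note parts = test_integral_by_parts[OF smooth_vec_nth[OF assms(3)] test_function_vec_nth[OF \<phi>]]
  have "l2_of (restr \<Omega> u) \<bullet> l2_of (curl \<phi>) = (LINT x|lborel. u x \<bullet> curl \<phi> x)"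
    by (rule l2_of_restr_inner[OF assms(1,2) smooth_continuous[OF assms(3)] test_function_curl[OF \<phi>]])
  also have "\<dots> = (LINT x|lborel. curl u x \<bullet> \<phi> x)"
    using parts(1,2)
    by (simp add: inner_vec_def sum_3 curl_nth[OF assms(3)] curl_nth[OF test_function_smooth[OF \<phi>]]
        right_diff_distrib left_diff_distrib parts(3))
  also have "\<dots> = l2_of (restr \<Omega> (curl u)) \<bullet> l2_of \<phi>"
    using l2_of_restr_inner[OF assms(1,2) smooth_continuous[OF smooth_curl[OF assms(3)]] \<phi>] by simp
  finally show "l2_of (restr \<Omega> u) \<bullet> l2_of (curl \<phi>) = l2_of (restr \<Omega> (curl u)) \<bullet> l2_of \<phi>" .
qed

lemma has_grad_test_function:
  assumes "open \<Omega>" "bounded \<Omega>" "test_function \<Omega> \<phi>"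
  shows "has_grad \<Omega> (l2_of \<phi>) (l2_of (grad \<phi>))"
  using has_grad_restr[OF assms(1,2) test_function_smooth[OF assms(3)]]
  by (simp only: restr_test_function[OF assms(3)] restr_test_function[OF test_function_grad[OF assms(3)]])

lemma zero_in_L2: "0 \<in> L2 \<Omega>"
  using l2_of_in_L2_iff[OF square_integrable_zero, of \<Omega>] by (simp add: zero_l2_def)

text \<open>Pairing \<open>g\<close> with a curl amounts to pairing the potential with the
  divergence of that curl, which is zero.\<close>

lemma has_rot_gradient:
  assumes "has_grad \<Omega> h g"
  shows "has_rot \<Omega> g 0"
  unfolding has_rot_def
proof (intro conjI allI impI)
  show "g \<in> L2 \<Omega>" "0 \<in> L2 \<Omega>"
    using assms by (simp_all add: has_grad_def zero_in_L2)
  fix \<phi> :: "real^3 \<Rightarrow> real^3"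
  assume \<phi>: "test_function \<Omega> \<phi>"
  have "divg (curl \<phi>) = (\<lambda>x. 0)"
    using divg_curl[OF test_function_smooth[OF \<phi>]] by blast
  then have "h \<bullet> l2_of (divg (curl \<phi>)) = 0"
    by (simp flip: zero_l2_def)
  then show "g \<bullet> l2_of (curl \<phi>) = 0 \<bullet> l2_of \<phi>"
    using assms test_function_curl[OF \<phi>] by (simp add: has_grad_def)
qed

section \<open>Bump functions and totality of the test functions\<close>

text \<open>Cauchy's function, all of whose derivatives vanish at the origin; products of it give
  smooth cut-offs of compact support.\<close>

definition flat :: "real \<Rightarrow> real" where
  "flat t = (if 0 < t then exp (- (1 / t)) else 0)"

text \<open>The induction needs every \<open>k\<close> at once, since splitting off the constant
  coefficient raises the power of \<open>s\<close>.\<close>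

lemma power_times_poly_over_exp_tendsto_0:
  fixes p :: "real poly"
  shows "((\<lambda>s. s ^ k * poly p s / exp s) \<longlongrightarrow> 0) at_top"
proof (induction p arbitrary: k)
  case (pCons a p)
  have "((\<lambda>s::real. a * (s ^ k / exp s) + s ^ Suc k * poly p s / exp s) \<longlongrightarrow> a * 0 + 0) at_top"
    by (intro tendsto_add tendsto_mult tendsto_const tendsto_power_div_exp_0 pCons.IH)
  then show ?case
    by (simp add: distrib_left add_divide_distrib mult_ac)
qed simp

lemma smooth_flat: "smooth flat"
proof (rule smooth_coinduct[where P =
      "\<lambda>f. \<exists>p :: real poly. f = (\<lambda>t. if 0 < t then poly p (1/t) * exp (- (1/t)) else 0)"])
  show "\<exists>p :: real poly. flat = (\<lambda>t. if 0 < t then poly p (1/t) * exp (- (1/t)) else 0)"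
    by (rule exI[of _ 1]) (auto simp: flat_def)
  fix f :: "real \<Rightarrow> real"
  assume "\<exists>p :: real poly. f = (\<lambda>t. if 0 < t then poly p (1/t) * exp (- (1/t)) else 0)"
  then obtain p :: "real poly" where
    f: "f = (\<lambda>t. if 0 < t then poly p (1/t) * exp (- (1/t)) else 0)" by blast
  \<comment> \<open>Differentiating \<open>poly p (1/t) * exp (- (1/t))\<close> yields the factor
    \<open>1/t^2\<close>, here the polynomial \<open>[:0, 0, 1:]\<close>, and the difference of
    \<open>p\<close> and its derivative.\<close>
  define p' where "p' = [:0, 0, 1:] * (p - pderiv p)"
  define f' where "f' = (\<lambda>t. if 0 < t then poly p' (1/t) * exp (- (1/t)) else 0)"
  have d: "(f has_real_derivative f' t) (at t)" for t
  proof -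
    consider "0 < t" | "t < 0" | "t = 0" by linarith
    then show ?thesis
    proof cases
      case 1
      have "((\<lambda>t. poly p (1/t) * exp (- (1/t))) has_real_derivative f' t) (at t)"
        using 1 unfolding f'_def p'_def
        by (auto intro!: derivative_eq_intros DERIV_chain2[OF poly_DERIV]
            simp: field_simps power2_eq_square)
      then show ?thesis
        by (rule has_field_derivative_transform_within_open[where S = "{0<..}"]) (use 1 in \<open>auto simp: f\<close>)
    next
      case 2
      have "((\<lambda>t. 0) has_real_derivative f' t) (at t)"
        using 2 by (simp add: f'_def)
      then show ?thesis
        by (rule has_field_derivative_transform_within_open[where S = "{..<0}"]) (use 2 in \<open>auto simp: f\<close>)
    next
      case 3
      \<comment> \<open>Under \<open>s = inverse h\<close> the right difference quotient becomes
        \<open>s * poly p s / exp s\<close>.\<close>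
      have "((\<lambda>h. f h / h) \<longlongrightarrow> 0) (at_right 0)"
        unfolding filterlim_at_right_to_top
      proof (rule Lim_transform_eventually[OF power_times_poly_over_exp_tendsto_0[of 1 p]])
        show "eventually (\<lambda>s. s ^ 1 * poly p s / exp s = f (inverse s) / inverse s) at_top"
          using eventually_gt_at_top[of 0]
          by eventually_elim (simp add: f exp_minus field_simps)
      qed
      moreover have "((\<lambda>h. f h / h) \<longlongrightarrow> 0) (at_left 0)"
        by (rule tendsto_eventually) (auto simp: f eventually_at_topological)
      ultimately have "((\<lambda>h. f h / h) \<longlongrightarrow> 0) (at 0)"
        by (simp add: filterlim_at_split)
      moreover have "f 0 = 0" "f' 0 = 0"
        by (simp_all add: f f'_def)
      ultimately show ?thesis
        by (simp add: 3 DERIV_def)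
    qed
  qed
  have h: "(f has_derivative (\<lambda>v. v * f' t)) (at t)" for t
    using d[of t] by (simp add: has_field_derivative_def mult.commute[of _ "f' t"])
  have "(\<lambda>t. v * f' t) = (\<lambda>t. if 0 < t then poly (smult v p') (1/t) * exp (- (1/t)) else 0)" for v
    by (auto simp: f'_def)
  then show "f differentiable_on UNIV \<and> (\<forall>v. \<exists>p :: real poly.
      (\<lambda>x. frechet_derivative f (at x) v) = (\<lambda>t. if 0 < t then poly p (1/t) * exp (- (1/t)) else 0))"
    using h by (auto simp: differentiable_on_def differentiable_def frechet_derivative_eqI[OF h])
qed

lemma flat_range: "0 \<le> flat t" "flat t \<le> 1"
  by (auto simp: flat_def)

lemma flat_tendsto_1: "(flat \<longlongrightarrow> 1) at_top"
proof (rule Lim_transform_eventually)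
  have "((\<lambda>t::real. exp (- inverse t)) \<longlongrightarrow> exp (- 0)) at_top"
    by (intro tendsto_exp tendsto_minus tendsto_inverse_0_at_top filterlim_ident)
  then show "((\<lambda>t::real. exp (- inverse t)) \<longlongrightarrow> 1) at_top"
    by simp
  show "eventually (\<lambda>t. exp (- inverse t) = flat t) at_top"
    using eventually_gt_at_top[of 0] by eventually_elim (simp add: flat_def divide_inverse)
qed

text \<open>A smooth approximation of the indicator of \<open>box a b\<close>. The
  \<open>- 1\<close> makes a factor vanish within \<open>1 / (n + 1)\<close> of a face, so the
  support is compact in the open box; the growing \<open>Suc n\<close> drives the values inside to
  \<open>1\<close>.\<close>

definition box_bump :: "'a::euclidean_space \<Rightarrow> 'a \<Rightarrow> nat \<Rightarrow> 'a \<Rightarrow> real" where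
  "box_bump a b n x = (\<Prod>i\<in>Basis.
     flat (real (Suc n) * (x \<bullet> i - a \<bullet> i) - 1) * flat (real (Suc n) * (b \<bullet> i - x \<bullet> i) - 1))"

lemma box_bump_range: "0 \<le> box_bump a b n x" "box_bump a b n x \<le> 1"
  unfolding box_bump_def by (auto intro!: prod_nonneg prod_le_1 mult_le_one simp: flat_range)

lemma smooth_box_bump: "smooth (box_bump a b n)"
proof -
  have "smooth (\<lambda>x::'a. flat (r * (x \<bullet> i) + c))" for r c i
    by (rule smooth_affine[OF _ smooth_flat]) (intro bounded_linear_const_mult bounded_linear_inner_left)
  note s = this[of "real (Suc n)" _ "- real (Suc n) * (a \<bullet> _) - 1"]
    this[of "- real (Suc n)" _ "real (Suc n) * (b \<bullet> _) - 1"]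
  have "smooth (\<lambda>x::'a. \<Prod>i\<in>Basis. flat (real (Suc n) * (x \<bullet> i) + (- real (Suc n) * (a \<bullet> i) - 1)) *
     flat (- real (Suc n) * (x \<bullet> i) + (real (Suc n) * (b \<bullet> i) - 1)))"
    by (intro smooth_prod smooth_mult s)
  then show ?thesis
    by (simp add: box_bump_def[abs_def] algebra_simps)
qed

lemma test_function_box_bump:
  assumes "box a b \<subseteq> \<Omega>"
  shows "test_function \<Omega> (box_bump a b n)"
proof -
  define \<epsilon> where "\<epsilon> = inverse (real (Suc n))"
  define K where "K = {x. \<forall>i\<in>Basis. a \<bullet> i + \<epsilon> \<le> x \<bullet> i \<and> x \<bullet> i \<le> b \<bullet> i - \<epsilon>}"
  have \<epsilon>: "0 < \<epsilon>" by (simp add: \<epsilon>_def)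
  have "K = cbox (\<Sum>i\<in>Basis. (a \<bullet> i + \<epsilon>) *\<^sub>R i) (\<Sum>i\<in>Basis. (b \<bullet> i - \<epsilon>) *\<^sub>R i)"
    by (simp add: K_def cbox_def)
  then have "compact K" by (simp add: compact_cbox)
  moreover have "K \<subseteq> \<Omega>"
  proof -
    have "K \<subseteq> box a b"
      using \<epsilon> by (force simp: K_def box_def)
    then show ?thesis using assms by blast
  qed
  moreover have "box_bump a b n x = 0" if "x \<notin> K" for x
  proof -
    obtain i where i: "i \<in> Basis" "x \<bullet> i - a \<bullet> i < \<epsilon> \<or> b \<bullet> i - x \<bullet> i < \<epsilon>"
    proof -
      obtain i where i: "i \<in> Basis" "\<not> (a \<bullet> i + \<epsilon> \<le> x \<bullet> i \<and> x \<bullet> i \<le> b \<bullet> i - \<epsilon>)"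
        using \<open>x \<notin> K\<close> by (auto simp: K_def)
      have "x \<bullet> i - a \<bullet> i < \<epsilon> \<or> b \<bullet> i - x \<bullet> i < \<epsilon>" using i(2) by linarith
      with i(1) show thesis by (rule that)
    qed
    have fz: "flat (real (Suc n) * t - 1) = 0" if "t < \<epsilon>" for t
      using mult_left_mono[OF less_imp_le[OF that], of "real (Suc n)"]
      by (simp add: \<epsilon>_def flat_def not_less del: of_nat_Suc)
    have "flat (real (Suc n) * (x \<bullet> i - a \<bullet> i) - 1) * flat (real (Suc n) * (b \<bullet> i - x \<bullet> i) - 1) = 0"
      using i(2) by (elim disjE) (simp_all only: fz mult_zero_left mult_zero_right)
    then show ?thesis
      unfolding box_bump_def using i(1) by (intro prod_zero) auto
  qed
  ultimately show ?thesis
    unfolding test_function_def using smooth_box_bump by blast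
qed

lemma box_bump_tendsto: "(\<lambda>n. box_bump a b n x) \<longlonglongrightarrow> indicator (box a b) x"
proof (cases "x \<in> box a b")
  case True
  have "(\<lambda>n. flat (real (Suc n) * t - 1)) \<longlonglongrightarrow> 1" if "0 < t" for t
  proof (rule filterlim_compose[OF flat_tendsto_1])
    have "filterlim (\<lambda>n. - 1 + t * real (Suc n)) at_top sequentially"
      by (intro filterlim_tendsto_add_at_top[OF tendsto_const] that
          filterlim_tendsto_pos_mult_at_top[OF tendsto_const]
          filterlim_compose[OF filterlim_real_sequentially filterlim_Suc])
    then show "filterlim (\<lambda>n. real (Suc n) * t - 1) at_top sequentially"
      by (simp add: algebra_simps)
  qed
  then have "(\<lambda>n. box_bump a b n x) \<longlonglongrightarrow> (\<Prod>i\<in>(Basis::'a set). 1 * 1)"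
    unfolding box_bump_def using True by (intro tendsto_prod tendsto_mult) (auto simp: box_def)
  then show ?thesis using True by simp
next
  case False
  then have "box_bump a b n x = 0" for n
    using test_function_outside[OF test_function_box_bump[OF order_refl]] by blast
  then show ?thesis using False by simp
qed

text \<open>The sets with integral zero form a Dynkin system (\<open>total\<close> handles
  complements), and boxes are an intersection-stable generator of the Borel sets; uniqueness of
  densities concludes.\<close>

lemma AE_zero_if_box_integrals_zero:
  fixes f :: "'a::euclidean_space \<Rightarrow> real"
  assumes f: "integrable lborel f" and total: "(LINT x|lborel. f x) = 0"
    and box: "\<And>a b. (LINT x:box a b|lborel. f x) = 0"
  shows "AE x in lborel. f x = 0"
proof (rule density_unique_real[OF f])
  show "integrable lborel (\<lambda>x::'a. 0::real)" by simp
  fix A :: "'a set"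
  assume A: "A \<in> sets lborel"
  have si: "set_integrable lborel B f" if "B \<in> sets borel" for B
    unfolding set_integrable_def using integrable_mult_indicator[of B lborel f] f that by simp
  have borel: "sigma_sets UNIV (range (\<lambda>(a, b). box a b)) = (sets borel :: 'a set set)"
    by (subst borel_eq_box) simp
  have "(LINT x:A|lborel. f x) = 0"
  proof (rule sigma_sets_induct_disjoint[of "range (\<lambda>(a, b). box a b)" UNIV A])
    show "Int_stable (range (\<lambda>(a, b). box a b :: 'a set))"
      by (auto simp: Int_stable_def box_Int_box)
    show "A \<in> sigma_sets UNIV (range (\<lambda>(a, b). box a b))"
      using A by (simp add: borel)
  next
    fix B assume "B \<in> range (\<lambda>(a, b). box a b :: 'a set)"
    then show "(LINT x:B|lborel. f x) = 0" using box by auto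
  next
    fix B :: "'a set" assume B: "B \<in> sigma_sets UNIV (range (\<lambda>(a, b). box a b))"
      and 0: "(LINT x:B|lborel. f x) = 0"
    have "(LINT x:UNIV - B|lborel. f x) + (LINT x:B|lborel. f x) = (LINT x:(UNIV - B) \<union> B|lborel. f x)"
      using B by (intro set_integral_Un[symmetric] si) (auto simp: borel)
    then show "(LINT x:UNIV - B|lborel. f x) = 0"
      using 0 total by (simp add: set_lebesgue_integral_def)
  next
    fix B :: "nat \<Rightarrow> 'a set"
    assume B: "disjoint_family B" "range B \<subseteq> sigma_sets UNIV (range (\<lambda>(a, b). box a b))"
      and 0: "\<And>i. (LINT x:B i|lborel. f x) = 0"
    have "(LINT x:(\<Union>i. B i)|lborel. f x) = (\<Sum>i. LINT x:B i|lborel. f x)"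
      using B by (intro lebesgue_integral_countable_add si) (auto simp: borel disjoint_family_on_def)
    then show "(LINT x:(\<Union>i. B i)|lborel. f x) = 0"
      by (simp add: 0)
  qed (auto simp: set_lebesgue_integral_def)
  then show "(LINT x:A|lborel. f x) = (LINT x:A|lborel. 0)"
    by (simp add: set_lebesgue_integral_def)
qed

text \<open>The bumps times the vector \<open>e\<close> are test functions, stay below the indicator
  and converge to it, so dominated convergence applies.\<close>

lemma box_integral_zero:
  fixes w :: "('a::euclidean_space, 'b::euclidean_space) l2"
  assumes w: "\<And>\<phi>. test_function \<Omega> \<phi> \<Longrightarrow> w \<bullet> l2_of \<phi> = 0" and ab: "box a b \<subseteq> \<Omega>"
  shows "integrable lborel (\<lambda>x. indicator (box a b) x * (rep_l2 w x \<bullet> e))"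
    and "(LINT x|lborel. indicator (box a b) x * (rep_l2 w x \<bullet> e)) = 0"
proof -
  define r where "r = rep_l2 w"
  have r: "square_integrable r" by (simp add: r_def square_integrable_rep_l2)
  have rm [measurable]: "r \<in> borel_measurable borel"
    using r by (simp add: square_integrable_def)
  have "integrable lborel (\<lambda>x. r x \<bullet> (indicator (box a b) x *\<^sub>R e))"
    by (rule square_integrable_inner[OF r square_integrable_restr]) auto
  then show i: "integrable lborel (\<lambda>x. indicator (box a b) x * (rep_l2 w x \<bullet> e))"
    by (simp add: r_def)
  have t: "test_function \<Omega> (\<lambda>x. box_bump a b n x *\<^sub>R e)" for n
    by (rule test_function_bounded_linear[OF bounded_linear_scaleR_left test_function_box_bump[OF ab]])
  have b: "box_bump a b n \<in> borel_measurable borel" for n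
    by (rule borel_measurable_continuous_onI[OF smooth_continuous[OF smooth_box_bump]])
  have z: "box_bump a b n x = 0" if "x \<notin> box a b" for n x
    using test_function_outside[OF test_function_box_bump[OF order_refl] that] .
  have "(\<lambda>n. LINT x|lborel. box_bump a b n x * (r x \<bullet> e))
      \<longlonglongrightarrow> (LINT x|lborel. indicator (box a b) x * (r x \<bullet> e))"
  proof (rule integral_dominated_convergence)
    show "integrable lborel (\<lambda>x. norm (indicator (box a b) x * (r x \<bullet> e)))"
      using i by (intro integrable_norm) (simp add: r_def)
    show "AE x in lborel. (\<lambda>n. box_bump a b n x * (r x \<bullet> e)) \<longlonglongrightarrow> indicator (box a b) x * (r x \<bullet> e)"
      by (intro AE_I2 tendsto_mult tendsto_const box_bump_tendsto)
    show "AE x in lborel. norm (box_bump a b n x * (r x \<bullet> e)) \<le> norm (indicator (box a b) x * (r x \<bullet> e))" for n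
    proof (rule AE_I2)
      fix x
      show "norm (box_bump a b n x * (r x \<bullet> e)) \<le> norm (indicator (box a b) x * (r x \<bullet> e))"
        using box_bump_range[of a b n x] z[of x n]
        by (cases "x \<in> box a b") (auto simp: abs_mult intro!: mult_left_le_one_le)
    qed
    show "(\<lambda>x. box_bump a b n x * (r x \<bullet> e)) \<in> borel_measurable lborel" for n
      using b[of n] by measurable
  qed measurable
  moreover have "(LINT x|lborel. box_bump a b n x * (r x \<bullet> e)) = 0" for n
  proof -
    have "w \<bullet> l2_of (\<lambda>x. box_bump a b n x *\<^sub>R e) = (LINT x|lborel. r x \<bullet> (box_bump a b n x *\<^sub>R e))"
      using l2_of_inner[OF r test_function_square_integrable[OF t]] by (simp add: r_def)
    then show ?thesis using w[OF t[of n]] by simp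
  qed
  ultimately show "(LINT x|lborel. indicator (box a b) x * (rep_l2 w x \<bullet> e)) = 0"
    by (simp add: LIMSEQ_const_iff r_def)
qed

text \<open>The fundamental lemma of the calculus of variations. A square integrable field need not
  be integrable on the whole space, so its components are treated on boxes inside
  \<open>\<Omega>\<close>, countably many of which cover \<open>\<Omega>\<close>.\<close>

lemma test_functions_total:
  fixes w :: "('a::euclidean_space, 'b::euclidean_space) l2"
  assumes "open \<Omega>" "w \<in> L2 \<Omega>" and w: "\<And>\<phi>. test_function \<Omega> \<phi> \<Longrightarrow> w \<bullet> l2_of \<phi> = 0"
  shows "w = 0"
proof -
  have box: "AE x in lborel. x \<in> box a b \<longrightarrow> rep_l2 w x = 0" if ab: "box a b \<subseteq> \<Omega>" for a b
  proof -
    have "AE x in lborel. indicator (box a b) x * (rep_l2 w x \<bullet> e) = 0" for e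
    proof (rule AE_zero_if_box_integrals_zero)
      show "integrable lborel (\<lambda>x. indicator (box a b) x * (rep_l2 w x \<bullet> e))"
        "(LINT x|lborel. indicator (box a b) x * (rep_l2 w x \<bullet> e)) = 0"
        using box_integral_zero[OF w ab] by auto
      show "(LINT x:box c d|lborel. indicator (box a b) x * (rep_l2 w x \<bullet> e)) = 0" for c d
      proof -
        obtain c' d' where cd: "box c d \<inter> box a b = box c' d'"
          by (auto simp: box_Int_box)
        then have "box c' d' \<subseteq> \<Omega>" using ab by blast
        then have "(LINT x|lborel. indicator (box c d \<inter> box a b) x * (rep_l2 w x \<bullet> e)) = 0"
          unfolding cd using box_integral_zero(2)[OF w] by blast
        then show ?thesis
          by (simp add: set_lebesgue_integral_def indicator_inter_arith mult.assoc)
      qed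
    qed
    then have "AE x in lborel. \<forall>e\<in>Basis. indicator (box a b) x * (rep_l2 w x \<bullet> e) = 0"
      by (intro AE_finite_allI) auto
    then show ?thesis
    proof eventually_elim
      case (elim x)
      show ?case
      proof
        assume "x \<in> box a b"
        then have "rep_l2 w x \<bullet> e = 0 \<bullet> e" if "e \<in> Basis" for e
          using elim[rule_format, OF that] by simp
        then show "rep_l2 w x = 0"
          by (rule euclidean_eqI)
      qed
    qed
  qed
  obtain \<D> where D: "countable \<D>" "\<D> \<subseteq> Pow \<Omega>" "\<And>X. X \<in> \<D> \<Longrightarrow> \<exists>a b. X = box a b" "\<Union>\<D> = \<Omega>"
    using open_countable_Union_open_box[OF assms(1)] by metis
  have "AE x in lborel. \<forall>X\<in>\<D>. x \<in> X \<longrightarrow> rep_l2 w x = 0"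
  proof (subst AE_ball_countable[OF D(1)], intro ballI)
    fix X assume X: "X \<in> \<D>"
    then obtain a b where ab: "X = box a b" using D(3) by blast
    have "box a b \<subseteq> \<Omega>"
      using subsetD[OF D(2) X] by (simp add: ab)
    then show "AE x in lborel. x \<in> X \<longrightarrow> rep_l2 w x = 0"
      unfolding ab by (rule box)
  qed
  moreover have "AE x in lborel. x \<notin> \<Omega> \<longrightarrow> rep_l2 w x = 0"
    using assms(2) by (simp add: in_L2_iff)
  ultimately have "AE x in lborel. rep_l2 w x = 0"
    by eventually_elim (use D(4) in auto)
  then have "l2_of (rep_l2 w) = l2_of (\<lambda>x. 0)"
    by (simp only: l2_of_eq_iff[OF square_integrable_rep_l2 square_integrable_zero])
  then show ?thesis
    by (simp add: zero_l2_def)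
qed

lemma subspace_L2: "subspace (L2 \<Omega>)"
proof (rule subspaceI)
  show "0 \<in> L2 \<Omega>" by (rule zero_in_L2)
  fix u v :: "('a, 'b) l2" and c :: real
  assume u: "u \<in> L2 \<Omega>"
  note s = square_integrable_rep_l2
  have "AE x in lborel. x \<notin> \<Omega> \<longrightarrow> c *\<^sub>R rep_l2 u x = 0"
    using u[unfolded in_L2_iff] by eventually_elim simp
  then have "l2_of (\<lambda>x. c *\<^sub>R rep_l2 u x) \<in> L2 \<Omega>"
    by (rule iffD2[OF l2_of_in_L2_iff[OF square_integrable_scaleR[OF s]]])
  then show "c *\<^sub>R u \<in> L2 \<Omega>"
    by (simp add: l2_of_scaleR s)
  assume v: "v \<in> L2 \<Omega>"
  have "AE x in lborel. x \<notin> \<Omega> \<longrightarrow> rep_l2 u x + rep_l2 v x = 0"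
    using u[unfolded in_L2_iff] v[unfolded in_L2_iff] by eventually_elim simp
  then have "l2_of (\<lambda>x. rep_l2 u x + rep_l2 v x) \<in> L2 \<Omega>"
    by (simp add: l2_of_in_L2_iff square_integrable_add s)
  then show "u + v \<in> L2 \<Omega>"
    by (simp add: l2_of_add s)
qed

lemma has_rot_unique:
  assumes "open \<Omega>" "has_rot \<Omega> u w" "has_rot \<Omega> u w'"
  shows "w = w'"
proof -
  have "w - w' = 0"
    using assms by (intro test_functions_total[OF assms(1)])
      (auto simp: has_rot_def inner_diff_left intro!: subspace_diff subspace_L2)
  then show ?thesis by simp
qed

lemma has_div_unique:
  assumes "open \<Omega>" "has_div \<Omega> u d" "has_div \<Omega> u d'"
  shows "d = d'"
proof -
  have "d - d' = 0"
    using assms by (intro test_functions_total[OF assms(1)])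
      (auto simp: has_div_def inner_diff_left intro!: subspace_diff subspace_L2)
  then show ?thesis by simp
qed

text \<open>Uniqueness of weak rotors fixes the definite description in \<open>rot\<close> as soon
  as one weak rotor is exhibited.\<close>

lemma rot_eqI: "open \<Omega> \<Longrightarrow> has_rot \<Omega> u w \<Longrightarrow> rot \<Omega> u = w"
  unfolding rot_def using has_rot_unique by blast

section \<open>Oscillating fields\<close>

text \<open>The phase \<open>c\<close> closes the family under differentiation up to factors: cosine
  is the sine with its phase raised by \<open>pi/2\<close>.\<close>

definition wave :: "real \<Rightarrow> real \<Rightarrow> real^3 \<Rightarrow> real" where
  "wave n c x = sin (n * x $ 1 + c)"

definition wave_energy :: "(real^3) set \<Rightarrow> real \<Rightarrow> real \<Rightarrow> real" where
  "wave_energy \<Omega> n c = (LINT x|lborel. indicator \<Omega> x * (wave n c x)\<^sup>2)"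

lemma smooth_wave: "smooth (wave n c)"
proof -
  have "smooth (\<lambda>x::real^3. 1 * sin ((n * x $ 1 + c) + 0))"
    by (rule smooth_affine[OF _ smooth_scaled_sin[of 1 0]])
      (intro bounded_linear_const_mult bounded_linear_vec_nth)
  then show ?thesis by (simp add: wave_def[abs_def])
qed

lemma smooth_wave_scaleR: "smooth (\<lambda>x. wave n c x *\<^sub>R e)"
  by (rule smooth_bounded_linear[OF bounded_linear_scaleR_left smooth_wave])

lemma wave_shift: "wave n (c + pi/2) x = cos (n * x $ 1 + c)"
  by (simp add: wave_def sin_add flip: add.assoc)

lemma partial_deriv_wave:
  "partial_deriv i (wave n c) x = (if i = 1 then n * wave n (c + pi/2) x else 0)"
proof -
  have "(wave n c has_derivative (\<lambda>v. n * v $ 1 * cos (n * x $ 1 + c))) (at x)"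
    unfolding wave_def[abs_def]
    by (auto intro!: derivative_eq_intros bounded_linear_imp_has_derivative[OF bounded_linear_vec_nth])
  then show ?thesis
    by (simp add: partial_deriv_def frechet_derivative_eqI wave_shift axis_def)
qed

lemma grad_wave: "grad (wave n c) = (\<lambda>x. wave n (c + pi/2) x *\<^sub>R (n *\<^sub>R axis 1 1))"
  by (rule ext) (simp add: vec_eq_iff grad_nth partial_deriv_wave axis_def)

text \<open>A transverse wave: it points along the second axis and varies along the first, so the
  curl sees the whole derivative. A longitudinal wave would have zero curl.\<close>

lemma curl_wave:
  "curl (\<lambda>x. wave n c x *\<^sub>R axis 2 1) = (\<lambda>x. wave n (c + pi/2) x *\<^sub>R (n *\<^sub>R axis 3 1))"
proof
  fix x :: "real^3"
  have z: "partial_deriv i (\<lambda>x. 0::real) x = 0" for i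
    by (simp add: partial_deriv_def)
  have w: "partial_deriv i (\<lambda>x. wave n c x) x = (if i = 1 then n * wave n (c + pi/2) x else 0)" for i
    by (rule partial_deriv_wave)
  show "curl (\<lambda>x. wave n c x *\<^sub>R axis 2 1) x = wave n (c + pi/2) x *\<^sub>R (n *\<^sub>R axis 3 1)"
    by (simp add: vec_eq_iff forall_3 curl_nth smooth_wave_scaleR axis_def z w)
qed

lemma norm_wave:
  fixes e :: "'b::euclidean_space"
  assumes "open \<Omega>" "bounded \<Omega>"
  shows "(norm (l2_of (restr \<Omega> (\<lambda>x. wave n c x *\<^sub>R e))))\<^sup>2 = (norm e)\<^sup>2 * wave_energy \<Omega> n c"
proof -
  have "(norm (l2_of (restr \<Omega> (\<lambda>x. wave n c x *\<^sub>R e))))\<^sup>2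
      = (LINT x|lborel. (norm (restr \<Omega> (\<lambda>x. wave n c x *\<^sub>R e) x))\<^sup>2)"
    by (rule norm_l2_of_sq[OF square_integrable_restr[OF assms smooth_continuous[OF smooth_wave_scaleR]]])
  also have "\<dots> = (LINT x|lborel. (norm e)\<^sup>2 * (indicator \<Omega> x * (wave n c x)\<^sup>2))"
    by (intro Bochner_Integration.integral_cong) (auto simp: indicator_def power_mult_distrib)
  finally show ?thesis
    by (simp add: wave_energy_def)
qed

text \<open>Since \<open>sin\<^sup>2 + cos\<^sup>2 = 1\<close>, an inequality bounding the derivative by the function, used at two
  phases a quarter period apart, bounds the frequency.\<close>

lemma no_uniform_derivative_bound:
  assumes \<Omega>: "open \<Omega>" "bounded \<Omega>" "\<Omega> \<noteq> {}"
    and bound: "\<And>n c. n\<^sup>2 * wave_energy \<Omega> n (c + pi/2) \<le> L * wave_energy \<Omega> n c"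
  shows False
proof -
  have int: "integrable lborel (\<lambda>x. indicator \<Omega> x * (wave n c x)\<^sup>2)" for n c
  proof -
    have "(\<lambda>x. (norm (restr \<Omega> (wave n c) x))\<^sup>2) = (\<lambda>x. indicator \<Omega> x * (wave n c x)\<^sup>2)"
      by (auto simp: indicator_def)
    then show ?thesis
      using square_integrable_restr[OF \<Omega>(1,2) smooth_continuous[OF smooth_wave[of n c]]]
      by (simp add: square_integrable_def)
  qed
  have sum: "wave_energy \<Omega> n 0 + wave_energy \<Omega> n (pi/2) = measure lborel \<Omega>" for n
  proof -
    have "wave_energy \<Omega> n 0 + wave_energy \<Omega> n (pi/2)
        = (LINT x|lborel. indicator \<Omega> x * (wave n 0 x)\<^sup>2 + indicator \<Omega> x * (wave n (pi/2) x)\<^sup>2)"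
      unfolding wave_energy_def by (rule Bochner_Integration.integral_add[symmetric, OF int int])
    also have "\<dots> = (LINT x|lborel. indicator \<Omega> x)"
      using wave_shift[of n 0]
      by (intro Bochner_Integration.integral_cong) (auto simp: wave_def indicator_def)
    also have "\<dots> = measure lborel \<Omega>"
      by simp
    finally show ?thesis .
  qed
  \<comment> \<open>A shift by \<open>pi\<close> only changes the sign of the wave, so two
    quarter-period shifts lead back to the initial energy.\<close>
  have period: "wave_energy \<Omega> n pi = wave_energy \<Omega> n 0" for n
    by (simp add: wave_energy_def wave_def)
  \<comment> \<open>The volume is cancelled at the end, so it must be nonzero and finite.\<close>
  have pos: "0 < measure lborel \<Omega>"
  proof -
    have "emeasure lborel \<Omega> \<noteq> 0"
    proof
      assume "emeasure lborel \<Omega> = 0"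
      then have "\<Omega> \<in> null_sets lebesgue"
        using \<Omega>(1) by (intro null_sets_completionI) (simp add: null_sets_def)
      then show False
        using open_not_negligible[OF \<Omega>(1,3)] by (simp add: negligible_iff_null_sets)
    qed
    moreover have "emeasure lborel \<Omega> < \<infinity>"
      by (rule emeasure_bounded_finite[OF \<Omega>(2)])
    ultimately show ?thesis
      by (simp add: measure_def enn2real_positive_iff zero_less_iff_neq_zero)
  qed
  have "n\<^sup>2 * measure lborel \<Omega> \<le> L * measure lborel \<Omega>" for n
  proof -
    have "n\<^sup>2 * wave_energy \<Omega> n (pi/2) \<le> L * wave_energy \<Omega> n 0"
      using bound[of n 0] by simp
    moreover have "n\<^sup>2 * wave_energy \<Omega> n 0 \<le> L * wave_energy \<Omega> n (pi/2)"
      using bound[of n "pi/2"] period[of n] by simp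
    ultimately show ?thesis
      unfolding sum[of n, symmetric] distrib_left by linarith
  qed
  then have "n\<^sup>2 \<le> L" for n :: real
    using pos by simp
  from this[of "\<bar>L\<bar> + 1"] show False
    by (auto simp: power2_eq_square algebra_simps abs_if split: if_splits) (smt (verit) mult_nonneg_nonneg zero_le_square)+
qed

section \<open>The spectral decomposition of the gradient part\<close>

text \<open>The fields living in \<open>\<Omega>\<close> are those orthogonal to all fields living
  off \<open>\<Omega>\<close>, an intersection of closed hyperplanes. Sums of divergence series
  therefore stay in \<open>L2 \<Omega>\<close>.\<close>

lemma closed_L2:
  fixes \<Omega> :: "'a::euclidean_space set"
  assumes "open \<Omega>"
  shows "closed (L2 \<Omega> :: ('a, 'b::euclidean_space) l2 set)"
proof -
  have L2_eq: "L2 \<Omega> = (\<Inter>w\<in>L2 (- \<Omega>). {u :: ('a, 'b) l2. w \<bullet> u = 0})"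
  proof (intro equalityI subsetI)
    fix u :: "('a, 'b) l2"
    assume u: "u \<in> L2 \<Omega>"
    have "w \<bullet> u = 0" if w: "w \<in> L2 (- \<Omega>)" for w
    proof -
      have "w \<bullet> u = (LINT x|lborel. rep_l2 w x \<bullet> rep_l2 u x)"
        using l2_of_inner[OF square_integrable_rep_l2 square_integrable_rep_l2, of w u] by simp
      also have "AE x in lborel. rep_l2 w x \<bullet> rep_l2 u x = 0"
        using u[unfolded in_L2_iff] w[unfolded in_L2_iff] by eventually_elim auto
      then have "(LINT x|lborel. rep_l2 w x \<bullet> rep_l2 u x) = 0"
        by (rule integral_eq_zero_AE)
      finally show ?thesis .
    qed
    then show "u \<in> (\<Inter>w\<in>L2 (- \<Omega>). {u. w \<bullet> u = 0})" by simp
  next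
    fix u :: "('a, 'b) l2"
    assume u: "u \<in> (\<Inter>w\<in>L2 (- \<Omega>). {u. w \<bullet> u = 0})"
    define r where "r = rep_l2 u"
    have r: "square_integrable r" by (simp add: r_def square_integrable_rep_l2)
    have s: "square_integrable (restr (- \<Omega>) r)"
      unfolding square_integrable_def
    proof
      have [measurable]: "r \<in> borel_measurable borel" "- \<Omega> \<in> sets borel"
        using r assms by (simp_all add: square_integrable_def)
      show "restr (- \<Omega>) r \<in> borel_measurable lborel" by measurable
      have "integrable lborel (\<lambda>x. (norm (r x))\<^sup>2)"
        using r by (simp add: square_integrable_def)
      then show "integrable lborel (\<lambda>x. (norm (restr (- \<Omega>) r x))\<^sup>2)"
      proof (rule Bochner_Integration.integrable_bound)
        show "AE x in lborel. norm ((norm (restr (- \<Omega>) r x))\<^sup>2) \<le> norm ((norm (r x))\<^sup>2)"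
          by (auto simp: indicator_def)
      qed measurable
    qed
    have "l2_of (restr (- \<Omega>) r) \<in> L2 (- \<Omega>)"
      by (simp add: l2_of_in_L2_iff s)
    then have "l2_of (restr (- \<Omega>) r) \<bullet> l2_of r = 0"
      using u by (simp add: r_def)
    then have "(LINT x|lborel. restr (- \<Omega>) r x \<bullet> r x) = 0"
      by (simp only: l2_of_inner[OF s r])
    then have "AE x in lborel. restr (- \<Omega>) r x \<bullet> r x = 0"
      by (subst (asm) integral_nonneg_eq_0_iff_AE[OF square_integrable_inner[OF s r]]) (auto simp: indicator_def)
    then have "AE x in lborel. x \<notin> \<Omega> \<longrightarrow> r x = 0"
      by eventually_elim (auto simp: indicator_def)
    then show "u \<in> L2 \<Omega>" by (simp add: in_L2_iff r_def)
  qed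
  show ?thesis
    unfolding L2_eq by (intro closed_INT ballI closed_hyperplane)
qed

lemma spaceA_subset_L2: "spaceA \<Omega> \<subseteq> L2 \<Omega>"
  by (auto simp: spaceA_def has_grad_def)

lemma spaceV_iff: "v \<in> spaceV \<Omega> \<longleftrightarrow> v \<in> L2 \<Omega> \<and> (\<forall>g\<in>spaceA \<Omega>. v \<bullet> g = 0)"
  by (auto simp: spaceV_def orthogonal_comp_def orthogonal_def inner_commute)

lemma subspace_spaceV: "subspace (spaceV \<Omega>)"
  using subspace_L2[of \<Omega>]
  by (auto simp: subspace_def spaceV_iff inner_add_left)

text \<open>Gradients of test functions belong to \<open>spaceA\<close>, so orthogonality to
  \<open>spaceA\<close> contains the weak equation for divergence zero.\<close>

lemma solenoidal_has_div:
  assumes "open \<Omega>" "bounded \<Omega>" "v \<in> spaceV \<Omega>"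
  shows "has_div \<Omega> v 0"
  unfolding has_div_def
proof (intro conjI allI impI)
  show "v \<in> L2 \<Omega>" "0 \<in> L2 \<Omega>"
    using assms(3) by (simp_all add: spaceV_iff zero_in_L2)
  fix \<phi> :: "real^3 \<Rightarrow> real"
  assume "test_function \<Omega> \<phi>"
  then have "l2_of (grad \<phi>) \<in> spaceA \<Omega>"
    using has_grad_test_function[OF assms(1,2)] by (auto simp: spaceA_def)
  then show "v \<bullet> l2_of (grad \<phi>) = - (0 \<bullet> l2_of \<phi>)"
    using assms(3) by (simp add: spaceV_iff)
qed

locale neumann_basis =
  fixes \<Omega> :: "(real^3) set" and q :: "nat \<Rightarrow> vector_l2" and \<nu> :: "nat \<Rightarrow> real"
  assumes open_\<Omega>: "open \<Omega>" and bounded_\<Omega>: "bounded \<Omega>" and nonempty_\<Omega>: "\<Omega> \<noteq> {}"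
    and basis: "orthonormal_basis q (spaceA \<Omega>)"
    and eigen: "\<And>j. has_grad_div \<Omega> (q j) (- ((\<nu> j)\<^sup>2 *\<^sub>R q j))"
    and trace: "\<And>j. normal_trace_zero \<Omega> (q j)"
    and \<nu>_pos: "0 < (\<nu> 0)\<^sup>2" and \<nu>_mono: "mono (\<lambda>j. (\<nu> j)\<^sup>2)"
begin

sublocale A: orthonormal_seq q
  by (rule orthonormal_seqI[OF basis])

lemma A_H: "A.H = spaceA \<Omega>"
  by (rule orthonormal_basis_H[OF basis])

lemma subspace_spaceA: "subspace (spaceA \<Omega>)"
  using A.subspace_H by (simp add: A_H)

text \<open>The Weyl decomposition, read off from the Fourier series in the gradient basis.\<close>

lemma decomposition:
  assumes "u \<in> L2 \<Omega>"
  obtains a v where "a \<in> spaceA \<Omega>" "v \<in> spaceV \<Omega>" "u = a + v"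
proof -
  obtain a where a: "a \<in> spaceA \<Omega>" "\<And>g. g \<in> spaceA \<Omega> \<Longrightarrow> (u - a) \<bullet> g = 0"
    using A.proj_exists[of u] unfolding A_H by blast
  have "u - a \<in> L2 \<Omega>"
    using assms subsetD[OF spaceA_subset_L2 a(1)] by (rule subspace_diff[OF subspace_L2])
  then have "u - a \<in> spaceV \<Omega>"
    using a(2) by (simp add: spaceV_iff)
  then show ?thesis
    using that[OF a(1)] by simp
qed

lemma orth_proj_sum:
  assumes "a \<in> spaceA \<Omega>" "v \<in> spaceV \<Omega>"
  shows "orth_proj (spaceA \<Omega>) (a + v) = a" "orth_proj (spaceV \<Omega>) (a + v) = v"
proof -
  show "orth_proj (spaceA \<Omega>) (a + v) = a"
    using assms by (intro orth_proj_eqI subspace_spaceA) (simp_all add: spaceV_iff)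
  show "orth_proj (spaceV \<Omega>) (a + v) = v"
    using assms by (intro orth_proj_eqI subspace_spaceV) (simp_all add: spaceV_iff inner_commute[of a])
qed

definition dv :: "nat \<Rightarrow> scalar_l2" where
  "dv j = (THE d. has_div \<Omega> (q j) d)"

text \<open>The eigenvalue equation and the trace condition each provide a divergence of
  \<open>q j\<close>, and uniqueness identifies them. The third fact is Green's formula without
  boundary term, for potentials \<open>h\<close> of any boundary behaviour.\<close>

lemma dv:
  shows "has_div \<Omega> (q j) (dv j)" "has_grad \<Omega> (dv j) (- ((\<nu> j)\<^sup>2 *\<^sub>R q j))"
    "has_grad \<Omega> h g \<Longrightarrow> dv j \<bullet> h = - (q j \<bullet> g)"
proof -
  obtain d where d: "has_div \<Omega> (q j) d" "has_grad \<Omega> d (- ((\<nu> j)\<^sup>2 *\<^sub>R q j))"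
    using eigen[of j] by (auto simp: has_grad_div_def)
  obtain d' where d': "has_div \<Omega> (q j) d'" "\<forall>h g. has_grad \<Omega> h g \<longrightarrow> q j \<bullet> g + d' \<bullet> h = 0"
    using trace[of j] by (auto simp: normal_trace_zero_def)
  have eq: "dv j = d"
    unfolding dv_def using d(1) has_div_unique[OF open_\<Omega>] by blast
  have eq': "d' = d"
    by (rule has_div_unique[OF open_\<Omega> d'(1) d(1)])
  show "has_div \<Omega> (q j) (dv j)" "has_grad \<Omega> (dv j) (- ((\<nu> j)\<^sup>2 *\<^sub>R q j))"
    using d by (simp_all add: eq)
  show "dv j \<bullet> h = - (q j \<bullet> g)" if "has_grad \<Omega> h g"
    using d'(2) that by (simp add: eq eq' eq_neg_iff_add_eq_0 add.commute)
qed

lemma \<nu>_ge: "(\<nu> 0)\<^sup>2 \<le> (\<nu> j)\<^sup>2"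
  using monoD[OF \<nu>_mono, of 0 j] by simp

lemma \<nu>_nz: "\<nu> j \<noteq> 0"
  using \<nu>_ge[of j] \<nu>_pos by auto

text \<open>Up to sign, these are normalised nonconstant Neumann eigenfunctions of the
  Laplacian.\<close>

definition p :: "nat \<Rightarrow> scalar_l2" where
  "p j = inverse (\<nu> j) *\<^sub>R dv j"

sublocale P: orthonormal_seq p
proof
  fix i j
  \<comment> \<open>Green's formula with the potential \<open>dv j\<close>, whose gradient is a
    multiple of \<open>q j\<close>, moves the product of divergences to the orthonormal
    fields.\<close>
  have "dv i \<bullet> dv j = (\<nu> j)\<^sup>2 * (q i \<bullet> q j)"
    using dv(3)[OF dv(2), of i j] by simp
  then show "p i \<bullet> p j = (if i = j then 1 else 0)"
    using \<nu>_nz[of j] by (cases "i = j") (simp_all add: p_def A.ortho power2_eq_square field_simps)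
qed

text \<open>Both the unboundedness of the eigenvalues and the boundary condition of the solution
  rest on this exchange between a potential and its gradient.\<close>

lemma p_inner: "has_grad \<Omega> h g \<Longrightarrow> \<nu> j * (p j \<bullet> h) = - (q j \<bullet> g)"
  using \<nu>_nz[of j] dv(3)[of h g j] by (simp add: p_def)

text \<open>Parseval's identity for the gradient in the basis \<open>q\<close> meets Bessel's
  inequality for the potential: the \<open>p j\<close> miss the constants, and an inequality is
  enough.\<close>

lemma gradient_bound:
  assumes L: "\<And>j. (\<nu> j)\<^sup>2 \<le> L" and hg: "has_grad \<Omega> h g"
  shows "(norm g)\<^sup>2 \<le> L * (norm h)\<^sup>2"
proof -
  have g: "g \<in> A.H"
    using hg by (auto simp: A_H spaceA_def)
  have co: "(g \<bullet> q j)\<^sup>2 = (\<nu> j)\<^sup>2 * (h \<bullet> p j)\<^sup>2" for j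
    using p_inner[OF hg, of j] by (metis inner_commute power2_minus power_mult_distrib)
  have "(norm g)\<^sup>2 = (\<Sum>j. (g \<bullet> q j)\<^sup>2)"
    by (rule sums_unique[OF A.parseval[OF g]])
  also have "\<dots> \<le> (\<Sum>j. L * (h \<bullet> p j)\<^sup>2)"
    using L A.bessel_summable[of g] P.bessel_summable[of h]
    by (intro suminf_le) (auto simp: co intro: mult_right_mono summable_mult)
  also have "\<dots> = L * (\<Sum>j. (h \<bullet> p j)\<^sup>2)"
    by (rule suminf_mult[OF P.bessel_summable])
  also have "\<dots> \<le> L * (norm h)\<^sup>2"
    using order_trans[OF zero_le_power2 L[of 0]] by (rule mult_left_mono[OF P.bessel])
  finally show ?thesis .
qed

lemma \<nu>_at_top: "filterlim (\<lambda>j. (\<nu> j)\<^sup>2) at_top sequentially"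
proof (rule mono_unbounded_at_top[OF \<nu>_mono], rule ccontr)
  fix L assume "\<not> (\<exists>j. L < (\<nu> j)\<^sup>2)"
  then have L: "(\<nu> j)\<^sup>2 \<le> L" for j
    by (simp add: not_less)
  show False
  proof (rule no_uniform_derivative_bound[OF open_\<Omega> bounded_\<Omega> nonempty_\<Omega>])
    fix n c
    have "(norm (l2_of (restr \<Omega> (grad (wave n c)))))\<^sup>2 \<le> L * (norm (l2_of (restr \<Omega> (wave n c))))\<^sup>2"
      by (rule gradient_bound[OF L has_grad_restr[OF open_\<Omega> bounded_\<Omega> smooth_wave]])
    moreover have "(norm (l2_of (restr \<Omega> (grad (wave n c)))))\<^sup>2 = n\<^sup>2 * wave_energy \<Omega> n (c + pi/2)"
      unfolding grad_wave norm_wave[OF open_\<Omega> bounded_\<Omega>] by simp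
    moreover have "(norm (l2_of (restr \<Omega> (wave n c))))\<^sup>2 = wave_energy \<Omega> n c"
      using norm_wave[OF open_\<Omega> bounded_\<Omega>, of n c "1::real"] by simp
    ultimately show "n\<^sup>2 * wave_energy \<Omega> n (c + pi/2) \<le> L * wave_energy \<Omega> n c"
      by simp
  qed
qed

section \<open>The resolvent of \<open>opN\<close> and its regularity gain\<close>

lemma spaceA_pow_iff:
  "v \<in> spaceA_pow \<Omega> \<nu> q k \<longleftrightarrow> v \<in> spaceA \<Omega> \<and> summable (\<lambda>j. ((\<nu> j)\<^sup>2 ^ k * (v \<bullet> q j))\<^sup>2)"
  by (simp add: spaceA_pow_def power_mult_distrib mult.commute flip: power_mult)

lemma opN:
  assumes "v \<in> spaceA_pow \<Omega> \<nu> q 1"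
  shows "opN \<nu> q v \<in> spaceA \<Omega>" "opN \<nu> q v \<bullet> q j = - ((\<nu> j)\<^sup>2 * (v \<bullet> q j))"
proof -
  have s: "summable (\<lambda>j. ((\<nu> j)\<^sup>2 * (v \<bullet> q j))\<^sup>2)"
    using assms by (simp add: spaceA_pow_iff del: One_nat_def)
  show "opN \<nu> q v \<in> spaceA \<Omega>"
    unfolding opN_def using A.series_in_H[OF s] by (simp add: A_H subspace_neg[OF subspace_spaceA])
  show "opN \<nu> q v \<bullet> q j = - ((\<nu> j)\<^sup>2 * (v \<bullet> q j))"
    unfolding opN_def by (simp add: A.series_coeff[OF s])
qed

lemma opN_shift_coeff:
  assumes "v \<in> spaceA_pow \<Omega> \<nu> q 1"
  shows "(opN \<nu> q v + lam *\<^sub>R v) \<bullet> q j = (lam - (\<nu> j)\<^sup>2) * (v \<bullet> q j)"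
  by (simp add: inner_add_left opN(2)[OF assms] algebra_simps)

text \<open>The second bound serves the inverse, the first the regularity gain; both come from the
  gap between \<open>lam\<close> and the eigenvalues.\<close>

lemma ratio_bounded:
  assumes "\<And>j. (\<nu> j)\<^sup>2 \<noteq> lam"
  obtains C where "\<And>j. \<bar>(\<nu> j)\<^sup>2 / (lam - (\<nu> j)\<^sup>2)\<bar> \<le> C" "\<And>j. \<bar>1 / (lam - (\<nu> j)\<^sup>2)\<bar> \<le> C"
proof -
  obtain \<delta> where \<delta>: "0 < \<delta>" "\<And>j. \<delta> \<le> \<bar>(\<nu> j)\<^sup>2 - lam\<bar>"
    using at_top_gap[OF \<nu>_at_top assms] by blast
  have 1: "\<bar>1 / (lam - (\<nu> j)\<^sup>2)\<bar> \<le> 1 / \<delta>" for j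
  proof -
    have "1 / \<bar>(\<nu> j)\<^sup>2 - lam\<bar> \<le> 1 / \<delta>"
      using \<delta>(1) \<delta>(2)[of j] by (intro divide_left_mono) auto
    then show ?thesis by (simp add: abs_divide abs_minus_commute)
  qed
  have 2: "\<bar>(\<nu> j)\<^sup>2 / (lam - (\<nu> j)\<^sup>2)\<bar> \<le> 1 + \<bar>lam\<bar> * (1 / \<delta>)" for j
  proof -
    \<comment> \<open>The ratio tends to \<open>- 1\<close>; separating this limit leaves a multiple
      of the bounded resolvent factor.\<close>
    have "(\<nu> j)\<^sup>2 / (lam - (\<nu> j)\<^sup>2) = lam * (1 / (lam - (\<nu> j)\<^sup>2)) - 1"
      using assms[of j] by (simp add: field_simps)
    then have "\<bar>(\<nu> j)\<^sup>2 / (lam - (\<nu> j)\<^sup>2)\<bar> \<le> \<bar>lam\<bar> * \<bar>1 / (lam - (\<nu> j)\<^sup>2)\<bar> + 1"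
      by (simp only: abs_mult[symmetric])
    also have "\<dots> \<le> \<bar>lam\<bar> * (1 / \<delta>) + 1"
      by (intro add_right_mono mult_left_mono 1) simp
    finally show ?thesis by simp
  qed
  show ?thesis
  proof (rule that[of "max (1 + \<bar>lam\<bar> * (1 / \<delta>)) (1 / \<delta>)"])
    show "\<bar>(\<nu> j)\<^sup>2 / (lam - (\<nu> j)\<^sup>2)\<bar> \<le> max (1 + \<bar>lam\<bar> * (1 / \<delta>)) (1 / \<delta>)" for j
      using 2[of j] by (rule max.coboundedI1)
    show "\<bar>1 / (lam - (\<nu> j)\<^sup>2)\<bar> \<le> max (1 + \<bar>lam\<bar> * (1 / \<delta>)) (1 / \<delta>)" for j
      using 1[of j] by (rule max.coboundedI2)
  qed
qed

text \<open>The coefficients of \<open>v\<close> are those of \<open>f\<close> divided by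
  \<open>lam - (\<nu> j)\<^sup>2\<close>, and this division absorbs the additional weight
  \<open>(\<nu> j)\<^sup>2\<close>.\<close>

lemma regularityN:
  assumes nz: "\<And>j. (\<nu> j)\<^sup>2 \<noteq> lam" and v: "v \<in> spaceA \<Omega>" and f: "f \<in> spaceA_pow \<Omega> \<nu> q k"
    and co: "\<And>j. f \<bullet> q j = (lam - (\<nu> j)\<^sup>2) * (v \<bullet> q j)"
  shows "v \<in> spaceA_pow \<Omega> \<nu> q (k + 1)"
proof -
  obtain C where C: "\<And>j. \<bar>(\<nu> j)\<^sup>2 / (lam - (\<nu> j)\<^sup>2)\<bar> \<le> C"
    using ratio_bounded[OF nz] by metis
  have "(\<nu> j)\<^sup>2 ^ (k + 1) * (v \<bullet> q j) = (\<nu> j)\<^sup>2 / (lam - (\<nu> j)\<^sup>2) * ((\<nu> j)\<^sup>2 ^ k * (f \<bullet> q j))" for j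
    using nz[of j] by (simp add: co)
  then have "summable (\<lambda>j. ((\<nu> j)\<^sup>2 ^ (k + 1) * (v \<bullet> q j))\<^sup>2)"
    using summable_sq_mult[OF C, of "\<lambda>j. (\<nu> j)\<^sup>2 ^ k * (f \<bullet> q j)"] f by (simp only: spaceA_pow_iff)
  then show ?thesis
    using v by (simp only: spaceA_pow_iff)
qed

lemma bijN:
  assumes nz: "\<And>j. (\<nu> j)\<^sup>2 \<noteq> lam"
  shows "bij_betw (\<lambda>v. opN \<nu> q v + lam *\<^sub>R v) (spaceA_pow \<Omega> \<nu> q 1) (spaceA \<Omega>)"
proof (rule bij_betw_imageI)
  have A: "v \<in> A.H" if "v \<in> spaceA_pow \<Omega> \<nu> q k" for v k
    using that by (simp add: A_H spaceA_pow_def)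
  show "inj_on (\<lambda>v. opN \<nu> q v + lam *\<^sub>R v) (spaceA_pow \<Omega> \<nu> q 1)"
  proof (rule inj_onI)
    fix u v
    assume u: "u \<in> spaceA_pow \<Omega> \<nu> q 1" and v: "v \<in> spaceA_pow \<Omega> \<nu> q 1"
      and eq: "opN \<nu> q u + lam *\<^sub>R u = opN \<nu> q v + lam *\<^sub>R v"
    show "u = v"
    proof (rule A.H_eqI[OF A[OF u] A[OF v]])
      fix j
      show "u \<bullet> q j = v \<bullet> q j"
        using opN_shift_coeff[OF u, of lam j] opN_shift_coeff[OF v, of lam j] nz[of j] by (simp add: eq)
    qed
  qed
  have "f \<in> (\<lambda>v. opN \<nu> q v + lam *\<^sub>R v) ` spaceA_pow \<Omega> \<nu> q 1" if f: "f \<in> spaceA \<Omega>" for f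
  proof -
    obtain C where C: "\<And>j. \<bar>1 / (lam - (\<nu> j)\<^sup>2)\<bar> \<le> C"
      using ratio_bounded[OF nz] by metis
    define c where "c = (\<lambda>j. 1 / (lam - (\<nu> j)\<^sup>2) * (f \<bullet> q j))"
    have s: "summable (\<lambda>j. (c j)\<^sup>2)"
      unfolding c_def by (rule summable_sq_mult[OF C A.bessel_summable])
    define u where "u = (\<Sum>j. c j *\<^sub>R q j)"
    have uA: "u \<in> spaceA \<Omega>" and uc: "u \<bullet> q j = c j" for j
      using A.series_in_H[OF s] by (simp_all add: u_def A_H A.series_coeff[OF s])
    \<comment> \<open>For exponent \<open>0\<close> the weight is \<open>1\<close> and Bessel's
      inequality suffices; the regularity gain then puts \<open>u\<close> into the domain.\<close>
    have "f \<in> spaceA_pow \<Omega> \<nu> q 0"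
      using f A.bessel_summable[of f] by (simp add: spaceA_pow_iff)
    then have u1: "u \<in> spaceA_pow \<Omega> \<nu> q 1"
      using regularityN[OF nz uA, of f 0] nz by (simp add: uc c_def eq_commute[of lam])
    have "f = opN \<nu> q u + lam *\<^sub>R u"
    proof (rule A.H_eqI)
      show "f \<in> A.H" using f by (simp add: A_H)
      show "opN \<nu> q u + lam *\<^sub>R u \<in> A.H"
        using opN(1)[OF u1] uA by (simp add: A_H subspace_add subspace_scale subspace_spaceA)
      show "f \<bullet> q j = (opN \<nu> q u + lam *\<^sub>R u) \<bullet> q j" for j
        using nz[of j] by (simp add: opN_shift_coeff[OF u1] uc c_def)
    qed
    then show ?thesis using u1 by blast
  qed
  moreover have "opN \<nu> q v + lam *\<^sub>R v \<in> spaceA \<Omega>" if "v \<in> spaceA_pow \<Omega> \<nu> q 1" for v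
    using opN(1)[OF that] A[OF that] by (simp add: A_H subspace_add subspace_scale subspace_spaceA)
  ultimately show "(\<lambda>v. opN \<nu> q v + lam *\<^sub>R v) ` spaceA_pow \<Omega> \<nu> q 1 = spaceA \<Omega>"
    by auto
qed

section \<open>The normal trace of the solution\<close>

lemma dv_in_L2: "dv j \<in> L2 \<Omega>"
  using dv(1)[of j] by (simp add: has_div_def)

lemma P_H_subset_L2: "P.H \<subseteq> L2 \<Omega>"
  unfolding P.H_def
  by (intro closure_minimal closed_L2 open_\<Omega> span_minimal subspace_L2)
    (auto simp: p_def intro!: subspace_scale[OF subspace_L2] dv_in_L2)

text \<open>The divergence of \<open>v\<close> is the series of
  \<open>(v \<bullet> q j) *\<^sub>R dv j\<close>, that is of \<open>c j *\<^sub>R p j\<close>;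
  pairing it termwise with a potential transfers the zero trace from the \<open>q j\<close> to
  \<open>v\<close>.\<close>

lemma trace_of_domainN:
  assumes v: "v \<in> spaceA_pow \<Omega> \<nu> q 1"
  obtains d where "has_div \<Omega> v d" "\<And>h g. has_grad \<Omega> h g \<Longrightarrow> v \<bullet> g + d \<bullet> h = 0"
proof -
  have vA: "v \<in> spaceA \<Omega>"
    using v by (simp add: spaceA_pow_def)
  \<comment> \<open>Written with \<open>(\<nu> j)\<^sup>2\<close> so that the domain condition
    applies; the remaining factor is bounded because the first eigenvalue is the smallest.\<close>
  define c where "c = (\<lambda>j. inverse (\<nu> j) * ((\<nu> j)\<^sup>2 * (v \<bullet> q j)))"
  have c: "c j = \<nu> j * (v \<bullet> q j)" for j
    using \<nu>_nz[of j] by (simp add: c_def power2_eq_square)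
  have s: "summable (\<lambda>j. (c j)\<^sup>2)"
    unfolding c_def
  proof (rule summable_sq_mult)
    show "\<bar>inverse (\<nu> j)\<bar> \<le> inverse \<bar>\<nu> 0\<bar>" for j
      using \<nu>_ge[of j] \<nu>_nz[of 0] by (simp add: abs_le_square_iff le_imp_inverse_le)
    show "summable (\<lambda>j. ((\<nu> j)\<^sup>2 * (v \<bullet> q j))\<^sup>2)"
      using v by (simp add: spaceA_pow_iff del: One_nat_def)
  qed
  define d where "d = (\<Sum>j. c j *\<^sub>R p j)"
  have dL2: "d \<in> L2 \<Omega>"
    using P.series_in_H[OF s] P_H_subset_L2 by (auto simp: d_def)
  \<comment> \<open>The identity is proved for all potentials; for test functions it is the
    definition of the weak divergence.\<close>
  have tr: "v \<bullet> g + d \<bullet> h = 0" if hg: "has_grad \<Omega> h g" for h g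
  proof -
    have "(\<lambda>j. c j * (p j \<bullet> h)) sums (d \<bullet> h)"
      unfolding d_def by (rule P.series_inner[OF s])
    moreover have "c j * (p j \<bullet> h) = - ((v \<bullet> q j) * (g \<bullet> q j))" for j
    proof -
      have "c j * (p j \<bullet> h) = (v \<bullet> q j) * (\<nu> j * (p j \<bullet> h))"
        by (simp add: c)
      then show ?thesis
        by (simp only: p_inner[OF hg]) (simp add: inner_commute[of g])
    qed
    moreover have "(\<lambda>j. - ((v \<bullet> q j) * (g \<bullet> q j))) sums (- (v \<bullet> g))"
      using vA by (intro sums_minus A.inner_expansion) (simp add: A_H)
    ultimately have "d \<bullet> h = - (v \<bullet> g)"
      using sums_unique2 by simp
    then show ?thesis by simp
  qed
  show ?thesis
  proof (rule that[OF _ tr])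
    show "has_div \<Omega> v d"
      unfolding has_div_def
    proof (intro conjI allI impI dL2)
      show "v \<in> L2 \<Omega>"
        using vA spaceA_subset_L2 by auto
      fix \<phi> :: "real^3 \<Rightarrow> real"
      assume "test_function \<Omega> \<phi>"
      then show "v \<bullet> l2_of (grad \<phi>) = - (d \<bullet> l2_of \<phi>)"
        using tr[OF has_grad_test_function[OF open_\<Omega> bounded_\<Omega>]] by (simp add: eq_neg_iff_add_eq_0)
    qed
  qed
qed

lemma trace_of_sum:
  assumes "a \<in> spaceA_pow \<Omega> \<nu> q 1" "v \<in> spaceV \<Omega>"
  shows "normal_trace_zero \<Omega> (a + v)"
proof -
  obtain d where d: "has_div \<Omega> a d" "\<And>h g. has_grad \<Omega> h g \<Longrightarrow> a \<bullet> g + d \<bullet> h = 0"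
    using trace_of_domainN[OF assms(1)] by blast
  have "has_div \<Omega> (a + v) d"
    using d(1) solenoidal_has_div[OF open_\<Omega> bounded_\<Omega> assms(2)]
    by (auto simp: has_div_def inner_add_left intro: subspace_add[OF subspace_L2])
  moreover have "(a + v) \<bullet> g + d \<bullet> h = 0" if hg: "has_grad \<Omega> h g" for h g
  proof -
    have "v \<bullet> g = 0"
      using assms(2) hg by (auto simp: spaceV_iff spaceA_def)
    then show ?thesis
      using d(2)[OF hg] by (simp add: inner_add_left)
  qed
  ultimately show ?thesis
    by (auto simp: normal_trace_zero_def)
qed

end

section \<open>The spectral decomposition of the rotor\<close>

lemma has_rot_add:
  "has_rot \<Omega> u w \<Longrightarrow> has_rot \<Omega> u' w' \<Longrightarrow> has_rot \<Omega> (u + u') (w + w')"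
  by (auto simp: has_rot_def inner_add_left intro: subspace_add[OF subspace_L2])

lemma has_rot_scaleR: "has_rot \<Omega> u w \<Longrightarrow> has_rot \<Omega> (c *\<^sub>R u) (c *\<^sub>R w)"
  by (auto simp: has_rot_def intro: subspace_scale[OF subspace_L2])

lemma has_rot_diff:
  "has_rot \<Omega> u w \<Longrightarrow> has_rot \<Omega> u' w' \<Longrightarrow> has_rot \<Omega> (u - u') (w - w')"
  by (auto simp: has_rot_def inner_diff_left intro: subspace_diff[OF subspace_L2])

lemma subspace_spaceW: "subspace (spaceW \<Omega> m)"
proof (induction m)
  case 0
  show ?case by (simp add: subspace_spaceV)
next
  case (Suc m)
  note V = subspace_spaceV[of \<Omega>]
  show ?case
  proof (rule subspaceI)
    have "has_rot \<Omega> 0 0"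
      by (simp add: has_rot_def zero_in_L2)
    then show "0 \<in> spaceW \<Omega> (Suc m)"
      using subspace_0[OF Suc] subspace_0[OF V] by auto
    show "u + v \<in> spaceW \<Omega> (Suc m)" if uv: "u \<in> spaceW \<Omega> (Suc m)" "v \<in> spaceW \<Omega> (Suc m)" for u v
    proof -
      obtain w w' where "w \<in> spaceW \<Omega> m" "has_rot \<Omega> u w" "w' \<in> spaceW \<Omega> m" "has_rot \<Omega> v w'"
        using uv by auto
      then show ?thesis
        using uv by (auto intro!: subspace_add[OF V] bexI[of _ "w + w'"] has_rot_add subspace_add[OF Suc])
    qed
    show "c *\<^sub>R u \<in> spaceW \<Omega> (Suc m)" if u: "u \<in> spaceW \<Omega> (Suc m)" for c u
    proof -
      obtain w where "w \<in> spaceW \<Omega> m" "has_rot \<Omega> u w"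
        using u by auto
      then show ?thesis
        using u by (auto intro!: subspace_scale[OF V] bexI[of _ "c *\<^sub>R w"] has_rot_scaleR subspace_scale[OF Suc])
    qed
  qed
qed

lemma spaceW_subset_spaceV: "spaceW \<Omega> m \<subseteq> spaceV \<Omega>"
  by (cases m) auto

lemma spaceW_antimono: "spaceW \<Omega> (Suc m) \<subseteq> spaceW \<Omega> m"
proof (induction m)
  case (Suc m)
  then show ?case by fastforce
qed auto

text \<open>A bootstrap: the rotor of \<open>u\<close> is the right-hand side minus
  \<open>lam *\<^sub>R u\<close>, so it is as regular as the worse of the two, and \<open>u\<close>
  is one step better.\<close>

lemma regularityS:
  assumes "open \<Omega>" "u \<in> spaceW \<Omega> 1" "rot \<Omega> u + lam *\<^sub>R u \<in> spaceW \<Omega> m"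
  shows "u \<in> spaceW \<Omega> (m + 1)"
  using assms(3)
proof (induction m)
  case 0
  then show ?case using assms(2) by simp
next
  case (Suc m)
  have u: "u \<in> spaceW \<Omega> (Suc m)"
    using Suc.IH subsetD[OF spaceW_antimono Suc.prems] by simp
  obtain w where w: "has_rot \<Omega> u w"
    using assms(2) by auto
  have "w = (rot \<Omega> u + lam *\<^sub>R u) - lam *\<^sub>R u"
    by (simp add: rot_eqI[OF assms(1) w])
  then have "w \<in> spaceW \<Omega> (Suc m)"
    using Suc.prems u by (simp only: subspace_diff subspace_scale subspace_spaceW)
  then have "u \<in> spaceW \<Omega> (Suc (Suc m))"
    using w subsetD[OF spaceW_subset_spaceV u] by (subst spaceW.simps) blast
  then show ?case by simp
qed

text \<open>The signed eigenvalues form one sequence in no prescribed order, because the orthonormal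
  calculus runs over the natural numbers.\<close>

locale rotor_basis = neumann_basis +
  fixes e :: "nat \<Rightarrow> vector_l2" and \<mu> :: "nat \<Rightarrow> real"
  assumes selfadj: "self_adjoint_in (spaceV \<Omega>) (spaceW \<Omega> 1) (opS \<Omega>)"
    and rbasis: "orthonormal_basis e (spaceV \<Omega>)"
    and reigen: "\<And>j. has_rot \<Omega> (e j) (\<mu> j *\<^sub>R e j)"
begin

lemma V_H: "orthonormal_seq.H e = spaceV \<Omega>"
  by (rule orthonormal_basis_H[OF rbasis])

sublocale S: diagonal_self_adjoint e "spaceW \<Omega> 1" "opS \<Omega>" \<mu>
proof -
  interpret V: orthonormal_seq e
    by (rule orthonormal_seqI[OF rbasis])
  show "diagonal_self_adjoint e (spaceW \<Omega> 1) (opS \<Omega>) \<mu>"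
  proof
    show "self_adjoint_in V.H (spaceW \<Omega> 1) (opS \<Omega>)"
      using selfadj by (simp only: V_H)
    have "e j \<in> spaceV \<Omega>" for j
      using V.e_in_H by (simp add: V_H)
    then show "e j \<in> spaceW \<Omega> 1" for j
      using reigen[of j] by (auto intro!: bexI[of _ "\<mu> j *\<^sub>R e j"] subspace_scale[OF subspace_spaceV])
    show "opS \<Omega> (e j) = \<mu> j *\<^sub>R e j" for j
      by (rule rot_eqI[OF open_\<Omega> reigen])
  qed
qed

text \<open>Gradients have zero rotor, so the solenoidal part of a field has the same rotor.\<close>

lemma rotor_bound:
  assumes L: "\<And>j. \<bar>\<mu> j\<bar> \<le> L" and u: "has_rot \<Omega> u w"
  shows "(norm w)\<^sup>2 \<le> L\<^sup>2 * (norm u)\<^sup>2"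
proof -
  have "u \<in> L2 \<Omega>"
    using u by (simp add: has_rot_def)
  then obtain a v where av: "a \<in> spaceA \<Omega>" "v \<in> spaceV \<Omega>" "u = a + v"
    by (rule decomposition)
  obtain h where "has_grad \<Omega> h a"
    using av(1) by (auto simp: spaceA_def)
  then have "has_rot \<Omega> (u - a) (w - 0)"
    by (intro has_rot_diff u has_rot_gradient)
  then have "rot \<Omega> v = w"
    by (intro rot_eqI[OF open_\<Omega>]) (simp add: av(3))
  \<comment> \<open>With bounded eigenvalues every solenoidal field lies in the domain, so the bound
    applies although \<open>v\<close> is only known as a projection.\<close>
  then have "norm w \<le> L * norm v"
    using S.bounded_domain(2)[OF L, of v] av(2) by (simp add: V_H)
  then have "(norm w)\<^sup>2 \<le> (L * norm v)\<^sup>2"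
    by (rule power_mono) simp
  also have "\<dots> = L\<^sup>2 * (norm v)\<^sup>2"
    by (rule power_mult_distrib)
  also have "\<dots> \<le> L\<^sup>2 * (norm u)\<^sup>2"
  proof (rule mult_left_mono)
    have "v \<bullet> a = 0"
      using av by (simp add: spaceV_iff)
    then show "(norm v)\<^sup>2 \<le> (norm u)\<^sup>2"
      by (simp add: av(3) power2_norm_eq_inner inner_add_left inner_add_right inner_commute[of a v])
  qed simp
  finally show ?thesis .
qed

lemma eigenvalues_unbounded: "\<exists>j. L < \<bar>\<mu> j\<bar>"
proof (rule ccontr)
  assume "\<not> (\<exists>j. L < \<bar>\<mu> j\<bar>)"
  then have L: "\<bar>\<mu> j\<bar> \<le> L" for j
    by (simp add: not_less)
  show False
  proof (rule no_uniform_derivative_bound[OF open_\<Omega> bounded_\<Omega> nonempty_\<Omega>])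
    fix n c
    \<comment> \<open>The cut-off wave need not be tangential at the boundary, hence need not lie in
      \<open>spaceV\<close>; \<open>rotor_bound\<close> asks only for a weak rotor.\<close>
    let ?u = "\<lambda>x. wave n c x *\<^sub>R (axis 2 1 :: real^3)"
    have "(norm (l2_of (restr \<Omega> (curl ?u))))\<^sup>2 \<le> L\<^sup>2 * (norm (l2_of (restr \<Omega> ?u)))\<^sup>2"
      by (rule rotor_bound[OF L has_rot_restr[OF open_\<Omega> bounded_\<Omega> smooth_wave_scaleR]])
    then show "n\<^sup>2 * wave_energy \<Omega> n (c + pi/2) \<le> L\<^sup>2 * wave_energy \<Omega> n c"
      unfolding curl_wave norm_wave[OF open_\<Omega> bounded_\<Omega>] by simp
  qed
qed

end

lemma orthonormal_basis_reindex:
  assumes "bij \<pi>" "orthonormal_basis e H"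
  shows "orthonormal_basis (e \<circ> \<pi>) H"
proof -
  have "range (e \<circ> \<pi>) = range e"
    by (simp only: image_comp[symmetric] bij_is_surj[OF assms(1)])
  then show ?thesis
    using assms by (auto simp: orthonormal_basis_def inj_eq[OF bij_is_inj])
qed

lemma orthonormal_basis_nonzero: "orthonormal_basis e H \<Longrightarrow> e i \<noteq> 0"
  unfolding orthonormal_basis_def by (metis inner_zero_left zero_neq_one)

theorem mainTheorem10:
  fixes \<Omega> :: "(real^3) set"
    and q qp qm :: "nat \<Rightarrow> vector_l2" and \<nu> ev :: "nat \<Rightarrow> real"
    and lam :: real and k m :: nat and f :: vector_l2
  assumes "open \<Omega>" and "bounded \<Omega>" and "smooth_boundary \<Omega>"
    and "\<Omega> homeomorphic (ball 0 1 :: (real^3) set)"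
    and "orthonormal_basis q (spaceA \<Omega>)"
    and "\<And>j. smooth_closure \<Omega> (q j)"
    and "\<And>j. has_grad_div \<Omega> (q j) (- ((\<nu> j)\<^sup>2 *\<^sub>R q j))"
    and "\<And>j. normal_trace_zero \<Omega> (q j)"
    and "0 < (\<nu> 0)\<^sup>2" and "mono (\<lambda>j. (\<nu> j)\<^sup>2)"
    and "self_adjoint_in (spaceV \<Omega>) (spaceW \<Omega> 1) (opS \<Omega>)"
    and "orthonormal_basis (case_sum qp qm) (spaceV \<Omega>)"
    and "\<And>j. has_rot \<Omega> (qp j) (ev j *\<^sub>R qp j)"
    and "\<And>j. has_rot \<Omega> (qm j) (- (ev j *\<^sub>R qm j))"
    and "\<And>j. normal_trace_zero \<Omega> (qp j)" and "\<And>j. normal_trace_zero \<Omega> (qm j)"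
    and "0 < ev 0" and "mono ev"
    and "lam \<notin> Sp_neg_grad_div \<Omega> \<union> Sp_rot \<Omega>"
    and "f \<in> spaceC \<Omega> \<nu> q k m"
  shows "(\<exists>!u. solves_problem \<Omega> \<nu> q lam f u) \<and>
    (\<forall>u. solves_problem \<Omega> \<nu> q lam f u \<longrightarrow>
       u = orth_proj (spaceA \<Omega>) u + orth_proj (spaceV \<Omega>) u \<and>
       orth_proj (spaceA \<Omega>) u = resolventN \<Omega> \<nu> q lam (orth_proj (spaceA \<Omega>) f) \<and>
       orth_proj (spaceV \<Omega>) u = resolventS \<Omega> lam (orth_proj (spaceV \<Omega>) f) \<and>
       u \<in> spaceC \<Omega> \<nu> q (k + 1) (m + 1)) \<and>
    bij_betw (\<lambda>v. opN \<nu> q v + lam *\<^sub>R v) (spaceA_pow \<Omega> \<nu> q 1) (spaceA \<Omega>) \<and>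
    bij_betw (\<lambda>v. opS \<Omega> v + lam *\<^sub>R v) (spaceW \<Omega> 1) (spaceV \<Omega>)"
proof -
  \<comment> \<open>\<open>sum_decode\<close> merges the two families into one sequence:
    \<open>Inl\<close> carries the positive eigenvalues, \<open>Inr\<close> the negative
    ones.\<close>
  define e where "e = case_sum qp qm \<circ> sum_decode"
  define \<mu> where "\<mu> = case_sum ev (\<lambda>j. - ev j) \<circ> sum_decode"
  \<comment> \<open>Supplied by the homeomorphism with a ball; the oscillating fields need a domain
    of positive volume.\<close>
  have nonempty: "\<Omega> \<noteq> {}"
    using homeomorphic_empty(2)[of "ball 0 1 :: (real^3) set"] assms(4) by auto
  have rot_e: "has_rot \<Omega> (e j) (\<mu> j *\<^sub>R e j)" for j
    using assms(13,14) by (cases "sum_decode j") (simp_all add: e_def \<mu>_def)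
  interpret rotor_basis \<Omega> q \<nu> e \<mu>
    using assms(1,2,5,7-11) nonempty rot_e
      orthonormal_basis_reindex[OF bij_sum_decode assms(12)]
    by unfold_locales (simp_all add: e_def)

  have \<nu>_ne: "(\<nu> j)\<^sup>2 \<noteq> lam" for j
  proof -
    have "(\<nu> j)\<^sup>2 \<in> Sp_neg_grad_div \<Omega>"
      using assms(7,8) orthonormal_basis_nonzero[OF assms(5)]
      by (auto simp: Sp_neg_grad_div_def intro!: exI[of _ "q j"])
    then show ?thesis using assms(19) by auto
  qed
  \<comment> \<open>The shifted rotor degenerates at the eigenvalue \<open>- lam\<close>, while the
    hypothesis speaks of \<open>lam\<close>; the pairing of eigenvalues with both signs bridges
    this.\<close>
  have ev_ne: "ev j \<noteq> lam" "ev j \<noteq> - lam" for j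
  proof -
    have "ev j \<in> Sp_rot \<Omega>"
      using assms(13,15) orthonormal_basis_nonzero[OF assms(12), of "Inl j"]
      by (auto simp: Sp_rot_def intro!: exI[of _ "qp j"])
    moreover have "- ev j \<in> Sp_rot \<Omega>"
      using assms(14,16) orthonormal_basis_nonzero[OF assms(12), of "Inr j"]
      by (auto simp: Sp_rot_def intro!: exI[of _ "qm j"])
    ultimately show "ev j \<noteq> lam" "ev j \<noteq> - lam"
      using assms(19) by auto
  qed
  have ev_pos: "0 < ev j" for j
    using assms(17) monoD[OF assms(18), of 0 j] by simp
  have "filterlim ev at_top sequentially"
  proof (rule mono_unbounded_at_top[OF assms(18)])
    fix L
    \<comment> \<open>The modulus of \<open>\<mu> j\<close> is \<open>ev i\<close> for the decoded
      index \<open>i\<close>, whichever sign it carries.\<close>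
    obtain j where "L < \<bar>\<mu> j\<bar>"
      using eigenvalues_unbounded by blast
    then show "\<exists>j. L < ev j"
      using ev_pos by (cases "sum_decode j") (auto simp: \<mu>_def abs_of_pos)
  qed
  then obtain \<delta> \<delta>' where \<delta>: "0 < \<delta>" "\<And>j. \<delta> \<le> \<bar>ev j - lam\<bar>" "0 < \<delta>'" "\<And>j. \<delta>' \<le> \<bar>ev j - (- lam)\<bar>"
    using at_top_gap ev_ne by metis
  \<comment> \<open>The shifted eigenvalues are \<open>ev i + lam\<close> and
    \<open>lam - ev i\<close>, so the gaps are those of \<open>ev\<close> around
    \<open>- lam\<close> and around \<open>lam\<close>.\<close>
  have gap: "min \<delta> \<delta>' \<le> \<bar>\<mu> j + lam\<bar>" for j
  proof (cases "sum_decode j")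
    case (Inl i)
    then show ?thesis using \<delta>(4)[of i] by (simp add: \<mu>_def)
  next
    case (Inr i)
    then show ?thesis using \<delta>(2)[of i] by (simp add: \<mu>_def abs_minus_commute)
  qed

  have bijN: "bij_betw (\<lambda>v. opN \<nu> q v + lam *\<^sub>R v) (spaceA_pow \<Omega> \<nu> q 1) (spaceA \<Omega>)"
    by (rule bijN[OF \<nu>_ne])
  have bijS: "bij_betw (\<lambda>v. opS \<Omega> v + lam *\<^sub>R v) (spaceW \<Omega> 1) (spaceV \<Omega>)"
    using S.bij_shift[OF _ gap] \<delta>(1,3) by (simp add: V_H del: One_nat_def)
  have A1: "a \<in> spaceA \<Omega>" if "a \<in> spaceA_pow \<Omega> \<nu> q n" for a n
    using that by (simp add: spaceA_pow_def)
  have W1: "v \<in> spaceV \<Omega>" if "v \<in> spaceW \<Omega> n" for v n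
    using that spaceW_subset_spaceV by blast

  obtain fA fV where f: "f = fA + fV" "fA \<in> spaceA_pow \<Omega> \<nu> q k" "fV \<in> spaceW \<Omega> m"
    using assms(20) by (auto simp: spaceC_def)
  have fp: "orth_proj (spaceA \<Omega>) f = fA" "orth_proj (spaceV \<Omega>) f = fV"
    using orth_proj_sum[OF A1[OF f(2)] W1[OF f(3)]] by (simp_all add: f(1))
  obtain uA where uA: "uA \<in> spaceA_pow \<Omega> \<nu> q 1" "opN \<nu> q uA + lam *\<^sub>R uA = fA"
    using A1[OF f(2)] bij_betw_imp_surj_on[OF bijN] by (metis (no_types, lifting) imageE)
  obtain uV where uV: "uV \<in> spaceW \<Omega> 1" "opS \<Omega> uV + lam *\<^sub>R uV = fV"
    using W1[OF f(3)] bij_betw_imp_surj_on[OF bijS] by (metis (no_types, lifting) imageE)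
  have up: "orth_proj (spaceA \<Omega>) (uA + uV) = uA" "orth_proj (spaceV \<Omega>) (uA + uV) = uV"
    using orth_proj_sum[OF A1[OF uA(1)] W1[OF uV(1)]] by simp_all
  have uL2: "uA + uV \<in> L2 \<Omega>"
    using A1[OF uA(1)] W1[OF uV(1)] spaceA_subset_L2
    by (auto simp: spaceV_iff intro!: subspace_add[OF subspace_L2])
  \<comment> \<open>The zero trace is established outright, which covers the conditional form in
    \<open>solves_problem\<close>.\<close>
  have sol: "solves_problem \<Omega> \<nu> q lam f (uA + uV)"
    unfolding solves_problem_def Let_def up fp
    using uA uV uL2 trace_of_sum[OF uA(1) W1[OF uV(1)]] by blast
  have unique: "u = uA + uV" if u: "solves_problem \<Omega> \<nu> q lam f u" for u
  proof -
    have "u \<in> L2 \<Omega>"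
      using u by (simp add: solves_problem_def Let_def)
    then obtain a v where av: "a \<in> spaceA \<Omega>" "v \<in> spaceV \<Omega>" "u = a + v"
      by (rule decomposition)
    have p: "orth_proj (spaceA \<Omega>) u = a" "orth_proj (spaceV \<Omega>) u = v"
      using orth_proj_sum[OF av(1,2)] by (simp_all add: av(3))
    have s: "a \<in> spaceA_pow \<Omega> \<nu> q 1" "v \<in> spaceW \<Omega> 1"
      "opN \<nu> q a + lam *\<^sub>R a = fA" "opS \<Omega> v + lam *\<^sub>R v = fV"
      using u unfolding solves_problem_def Let_def p fp by blast+
    have "a = uA"
      using inj_onD[OF bij_betw_imp_inj_on[OF bijN] _ s(1) uA(1)] s(3) uA(2) by simp
    moreover have "v = uV"
      using inj_onD[OF bij_betw_imp_inj_on[OF bijS] _ s(2) uV(1)] s(4) uV(2) by simp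
    ultimately show ?thesis by (simp add: av(3))
  qed
  have rN: "resolventN \<Omega> \<nu> q lam fA = uA"
    unfolding resolventN_def by (rule the_inv_into_f_eq[OF bij_betw_imp_inj_on[OF bijN] uA(2,1)])
  have rS: "resolventS \<Omega> lam fV = uV"
    unfolding resolventS_def by (rule the_inv_into_f_eq[OF bij_betw_imp_inj_on[OF bijS] uV(2,1)])
  \<comment> \<open>Here the exponents \<open>k\<close> and \<open>m\<close> enter; existence and
    uniqueness used only that \<open>fA\<close> is a gradient and \<open>fV\<close> is
    solenoidal.\<close>
  have "uA \<in> spaceA_pow \<Omega> \<nu> q (k + 1)"
    using opN_shift_coeff[OF uA(1), of lam] uA(2) by (intro regularityN[OF \<nu>_ne A1[OF uA(1)] f(2)]) simp
  moreover have "uV \<in> spaceW \<Omega> (m + 1)"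
    using uV(2) f(3) by (intro regularityS[OF assms(1) uV(1), of lam]) simp
  ultimately have reg: "uA + uV \<in> spaceC \<Omega> \<nu> q (k + 1) (m + 1)"
    unfolding spaceC_def by blast
  show ?thesis
  proof (intro conjI allI impI bijN bijS)
    show "\<exists>!u. solves_problem \<Omega> \<nu> q lam f u"
      using sol unique by blast
    fix u assume "solves_problem \<Omega> \<nu> q lam f u"
    then have u: "u = uA + uV" by (rule unique)
    show "u = orth_proj (spaceA \<Omega>) u + orth_proj (spaceV \<Omega>) u"
      "orth_proj (spaceA \<Omega>) u = resolventN \<Omega> \<nu> q lam (orth_proj (spaceA \<Omega>) f)"
      "orth_proj (spaceV \<Omega>) u = resolventS \<Omega> lam (orth_proj (spaceV \<Omega>) f)"
      "u \<in> spaceC \<Omega> \<nu> q (k + 1) (m + 1)"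
      unfolding u up fp rN rS using reg by simp_all
  qed
qed

end
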